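(* Let $\mathbb K$ be a field with $\mathrm{Char}\,\mathbb K\ne2$ and $\sqrt{-1}\in\mathbb K$, and let $A=A(\mathbf q,\mathbf a)$ be a quantum complete intersection over $\mathbb K$. Then $A$ admits a bi-Frobenius algebra structure with permutation antipode if and only if $\mathcal N^2=\mathrm{Id}$ and there is a compatible permutation $\pi\in S_n$ with $\pi^2=\mathrm{Id}$ such that $|I_1|+|I_3|\ne0$ or $\frac{|J_3|}{2}$ is even, where $I_1,I_3,J_3$ are the subsets of $\{1,\dots,n\}$ determined by $\pi$ as defined in the context. If this is the case, then, for such $\pi$ and for some $c_i\in\mathbb K$ ($1\le i\le n$) with $c_ic_{\pi(i)}=h_{\mathbf e_i}$ for all $i$ and $q_\pi\prod_{1\le i\le n}c_i^{a_i-1}=1$, the quadruple $(A,\ x_{\mathbf a-\mathbf 1}^*,\ x_{\mathbf a-\mathbf 1},\ S)$ is a bi-Frobenius algebra, where the coalgebra structure $(\Delta,\varepsilon)$ and the map $S$ are those attached to $(\pi,c_1,\dots,c_n)$ as defined in the context.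
   Context: **Quantum complete intersections.** Let $\mathbb K$ be a field, $n\ge 2$ an integer, $\mathbf a=(a_1,\dots,a_n)$ an integer vector with all $a_i\ge 2$, and $\mathbf q=(q_{ij})$ an $n\times n$ matrix over $\mathbb K$ with $q_{ii}=1$ and $q_{ij}q_{ji}=1$ for all $i,j$. The quantum complete intersection $A=A(\mathbf q,\mathbf a)$ is the $\mathbb K$-algebra $\mathbb K\langle x_1,\dots,x_n\rangle/\langle x_i^{a_i},\ x_jx_i-q_{ij}x_ix_j,\ 1\le i,j\le n\rangle$. Put $V=\{\mathbf v=(v_1,\dots,v_n)\in\mathbb N_0^n: v_i\le a_i-1,\ 1\le i\le n\}$ and $x_{\mathbf v}=x_1^{v_1}\cdots x_n^{v_n}$. Then $\{x_{\mathbf v}:\mathbf v\in V\}$ is a $\mathbb K$-basis of $A$ (the standard basis); $\{x_{\mathbf v}^*\}$ denotes the dual basis of $A^*=\mathrm{Hom}_{\mathbb K}(A,\mathbb K)$. Write $\mathbf 0=(0,\dots,0)$, $\mathbf 1=(1,\dots,1)$, and $\mathbf e_i$ for the $i$-th unit vector. **Structure coefficients and $\mathcal N$.** For $\mathbf u,\mathbf v\in\mathbb Z^n$: $\mathbf q^{\langle\mathbf u|\mathbf v\rangle}=\prod_{1\le i<j\le n}q_{ij}^{u_jv_i}$ and $h_{\mathbf v}=\mathbf q^{\langle\mathbf a-\mathbf 1-\mathbf v|\mathbf v\rangle}/\mathbf q^{\langle\mathbf v|\mathbf a-\mathbf 1-\mathbf v\rangle}$; in particular $h_{\mathbf e_i}=\prod_{1\le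 j\le n}q_{ij}^{a_j-1}$. The canonical Nakayama automorphism $\mathcal N$ of $A$ is the Nakayama automorphism with respect to the Frobenius form $x_{\mathbf a-\mathbf 1}^*$ (i.e. $x^*_{\mathbf a-\mathbf 1}(xy)=x^*_{\mathbf a-\mathbf 1}(y\mathcal N(x))$); it is given by $\mathcal N(x_{\mathbf v})=h_{\mathbf v}x_{\mathbf v}$, $\mathbf v\in V$. Thus $\mathcal N^2=\mathrm{Id}$ iff $h_{\mathbf e_i}^2=1$ for all $i$. **Permutations.** $\pi\in S_n$ acts on $\mathbb Z^n$ by $\pi(\mathbf v)=(v_{\pi^{-1}(1)},\dots,v_{\pi^{-1}(n)})$, so $\pi(\mathbf e_i)=\mathbf e_{\pi(i)}$. It is compatible (with $A$) if $a_{\pi(i)}=a_i$ and $q_{\pi(i)\pi(j)}=q_{ji}$ for all $1\le i,j\le n$ (then $\pi$ maps $V$ to $V$). Put $q_\pi=\prod_{1\le j<k\le n}(\mathbf q^{\langle\pi(\mathbf e_k)|\pi(\mathbf e_j)\rangle})^{(a_k-1)(a_j-1)}$. **The index sets.** For a compatible $\pi$ with $\pi^2=\mathrm{Id}$, let $I=\{i:\pi(i)=i\}$, $J=\{i:\pi(i)\ne i\}$ (subsets of $\{1,\dots,n\}$), and $I_1=\{i\in I: h_{\mathbf e_i}=1,\ a_i\text{ even}\}$, $I_3=\{i\in I:h_{\mathbf e_i}=-1,\ a_i\text{ even}\}$, $J_3=\{i\in J:h_{\mathbf e_i}=-1,\ a_i\text{ even}\}$. ($|X|$ is the cardinality of $X$.)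 **Bi-Frobenius algebras.** Let $A$ be a finite-dimensional algebra which is also a coalgebra $(A,\Delta,\varepsilon)$ over $\mathbb K$, let $t\in A$, $\phi\in A^*$, and let $S:A\to A$ be the linear map $S(a)=\sum\phi(t_1a)t_2$ (Sweedler notation $\Delta(t)=\sum t_1\otimes t_2$). $(A,\phi,t,S)$ is a bi-Frobenius algebra (with antipode $S$) if: (i) $\varepsilon$ is an algebra homomorphism and $\Delta(1_A)=1_A\otimes 1_A$; (ii) $(A,\phi)$ is a Frobenius algebra, i.e. every element of $A^*$ has the form $x\mapsto\phi(bx)$ for some $b\in A$, and $(A,t)$ is a Frobenius coalgebra, i.e. $A=\{\sum f(t_1)t_2: f\in A^*\}$; (iii) $S$ is an algebra anti-homomorphism ($S(1)=1$, $S(ab)=S(b)S(a)$) and a coalgebra anti-homomorphism ($\varepsilon\circ S=\varepsilon$, $\Delta(S(a))=\sum S(a_2)\otimes S(a_1)$). A bi-Frobenius algebra structure on the algebra $A$ is a choice of coalgebra structure, $\phi$, $t$ making $(A,\phi,t,S)$ a bi-Frobenius algebra. **Permutation antipode.** For a bi-Frobenius algebra structure on $A(\mathbf q,\mathbf a)$, $S$ is a permutation antipode if there are a permutation $\pi$ of the set $V$ and $c_{\mathbf v}\in\mathbb K$ ($\mathbf v\in V$) with $S(x_{\mathbf v})=c_{\mathbf v}x_{\pi(\mathbf v)}$ for all $\mathbf v\in V$. **Structure attached to $(\pi,c_1,\dots,c_n)$.** Let $\pi\in S_n$ be compatible with $\pi^2=\mathrm{Id}$ and $c_i\in\mathbb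 K$ with $c_ic_{\pi(i)}=h_{\mathbf e_i}$ for all $i$ and $q_\pi\prod_ic_i^{a_i-1}=1$. For $\mathbf v\in V$ put $$g_{\mathbf a-\mathbf 1-\mathbf v,\pi(\mathbf v)}=\frac{1}{\mathbf q^{\langle\mathbf a-\mathbf 1-\mathbf v|\mathbf v\rangle}}\prod_{1\le i\le n}c_i^{v_i}\prod_{1\le j<k\le n}(\mathbf q^{\langle\pi(\mathbf e_k)|\pi(\mathbf e_j)\rangle})^{v_jv_k}.$$ Define linear maps: $\varepsilon(x_{\mathbf v})=\delta_{\mathbf v,\mathbf 0}$; $\Delta(1_A)=1_A\otimes1_A$; $\Delta(x_{\mathbf v})=1_A\otimes x_{\mathbf v}+x_{\mathbf v}\otimes1_A$ for $\mathbf v\in V\setminus\{\mathbf 0,\mathbf a-\mathbf 1\}$; $\Delta(x_{\mathbf a-\mathbf 1})=\sum_{\mathbf v\in V}g_{\mathbf a-\mathbf 1-\mathbf v,\pi(\mathbf v)}\,x_{\mathbf a-\mathbf 1-\mathbf v}\otimes x_{\pi(\mathbf v)}$; and $$S(x_{\mathbf v})=\prod_{1\le i\le n}c_i^{v_i}\prod_{1\le j<k\le n}(\mathbf q^{\langle\pi(\mathbf e_k)|\pi(\mathbf e_j)\rangle})^{v_jv_k}\,x_{\pi(\mathbf v)},\quad\mathbf v\in V.$$ *)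

theory Defs
  imports
    "Jordan_Normal_Form.VS_Connect"
    "HOL-Algebra.QuotRing"
    "HOL-Combinatorics.Permutations"
begin

hide_const (open) Modules.module_hom

section \<open>Vector spaces over a type-class field: quotients, duals, tensor products\<close>

text \<open>The ground field is a type \<^typ>\<open>'k::field\<close>, seen as the \<^theory>\<open>HOL-Algebra.Ring\<close> record
  \<^term>\<open>class_ring :: 'k::field ring\<close>.\<close>

definition scalar_space :: "('k::field, 'k) module" where
  "scalar_space = ring.extend class_ring (module.fields (*))"

definition dual_space :: "('k::field, 'a) module \<Rightarrow> ('a \<Rightarrow> 'k) set" where
  "dual_space M = module_hom class_ring M scalar_space"

definition quotient_module :: "('k, 'a) module \<Rightarrow> 'a set \<Rightarrow> ('k, 'a set) module" where
  "quotient_module M U =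
     ring.extend (M Quot U) (module.fields (\<lambda>c C. \<Union>x\<in>C. U +>\<^bsub>M\<^esub> (c \<odot>\<^bsub>M\<^esub> x)))"

text \<open>The vector space with basis \<open>X\<close>. A \<^type>\<open>module\<close> record carries a multiplication and a unit,
  which play no role here.\<close>

definition free_space :: "'x set \<Rightarrow> ('k::field, 'x \<Rightarrow> 'k) module" where
  "free_space X =
     \<lparr>carrier = {f. finite {x. f x \<noteq> 0} \<and> {x. f x \<noteq> 0} \<subseteq> X},
      mult = (\<lambda>f g x. 0), one = (\<lambda>x. 0), zero = (\<lambda>x. 0),
      add = (\<lambda>f g x. f x + g x), smult = (\<lambda>c f x. c * f x)\<rparr>"

definition single :: "'x \<Rightarrow> 'x \<Rightarrow> 'k::field" where
  "single x = (\<lambda>y. if y = x then 1 else 0)"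

abbreviation pair_space :: "('k::field, 'a) module \<Rightarrow> ('k, 'b) module \<Rightarrow> ('k, 'a \<times> 'b \<Rightarrow> 'k) module" where
  "pair_space M N \<equiv> free_space (carrier M \<times> carrier N)"

definition bilinear_relations ::
    "('k::field, 'a) module \<Rightarrow> ('k, 'b) module \<Rightarrow> ('a \<times> 'b \<Rightarrow> 'k) set" where
  "bilinear_relations M N =
     {single (x \<oplus>\<^bsub>M\<^esub> x', y) \<ominus>\<^bsub>pair_space M N\<^esub> (single (x, y) \<oplus>\<^bsub>pair_space M N\<^esub> single (x', y))
        | x x' y. x \<in> carrier M \<and> x' \<in> carrier M \<and> y \<in> carrier N}
   \<union> {single (x, y \<oplus>\<^bsub>N\<^esub> y') \<ominus>\<^bsub>pair_space M N\<^esub> (single (x, y) \<oplus>\<^bsub>pair_space M N\<^esub> single (x, y'))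
        | x y y'. x \<in> carrier M \<and> y \<in> carrier N \<and> y' \<in> carrier N}
   \<union> {single (c \<odot>\<^bsub>M\<^esub> x, y) \<ominus>\<^bsub>pair_space M N\<^esub> (c \<odot>\<^bsub>pair_space M N\<^esub> single (x, y))
        | c x y. x \<in> carrier M \<and> y \<in> carrier N}
   \<union> {single (x, c \<odot>\<^bsub>N\<^esub> y) \<ominus>\<^bsub>pair_space M N\<^esub> (c \<odot>\<^bsub>pair_space M N\<^esub> single (x, y))
        | c x y. x \<in> carrier M \<and> y \<in> carrier N}"

definition tensor_kernel ::
    "('k::field, 'a) module \<Rightarrow> ('k, 'b) module \<Rightarrow> ('a \<times> 'b \<Rightarrow> 'k) set" where
  "tensor_kernel M N =
     LinearCombinations.module.span class_ring (pair_space M N) (bilinear_relations M N)"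

definition tensor ::
    "('k::field, 'a) module \<Rightarrow> ('k, 'b) module \<Rightarrow> ('k, ('a \<times> 'b \<Rightarrow> 'k) set) module" where
  "tensor M N = quotient_module (pair_space M N) (tensor_kernel M N)"

definition pure ::
    "('k::field, 'a) module \<Rightarrow> ('k, 'b) module \<Rightarrow> 'a \<Rightarrow> 'b \<Rightarrow> ('a \<times> 'b \<Rightarrow> 'k) set" where
  "pure M N x y = tensor_kernel M N +>\<^bsub>pair_space M N\<^esub> single (x, y)"

text \<open>The linear map \<open>M \<otimes> N \<rightarrow> P\<close> induced by a bilinear map \<open>\<beta>\<close>: the value on a coset is the
  common value of \<open>\<beta>\<close>, extended linearly, on its representatives. The Sweedler expression
  \<open>\<Sum> \<beta>(t\<^sub>1, t\<^sub>2)\<close> with \<open>\<Delta>(t) = \<Sum> t\<^sub>1 \<otimes> t\<^sub>2\<close> is \<open>tensor_lift C C P \<beta> (\<Delta> t)\<close>.\<close>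

definition tensor_lift ::
    "('k::field, 'a) module \<Rightarrow> ('k, 'b) module \<Rightarrow> ('k, 'p) module \<Rightarrow> ('a \<Rightarrow> 'b \<Rightarrow> 'p)
      \<Rightarrow> ('a \<times> 'b \<Rightarrow> 'k) set \<Rightarrow> 'p" where
  "tensor_lift M N P \<beta> T =
     the_elem ((\<lambda>f. \<Oplus>\<^bsub>P\<^esub>p\<in>{p. f p \<noteq> 0}. f p \<odot>\<^bsub>P\<^esub> \<beta> (fst p) (snd p)) ` T)"

definition tensor_map ::
    "('k::field, 'a) module \<Rightarrow> ('k, 'b) module \<Rightarrow> ('k, 'c) module \<Rightarrow> ('k, 'd) module
      \<Rightarrow> ('a \<Rightarrow> 'c) \<Rightarrow> ('b \<Rightarrow> 'd) \<Rightarrow> ('a \<times> 'b \<Rightarrow> 'k) set \<Rightarrow> ('c \<times> 'd \<Rightarrow> 'k) set" where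
  "tensor_map M N M' N' f g = tensor_lift M N (tensor M' N') (\<lambda>x y. pure M' N' (f x) (g y))"

text \<open>The canonical isomorphism \<open>(C \<otimes> C) \<otimes> C \<rightarrow> C \<otimes> (C \<otimes> C)\<close>.\<close>

definition tensor_assoc ::
    "('k::field, 'a) module \<Rightarrow> (('a \<times> 'a \<Rightarrow> 'k) set \<times> 'a \<Rightarrow> 'k) set
      \<Rightarrow> ('a \<times> ('a \<times> 'a \<Rightarrow> 'k) set \<Rightarrow> 'k) set" where
  "tensor_assoc C =
     tensor_lift (tensor C C) C (tensor C (tensor C C))
       (\<lambda>s z. tensor_lift C C (tensor C (tensor C C))
          (\<lambda>x y. pure C (tensor C C) x (pure C C y z)) s)"


section \<open>Bi-Frobenius algebras\<close>

locale fin_dim_algebra =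
  fixes A :: "('k::field, 'a) module" (structure)
  assumes vectorspace_A: "vectorspace class_ring A"
    and ring_A: "ring A"
    and smult_mult_left:
      "\<And>c x y. x \<in> carrier A \<Longrightarrow> y \<in> carrier A \<Longrightarrow> (c \<odot> x) \<otimes> y = c \<odot> (x \<otimes> y)"
    and smult_mult_right:
      "\<And>c x y. x \<in> carrier A \<Longrightarrow> y \<in> carrier A \<Longrightarrow> x \<otimes> (c \<odot> y) = c \<odot> (x \<otimes> y)"
    and fin_dim: "vectorspace.fin_dim class_ring A"

locale coalgebra =
  fixes C :: "('k::field, 'a) module" (structure)
    and \<Delta> :: "'a \<Rightarrow> ('a \<times> 'a \<Rightarrow> 'k) set"
    and \<epsilon> :: "'a \<Rightarrow> 'k"
  assumes vectorspace_C: "vectorspace class_ring C"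
    and comult_linear: "\<Delta> \<in> module_hom class_ring C (tensor C C)"
    and counit_linear: "\<epsilon> \<in> dual_space C"
    and coassoc:
      "\<And>x. x \<in> carrier C \<Longrightarrow>
         tensor_assoc C (tensor_map C C (tensor C C) C \<Delta> (\<lambda>y. y) (\<Delta> x))
         = tensor_map C C C (tensor C C) (\<lambda>y. y) \<Delta> (\<Delta> x)"
    and counit_left: "\<And>x. x \<in> carrier C \<Longrightarrow> tensor_lift C C C (\<lambda>y z. \<epsilon> y \<odot> z) (\<Delta> x) = x"
    and counit_right: "\<And>x. x \<in> carrier C \<Longrightarrow> tensor_lift C C C (\<lambda>y z. \<epsilon> z \<odot> y) (\<Delta> x) = x"

definition frobenius_algebra :: "('k::field, 'a) module \<Rightarrow> ('a \<Rightarrow> 'k) \<Rightarrow> bool" where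
  "frobenius_algebra A \<phi> \<longleftrightarrow>
     \<phi> \<in> dual_space A \<and>
     (\<forall>f\<in>dual_space A. \<exists>b\<in>carrier A. \<forall>x\<in>carrier A. f x = \<phi> (b \<otimes>\<^bsub>A\<^esub> x))"

definition frobenius_coalgebra ::
    "('k::field, 'a) module \<Rightarrow> ('a \<Rightarrow> ('a \<times> 'a \<Rightarrow> 'k) set) \<Rightarrow> 'a \<Rightarrow> bool" where
  "frobenius_coalgebra C \<Delta> t \<longleftrightarrow>
     t \<in> carrier C \<and>
     carrier C = {tensor_lift C C C (\<lambda>x y. f x \<odot>\<^bsub>C\<^esub> y) (\<Delta> t) | f. f \<in> dual_space C}"

locale bi_frobenius_algebra =
  fin_dim_algebra A + coalgebra A \<Delta> \<epsilon>
  for A :: "('k::field, 'a) module" (structure)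
    and \<Delta> :: "'a \<Rightarrow> ('a \<times> 'a \<Rightarrow> 'k) set"
    and \<epsilon> :: "'a \<Rightarrow> 'k" +
  fixes \<phi> :: "'a \<Rightarrow> 'k" and t :: 'a and S :: "'a \<Rightarrow> 'a"
  assumes S_eq:
      "\<And>a. a \<in> carrier A \<Longrightarrow> S a = tensor_lift A A A (\<lambda>t\<^sub>1 t\<^sub>2. \<phi> (t\<^sub>1 \<otimes> a) \<odot> t\<^sub>2) (\<Delta> t)"
    and counit_hom: "\<epsilon> \<in> Ring.ring_hom A class_ring"
    and comult_one: "\<Delta> \<one> = pure A A \<one> \<one>"
    and frobenius_algebra: "frobenius_algebra A \<phi>"
    and frobenius_coalgebra: "frobenius_coalgebra A \<Delta> t"
    and S_one: "S \<one> = \<one>"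
    and S_mult: "\<And>a b. a \<in> carrier A \<Longrightarrow> b \<in> carrier A \<Longrightarrow> S (a \<otimes> b) = S b \<otimes> S a"
    and counit_S: "\<And>a. a \<in> carrier A \<Longrightarrow> \<epsilon> (S a) = \<epsilon> a"
    and comult_S:
      "\<And>a. a \<in> carrier A \<Longrightarrow>
         \<Delta> (S a) = tensor_lift A A (tensor A A) (\<lambda>a\<^sub>1 a\<^sub>2. pure A A (S a\<^sub>2) (S a\<^sub>1)) (\<Delta> a)"

definition nakayama_automorphism :: "('k::field, 'a) module \<Rightarrow> ('a \<Rightarrow> 'k) \<Rightarrow> 'a \<Rightarrow> 'a" where
  "nakayama_automorphism A \<phi> x =
     (THE z. z \<in> carrier A \<and> (\<forall>y\<in>carrier A. \<phi> (x \<otimes>\<^bsub>A\<^esub> y) = \<phi> (y \<otimes>\<^bsub>A\<^esub> z)))"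


section \<open>Quantum complete intersections\<close>

text \<open>Noncommutative polynomials in the letters \<open>X\<close>: finitely supported coefficient functions
  on words.\<close>

definition free_algebra :: "'x set \<Rightarrow> ('k::field, 'x list \<Rightarrow> 'k) module" where
  "free_algebra X =
     \<lparr>carrier = {f. finite {w. f w \<noteq> 0} \<and> {w. f w \<noteq> 0} \<subseteq> lists X},
      mult = (\<lambda>f g w. \<Sum>i\<le>length w. f (take i w) * g (drop i w)),
      one = single [], zero = (\<lambda>w. 0),
      add = (\<lambda>f g w. f w + g w), smult = (\<lambda>c f w. c * f w)\<rparr>"

text \<open>Vectors indexed by \<open>{1..n}\<close> are functions on \<^typ>\<open>nat\<close>; those in \<open>V\<close> vanish outside
  \<open>{1..n}\<close>, so that \<open>V\<close> is a finite set in bijection with the actual exponent vectors.\<close>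

definition qci_relations ::
    "nat \<Rightarrow> (nat \<Rightarrow> nat \<Rightarrow> 'k::field) \<Rightarrow> (nat \<Rightarrow> int) \<Rightarrow> (nat list \<Rightarrow> 'k) set" where
  "qci_relations n q a = (let F = free_algebra {1..n} in
     {single [i] [^]\<^bsub>F\<^esub> nat (a i) | i. i \<in> {1..n}}
   \<union> {(single [j] \<otimes>\<^bsub>F\<^esub> single [i]) \<ominus>\<^bsub>F\<^esub> (q i j \<odot>\<^bsub>F\<^esub> (single [i] \<otimes>\<^bsub>F\<^esub> single [j]))
        | i j. i \<in> {1..n} \<and> j \<in> {1..n}})"

definition qci_ideal ::
    "nat \<Rightarrow> (nat \<Rightarrow> nat \<Rightarrow> 'k::field) \<Rightarrow> (nat \<Rightarrow> int) \<Rightarrow> (nat list \<Rightarrow> 'k) set" where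
  "qci_ideal n q a = Idl\<^bsub>free_algebra {1..n}\<^esub> (qci_relations n q a)"

definition qci ::
    "nat \<Rightarrow> (nat \<Rightarrow> nat \<Rightarrow> 'k::field) \<Rightarrow> (nat \<Rightarrow> int) \<Rightarrow> ('k, (nat list \<Rightarrow> 'k) set) module" where
  "qci n q a = quotient_module (free_algebra {1..n}) (qci_ideal n q a)"

definition qci_gen ::
    "nat \<Rightarrow> (nat \<Rightarrow> nat \<Rightarrow> 'k::field) \<Rightarrow> (nat \<Rightarrow> int) \<Rightarrow> nat \<Rightarrow> (nat list \<Rightarrow> 'k) set" where
  "qci_gen n q a i = qci_ideal n q a +>\<^bsub>free_algebra {1..n}\<^esub> single [i]"

definition exponents :: "nat \<Rightarrow> (nat \<Rightarrow> int) \<Rightarrow> (nat \<Rightarrow> int) set" where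
  "exponents n a =
     {v. (\<forall>i\<in>{1..n}. 0 \<le> v i \<and> v i \<le> a i - 1) \<and> (\<forall>i. i \<notin> {1..n} \<longrightarrow> v i = 0)}"

definition basis_vec :: "nat \<Rightarrow> nat \<Rightarrow> int" where
  "basis_vec i = (\<lambda>j. if j = i then 1 else 0)"

definition co_vec :: "nat \<Rightarrow> (nat \<Rightarrow> int) \<Rightarrow> (nat \<Rightarrow> int) \<Rightarrow> nat \<Rightarrow> int" where
  \<comment> \<open>the vector \<open>a - 1 - v\<close>\<close>
  "co_vec n a v = (\<lambda>i. if i \<in> {1..n} then a i - 1 - v i else 0)"

abbreviation top_vec :: "nat \<Rightarrow> (nat \<Rightarrow> int) \<Rightarrow> nat \<Rightarrow> int" where
  "top_vec n a \<equiv> co_vec n a (\<lambda>i. 0)"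

text \<open>The monomial \<open>x\<^sub>1\<^bsup>v\<^sub>1\<^esup> \<cdots> x\<^sub>n\<^bsup>v\<^sub>n\<^esup>\<close>, in this order.\<close>

definition qci_monom ::
    "nat \<Rightarrow> (nat \<Rightarrow> nat \<Rightarrow> 'k::field) \<Rightarrow> (nat \<Rightarrow> int) \<Rightarrow> (nat \<Rightarrow> int) \<Rightarrow> (nat list \<Rightarrow> 'k) set" where
  "qci_monom n q a v =
     foldr (\<lambda>i y. (qci_gen n q a i [^]\<^bsub>qci n q a\<^esub> nat (v i)) \<otimes>\<^bsub>qci n q a\<^esub> y) [1..<Suc n]
       \<one>\<^bsub>qci n q a\<^esub>"

text \<open>The dual \<open>x\<^sub>v\<^sup>*\<close> of the standard basis: \<open>qci_dual n q a v x\<close> is the coefficient of \<open>x\<^sub>v\<close> in \<open>x\<close>.\<close>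

definition qci_dual ::
    "nat \<Rightarrow> (nat \<Rightarrow> nat \<Rightarrow> 'k::field) \<Rightarrow> (nat \<Rightarrow> int) \<Rightarrow> (nat \<Rightarrow> int)
      \<Rightarrow> (nat list \<Rightarrow> 'k) set \<Rightarrow> 'k" where
  "qci_dual n q a v x =
     (THE \<alpha>. \<alpha> \<in> exponents n a \<rightarrow>\<^sub>E UNIV \<and>
        x = (\<Oplus>\<^bsub>qci n q a\<^esub>u\<in>exponents n a. \<alpha> u \<odot>\<^bsub>qci n q a\<^esub> qci_monom n q a u)) v"

text \<open>The linear map \<open>A \<rightarrow> P\<close> with \<open>x\<^sub>v \<mapsto> f v\<close> for \<open>v \<in> V\<close>.\<close>

definition qci_linear ::
    "nat \<Rightarrow> (nat \<Rightarrow> nat \<Rightarrow> 'k::field) \<Rightarrow> (nat \<Rightarrow> int) \<Rightarrow> ('k, 'p) module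
      \<Rightarrow> ((nat \<Rightarrow> int) \<Rightarrow> 'p) \<Rightarrow> (nat list \<Rightarrow> 'k) set \<Rightarrow> 'p" where
  "qci_linear n q a P f x = (\<Oplus>\<^bsub>P\<^esub>v\<in>exponents n a. qci_dual n q a v x \<odot>\<^bsub>P\<^esub> f v)"

definition qci_nakayama ::
    "nat \<Rightarrow> (nat \<Rightarrow> nat \<Rightarrow> 'k::field) \<Rightarrow> (nat \<Rightarrow> int)
      \<Rightarrow> (nat list \<Rightarrow> 'k) set \<Rightarrow> (nat list \<Rightarrow> 'k) set" where
  "qci_nakayama n q a = nakayama_automorphism (qci n q a) (qci_dual n q a (top_vec n a))"

definition permutation_antipode ::
    "nat \<Rightarrow> (nat \<Rightarrow> nat \<Rightarrow> 'k::field) \<Rightarrow> (nat \<Rightarrow> int)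
      \<Rightarrow> ((nat list \<Rightarrow> 'k) set \<Rightarrow> (nat list \<Rightarrow> 'k) set) \<Rightarrow> bool" where
  "permutation_antipode n q a S \<longleftrightarrow>
     (\<exists>\<sigma> c. bij_betw \<sigma> (exponents n a) (exponents n a) \<and>
        (\<forall>v\<in>exponents n a. S (qci_monom n q a v) = c v \<odot>\<^bsub>qci n q a\<^esub> qci_monom n q a (\<sigma> v)))"


section \<open>The structure attached to a compatible permutation\<close>

text \<open>\<open>q\<^bsup>\<langle>u|v\<rangle>\<^esup>\<close> and \<open>h\<^sub>v\<close>.\<close>

definition q_pow ::
    "nat \<Rightarrow> (nat \<Rightarrow> nat \<Rightarrow> 'k::field) \<Rightarrow> (nat \<Rightarrow> int) \<Rightarrow> (nat \<Rightarrow> int) \<Rightarrow> 'k" where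
  "q_pow n q u v = (\<Prod>(i, j)\<in>{(i, j). 1 \<le> i \<and> i < j \<and> j \<le> n}. q i j powi (u j * v i))"

definition h_coeff ::
    "nat \<Rightarrow> (nat \<Rightarrow> nat \<Rightarrow> 'k::field) \<Rightarrow> (nat \<Rightarrow> int) \<Rightarrow> (nat \<Rightarrow> int) \<Rightarrow> 'k" where
  "h_coeff n q a v = q_pow n q (co_vec n a v) v / q_pow n q v (co_vec n a v)"

definition perm_act :: "(nat \<Rightarrow> nat) \<Rightarrow> (nat \<Rightarrow> int) \<Rightarrow> nat \<Rightarrow> int" where
  "perm_act \<pi> v = (\<lambda>i. v (inv_into UNIV \<pi> i))"

definition compatible ::
    "nat \<Rightarrow> (nat \<Rightarrow> nat \<Rightarrow> 'k::field) \<Rightarrow> (nat \<Rightarrow> int) \<Rightarrow> (nat \<Rightarrow> nat) \<Rightarrow> bool" where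
  "compatible n q a \<pi> \<longleftrightarrow>
     \<pi> permutes {1..n} \<and>
     (\<forall>i\<in>{1..n}. \<forall>j\<in>{1..n}. a (\<pi> i) = a i \<and> q (\<pi> i) (\<pi> j) = q j i)"

definition q_perm ::
    "nat \<Rightarrow> (nat \<Rightarrow> nat \<Rightarrow> 'k::field) \<Rightarrow> (nat \<Rightarrow> int) \<Rightarrow> (nat \<Rightarrow> nat) \<Rightarrow> 'k" where
  "q_perm n q a \<pi> =
     (\<Prod>(j, k)\<in>{(j, k). 1 \<le> j \<and> j < k \<and> k \<le> n}.
        q_pow n q (perm_act \<pi> (basis_vec k)) (perm_act \<pi> (basis_vec j)) powi ((a k - 1) * (a j - 1)))"

text \<open>The scalar by which \<open>S\<close> takes \<open>x\<^sub>v\<close> to \<open>x\<close> with exponent \<open>\<pi>(v)\<close>.\<close>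

definition s_coeff ::
    "nat \<Rightarrow> (nat \<Rightarrow> nat \<Rightarrow> 'k::field) \<Rightarrow> (nat \<Rightarrow> nat) \<Rightarrow> (nat \<Rightarrow> 'k) \<Rightarrow> (nat \<Rightarrow> int) \<Rightarrow> 'k" where
  "s_coeff n q \<pi> c v =
     (\<Prod>i\<in>{1..n}. c i powi v i) *
     (\<Prod>(j, k)\<in>{(j, k). 1 \<le> j \<and> j < k \<and> k \<le> n}.
        q_pow n q (perm_act \<pi> (basis_vec k)) (perm_act \<pi> (basis_vec j)) powi (v j * v k))"

definition g_coeff ::
    "nat \<Rightarrow> (nat \<Rightarrow> nat \<Rightarrow> 'k::field) \<Rightarrow> (nat \<Rightarrow> int) \<Rightarrow> (nat \<Rightarrow> nat) \<Rightarrow> (nat \<Rightarrow> 'k)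
      \<Rightarrow> (nat \<Rightarrow> int) \<Rightarrow> 'k" where
  "g_coeff n q a \<pi> c v = 1 / q_pow n q (co_vec n a v) v * s_coeff n q \<pi> c v"

definition qci_counit ::
    "nat \<Rightarrow> (nat \<Rightarrow> nat \<Rightarrow> 'k::field) \<Rightarrow> (nat \<Rightarrow> int) \<Rightarrow> (nat list \<Rightarrow> 'k) set \<Rightarrow> 'k" where
  "qci_counit n q a =
     qci_linear n q a scalar_space (\<lambda>v. if v = (\<lambda>i. 0) then 1 else 0)"

definition qci_comult ::
    "nat \<Rightarrow> (nat \<Rightarrow> nat \<Rightarrow> 'k::field) \<Rightarrow> (nat \<Rightarrow> int) \<Rightarrow> (nat \<Rightarrow> nat) \<Rightarrow> (nat \<Rightarrow> 'k)
      \<Rightarrow> (nat list \<Rightarrow> 'k) set \<Rightarrow> ((nat list \<Rightarrow> 'k) set \<times> (nat list \<Rightarrow> 'k) set \<Rightarrow> 'k) set" where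
  "qci_comult n q a \<pi> c = (let A = qci n q a; x = qci_monom n q a in
     qci_linear n q a (tensor A A)
       (\<lambda>v. if v = (\<lambda>i. 0) then pure A A \<one>\<^bsub>A\<^esub> \<one>\<^bsub>A\<^esub>
            else if v = top_vec n a then
              (\<Oplus>\<^bsub>tensor A A\<^esub>u\<in>exponents n a.
                 g_coeff n q a \<pi> c u \<odot>\<^bsub>tensor A A\<^esub> pure A A (x (co_vec n a u)) (x (perm_act \<pi> u)))
            else pure A A \<one>\<^bsub>A\<^esub> (x v) \<oplus>\<^bsub>tensor A A\<^esub> pure A A (x v) \<one>\<^bsub>A\<^esub>))"

definition qci_antipode ::
    "nat \<Rightarrow> (nat \<Rightarrow> nat \<Rightarrow> 'k::field) \<Rightarrow> (nat \<Rightarrow> int) \<Rightarrow> (nat \<Rightarrow> nat) \<Rightarrow> (nat \<Rightarrow> 'k)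
      \<Rightarrow> (nat list \<Rightarrow> 'k) set \<Rightarrow> (nat list \<Rightarrow> 'k) set" where
  "qci_antipode n q a \<pi> c =
     qci_linear n q a (qci n q a)
       (\<lambda>v. s_coeff n q \<pi> c v \<odot>\<^bsub>qci n q a\<^esub> qci_monom n q a (perm_act \<pi> v))"

definition index_I :: "nat \<Rightarrow> (nat \<Rightarrow> nat) \<Rightarrow> nat set" where
  "index_I n \<pi> = {i \<in> {1..n}. \<pi> i = i}"

definition index_J :: "nat \<Rightarrow> (nat \<Rightarrow> nat) \<Rightarrow> nat set" where
  "index_J n \<pi> = {i \<in> {1..n}. \<pi> i \<noteq> i}"

definition index_I1 ::
    "nat \<Rightarrow> (nat \<Rightarrow> nat \<Rightarrow> 'k::field) \<Rightarrow> (nat \<Rightarrow> int) \<Rightarrow> (nat \<Rightarrow> nat) \<Rightarrow> nat set" where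
  "index_I1 n q a \<pi> = {i \<in> index_I n \<pi>. h_coeff n q a (basis_vec i) = 1 \<and> even (a i)}"

definition index_I3 ::
    "nat \<Rightarrow> (nat \<Rightarrow> nat \<Rightarrow> 'k::field) \<Rightarrow> (nat \<Rightarrow> int) \<Rightarrow> (nat \<Rightarrow> nat) \<Rightarrow> nat set" where
  "index_I3 n q a \<pi> = {i \<in> index_I n \<pi>. h_coeff n q a (basis_vec i) = - 1 \<and> even (a i)}"

definition index_J3 ::
    "nat \<Rightarrow> (nat \<Rightarrow> nat \<Rightarrow> 'k::field) \<Rightarrow> (nat \<Rightarrow> int) \<Rightarrow> (nat \<Rightarrow> nat) \<Rightarrow> nat set" where
  "index_J3 n q a \<pi> = {i \<in> index_J n \<pi>. h_coeff n q a (basis_vec i) = - 1 \<and> even (a i)}"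

text \<open>\<open>|J\<^sub>3|\<close> is even when \<open>\<pi>\<close> is compatible with square the identity, as \<open>\<pi>\<close> acts on
  \<open>J\<^sub>3\<close> without fixed points; so the division below is exact.\<close>

definition admissible ::
    "nat \<Rightarrow> (nat \<Rightarrow> nat \<Rightarrow> 'k::field) \<Rightarrow> (nat \<Rightarrow> int) \<Rightarrow> (nat \<Rightarrow> nat) \<Rightarrow> bool" where
  "admissible n q a \<pi> \<longleftrightarrow>
     compatible n q a \<pi> \<and> \<pi> \<circ> \<pi> = id \<and>
     (card (index_I1 n q a \<pi>) + card (index_I3 n q a \<pi>) \<noteq> 0 \<or> even (card (index_J3 n q a \<pi>) div 2))"

end

theory Submission
  imports Defs
begin

text \<open>Let \<open>A\<close> be the quantum complete intersection and \<open>x\<^sub>v\<close> its standard monomials. Everything rests on the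
  rule \<open>x\<^sub>u x\<^sub>v = q\<^bsup>\<langle>u|v\<rangle>\<^esup> x\<^bsub>u+v\<^esub>\<close>, read as \<open>0\<close> when \<open>u + v\<close> leaves \<open>V\<close> (\<open>monom_mult\<close>). Sorting words shows that
  the monomials span \<open>A\<close>; they are independent because the coefficient functionals that this rule
  predicts on the free algebra have an ideal as common kernel (\<open>I_lcoef\<close>, \<open>monom_expansion\<close>). Maps out of
  tensor products are handled through the universal property (\<open>tensor_lift_linear\<close>,
  \<open>linear_maps_eq_on_pures\<close>).

  \<^bold>\<open>Existence.\<close> Fix a compatible involution \<open>\<pi>\<close> and scalars with \<open>c\<^sub>i c\<^bsub>\<pi>(i)\<^esub> = h\<^sub>i\<close>, where
  \<open>h\<^sub>i\<close> is \<open>h\<close> at the \<open>i\<close>-th unit vector, and let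
  \<open>S(x\<^sub>v) = s\<^sub>v x\<^bsub>\<pi>(v)\<^esub>\<close>. Between \<open>1\<close> and the top monomial all monomials are primitive, so coassociativity only
  concerns the top monomial, where it amounts to inserting \<open>1\<close> in one of three places
  (\<open>coassociative\<close>). The coefficients of \<open>\<Delta>(x\<^bsub>a-1\<^esub>)\<close> are chosen so that \<open>S(y) = \<Sum> \<phi>(t\<^sub>1 y) t\<^sub>2\<close>. The two
  antipode laws come from two identities: \<open>s_add\<close> says that \<open>S\<close> reverses products, and
  \<open>s_perm\<close> says \<open>S\<^sup>2(x\<^sub>v) = h\<^sub>v x\<^sub>v\<close>, which makes \<open>S\<close> reverse \<open>\<Delta>(x\<^bsub>a-1\<^esub>)\<close>. What remains is the normalization
  \<open>s\<^bsub>a-1\<^esub> = q\<^sub>\<pi> \<Prod> c\<^sub>i\<^bsup>a\<^sub>i-1\<^esup> = 1\<close>. By \<open>s_perm\<close> its square is \<open>h\<^bsub>a-1\<^esub> = 1\<close>, so only a sign is in question. If some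
  fixed index has \<open>a\<^sub>i\<close> even, i.e. \<open>|I\<^sub>1| + |I\<^sub>3| \<noteq> 0\<close>, then changing the sign of \<open>c\<^sub>i\<close> repairs it. Otherwise
  the product collapses orbit by orbit to \<open>(-1)\<^bsup>|J\<^sub>3|/2\<^esup>\<close> for every choice of the \<open>c\<^sub>i\<close>
  (\<open>s_top_no_even_fixed\<close>).

  \<^bold>\<open>Necessity.\<close> Let \<open>(A, \<phi>, t, S)\<close> be bi-Frobenius with \<open>S(x\<^sub>v) = c\<^sub>v x\<^bsub>\<sigma>(v)\<^esub>\<close>. From \<open>\<epsilon> \<circ> S = \<epsilon>\<close> one gets
  \<open>\<phi>(t y) = \<epsilon>(y)\<close>, so \<open>t\<close> is a multiple of the top monomial and \<open>S(t) = t\<close> (\<open>t_eq\<close>, \<open>S_t\<close>). In particular no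
  \<open>c\<^sub>v\<close> vanishes, and since \<open>S\<close> reverses products \<open>\<sigma>\<close> is additive; so \<open>\<sigma>\<close> is induced by a permutation
  \<open>\<pi>\<close> of the indices. As \<open>S\<close> also reverses \<open>\<Delta>(t)\<close>, the inverse of \<open>S\<^sup>2\<close> is the Nakayama automorphism of
  \<open>\<phi>\<close> (\<open>phi_S_square\<close>). Tested on complementary monomials this says that \<open>\<pi>\<close> is an involution and
  \<open>c\<^sub>i c\<^bsub>\<pi>(i)\<^esub> = h\<^sub>i\<close>. Comparing \<open>S(x\<^sub>i x\<^sub>j)\<close> with \<open>S(x\<^sub>j x\<^sub>i)\<close> shows that \<open>\<pi>\<close> is compatible, which gives
  \<open>h\<^bsub>\<pi>(i)\<^esub> = h\<^sub>i\<^bsup>-1\<^esup>\<close>; hence \<open>h\<^sub>i\<^sup>2 = 1\<close>, i.e. \<open>\<N>\<^sup>2 = Id\<close>. Finally \<open>S(t) = t\<close> is the normalization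
  \<open>s\<^bsub>a-1\<^esub> = 1\<close>, and the orbit computation from the first part yields the parity condition.\<close>

section \<open>Linear maps and quotient spaces\<close>

abbreviation linear_maps :: "('k::field, 'a) module \<Rightarrow> ('k, 'b) module \<Rightarrow> ('a \<Rightarrow> 'b) set" where
  "linear_maps M N \<equiv> module_hom class_ring M N"

lemma linear_mapsI:
  assumes "\<And>x. x \<in> carrier M \<Longrightarrow> f x \<in> carrier N"
    and "\<And>x y. x \<in> carrier M \<Longrightarrow> y \<in> carrier M \<Longrightarrow> f (x \<oplus>\<^bsub>M\<^esub> y) = f x \<oplus>\<^bsub>N\<^esub> f y"
    and "\<And>c x. x \<in> carrier M \<Longrightarrow> f (c \<odot>\<^bsub>M\<^esub> x) = c \<odot>\<^bsub>N\<^esub> f x"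
  shows "f \<in> linear_maps M N"
  using assms by (auto simp: LinearCombinations.module_hom_def)

lemma linear_mapsD:
  assumes "f \<in> linear_maps M N" and "x \<in> carrier M"
  shows "f x \<in> carrier N"
    and "y \<in> carrier M \<Longrightarrow> f (x \<oplus>\<^bsub>M\<^esub> y) = f x \<oplus>\<^bsub>N\<^esub> f y"
    and "f (c \<odot>\<^bsub>M\<^esub> x) = c \<odot>\<^bsub>N\<^esub> f x"
  using assms by (auto simp: LinearCombinations.module_hom_def)

lemma linear_map_zero:
  assumes M: "vectorspace class_ring M" and N: "vectorspace class_ring N"
    and f: "f \<in> linear_maps M N"
  shows "f \<zero>\<^bsub>M\<^esub> = \<zero>\<^bsub>N\<^esub>"
proof -
  interpret M: vectorspace class_ring M by fact
  interpret N: vectorspace class_ring N by fact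
  have "f (0 \<odot>\<^bsub>M\<^esub> \<zero>\<^bsub>M\<^esub>) = 0 \<odot>\<^bsub>N\<^esub> f \<zero>\<^bsub>M\<^esub>"
    by (rule linear_mapsD(3)[OF f]) simp
  then show ?thesis
    using M.smult_l_null[of "\<zero>\<^bsub>M\<^esub>"] N.smult_l_null[OF linear_mapsD(1)[OF f, of "\<zero>\<^bsub>M\<^esub>"]] by simp
qed

lemma linear_map_finsum:
  assumes M: "vectorspace class_ring M" and N: "vectorspace class_ring N"
    and f: "f \<in> linear_maps M N" and g: "\<And>i. i \<in> K \<Longrightarrow> g i \<in> carrier M"
  shows "f (\<Oplus>\<^bsub>M\<^esub>i\<in>K. g i) = (\<Oplus>\<^bsub>N\<^esub>i\<in>K. f (g i))"
  using g
proof (induction K rule: infinite_finite_induct)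
  case (infinite K)
  interpret M: vectorspace class_ring M by fact
  interpret N: vectorspace class_ring N by fact
  from infinite show ?case
    by (simp add: M.finsum_infinite N.finsum_infinite linear_map_zero[OF M N f])
next
  case empty
  interpret M: vectorspace class_ring M by fact
  interpret N: vectorspace class_ring N by fact
  show ?case by (simp add: linear_map_zero[OF M N f])
next
  case (insert i K)
  interpret M: vectorspace class_ring M by fact
  interpret N: vectorspace class_ring N by fact
  have g: "g \<in> K \<rightarrow> carrier M" "g i \<in> carrier M"
    using insert.prems by auto
  then have "(\<lambda>i. f (g i)) \<in> K \<rightarrow> carrier N" "f (g i) \<in> carrier N"
    using linear_mapsD(1)[OF f] by auto
  then show ?case
    using insert g by (simp add: linear_mapsD(2)[OF f])
qed

lemma vectorspaceI:
  fixes M :: "('k::field, 'a) module"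
  assumes "abelian_group M"
    and "\<And>c x. x \<in> carrier M \<Longrightarrow> c \<odot>\<^bsub>M\<^esub> x \<in> carrier M"
    and "\<And>c d x. x \<in> carrier M \<Longrightarrow> (c + d) \<odot>\<^bsub>M\<^esub> x = c \<odot>\<^bsub>M\<^esub> x \<oplus>\<^bsub>M\<^esub> d \<odot>\<^bsub>M\<^esub> x"
    and "\<And>c x y. x \<in> carrier M \<Longrightarrow> y \<in> carrier M \<Longrightarrow> c \<odot>\<^bsub>M\<^esub> (x \<oplus>\<^bsub>M\<^esub> y) = c \<odot>\<^bsub>M\<^esub> x \<oplus>\<^bsub>M\<^esub> c \<odot>\<^bsub>M\<^esub> y"
    and "\<And>c d x. x \<in> carrier M \<Longrightarrow> (c * d) \<odot>\<^bsub>M\<^esub> x = c \<odot>\<^bsub>M\<^esub> (d \<odot>\<^bsub>M\<^esub> x)"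
    and "\<And>x. x \<in> carrier M \<Longrightarrow> 1 \<odot>\<^bsub>M\<^esub> x = x"
  shows "vectorspace class_ring M"
proof -
  have "module class_ring M"
    by (rule moduleI) (use assms in \<open>auto intro: class_cring.cring_axioms\<close>)
  then show ?thesis
    using class_field by (simp add: vectorspace_def)
qed

text \<open>A name for vector spaces over a type-class field, under which the rules for scalars are available
  with \<open>+\<close>, \<open>*\<close> and \<open>1\<close> of the field instead of the selectors of \<^term>\<open>class_ring\<close>.\<close>

locale kspace = vectorspace class_ring M for M :: "('k::field, 'a) module" (structure)
begin

lemma smult_add_left: "x \<in> carrier M \<Longrightarrow> (c + d) \<odot> x = c \<odot> x \<oplus> d \<odot> x"
  using smult_l_distr[of c d x] by simp

lemma smult_smult: "x \<in> carrier M \<Longrightarrow> c \<odot> (d \<odot> x) = (c * d) \<odot> x"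
  using smult_assoc1[of c d x] by simp

lemma smult_1 [simp]: "x \<in> carrier M \<Longrightarrow> 1 \<odot> x = x"
  using smult_one[of x] by simp

lemma smult_0 [simp]: "x \<in> carrier M \<Longrightarrow> 0 \<odot> x = \<zero>"
  using smult_l_null[of x] by simp

lemma smult_minus_one_eq: "x \<in> carrier M \<Longrightarrow> (- 1) \<odot> x = \<ominus> x"
  using smult_minus_1[of x] by (auto simp: class_ring_simps)

lemma smult_closed' [simp]: "x \<in> carrier M \<Longrightarrow> c \<odot> x \<in> carrier M"
  by simp

lemma smult_add_right:
  "x \<in> carrier M \<Longrightarrow> y \<in> carrier M \<Longrightarrow> c \<odot> (x \<oplus> y) = c \<odot> x \<oplus> c \<odot> y"
  by (simp add: smult_r_distr)

lemma smult_zero [simp]: "c \<odot> \<zero> = \<zero>"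
  by (simp add: smult_r_null)

lemma smult_finsum:
  assumes "\<And>i. i \<in> K \<Longrightarrow> f i \<in> carrier M"
  shows "c \<odot> (\<Oplus>i\<in>K. f i) = (\<Oplus>i\<in>K. c \<odot> f i)"
  using assms
proof (induction K rule: infinite_finite_induct)
  case (insert i K)
  then have "f \<in> K \<rightarrow> carrier M" "(\<lambda>i. c \<odot> f i) \<in> K \<rightarrow> carrier M" by auto
  with insert show ?case by (simp add: smult_add_right)
qed (simp_all add: finsum_infinite)

end

lemma kspaceI: "vectorspace class_ring M \<Longrightarrow> kspace M"
  by (simp add: kspace_def)

lemma scalar_space_simps [simp]:
  "carrier scalar_space = UNIV" "x \<oplus>\<^bsub>scalar_space\<^esub> y = x + y" "\<zero>\<^bsub>scalar_space\<^esub> = 0"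
  "c \<odot>\<^bsub>scalar_space\<^esub> x = c * x"
  by (simp_all add: scalar_space_def ring.defs module.defs)

lemma kspace_scalar_space: "kspace (scalar_space :: ('k::field, 'k) module)"
proof (rule kspaceI, rule vectorspaceI)
  show "abelian_group (scalar_space :: ('k, 'k) module)"
    by (rule abelian_groupI) (auto simp: ac_simps intro: exI[of _ "- x" for x])
qed (auto simp: algebra_simps)

lemma finsum_scalar_space [simp]:
  fixes f :: "'i \<Rightarrow> 'k::field"
  shows "(\<Oplus>\<^bsub>scalar_space\<^esub>i\<in>K. f i) = sum f K"
proof -
  interpret S: kspace "scalar_space :: ('k, 'k) module" by (rule kspace_scalar_space)
  show ?thesis
    by (induction K rule: infinite_finite_induct) (auto simp: S.finsum_infinite S.finsum_insert)
qed

lemma dual_spaceI: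
  assumes "\<And>x y. x \<in> carrier M \<Longrightarrow> y \<in> carrier M \<Longrightarrow> f (x \<oplus>\<^bsub>M\<^esub> y) = f x + f y"
    and "\<And>c x. x \<in> carrier M \<Longrightarrow> f (c \<odot>\<^bsub>M\<^esub> x) = c * f x"
  shows "f \<in> dual_space M"
  unfolding dual_space_def by (rule linear_mapsI) (simp_all add: assms)

lemma dual_spaceD:
  assumes "f \<in> dual_space M" "x \<in> carrier M"
  shows "y \<in> carrier M \<Longrightarrow> f (x \<oplus>\<^bsub>M\<^esub> y) = f x + f y" and "f (c \<odot>\<^bsub>M\<^esub> x) = c * f x"
  using assms linear_mapsD[of f M scalar_space x] by (auto simp: dual_space_def)

lemma linear_maps_comp:
  assumes "f \<in> linear_maps M N" "g \<in> linear_maps N P"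
  shows "(\<lambda>x. g (f x)) \<in> linear_maps M P"
  using linear_mapsD[OF assms(1)] linear_mapsD[OF assms(2)] by (intro linear_mapsI) auto

lemma linear_map_scale_by_functional:
  assumes "kspace P" "f \<in> dual_space M" "z \<in> carrier P"
  shows "(\<lambda>x. f x \<odot>\<^bsub>P\<^esub> z) \<in> linear_maps M P"
proof -
  interpret P: kspace P by fact
  show ?thesis
    by (rule linear_mapsI) (simp_all add: assms(3) dual_spaceD[OF assms(2)] P.smult_add_left P.smult_smult)
qed

locale quotient_space =
  fixes M :: "('k::field, 'a) module" and U :: "'a set"
  assumes vectorspace_M: "vectorspace class_ring M"
    and submodule_U: "submodule class_ring U M"
begin

sublocale M: kspace M by (rule kspaceI[OF vectorspace_M])
sublocale U: submodule class_ring U M by (rule submodule_U)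

abbreviation Q where "Q \<equiv> quotient_module M U"
abbreviation cls where "cls x \<equiv> U +>\<^bsub>M\<^esub> x"

lemma abelian_subgroup_U: "abelian_subgroup U M"
proof (rule abelian_subgroupI3)
  show "additive_subgroup U M"
  proof (rule additive_subgroupI, rule M.add.subgroupI)
    show "\<ominus>\<^bsub>M\<^esub> x \<in> U" if "x \<in> U" for x
    proof -
      have "\<ominus>\<^bsub>M\<^esub> x = (- 1) \<odot>\<^bsub>M\<^esub> x"
        using M.smult_minus_one_eq[of x] that U.subset by auto
      then show ?thesis
        using U.smult_closed[of "- 1" x] that by simp
    qed
  qed (use U.subset U.zero_closed in \<open>auto simp del: U.zero_closed\<close>)
qed (rule M.M.abelian_group_axioms)

sublocale U: abelian_subgroup U M by (rule abelian_subgroup_U)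

lemma carrier_quotient: "carrier Q = cls ` carrier M"
  by (auto simp: quotient_module_def ring.defs module.defs FactRing_def A_RCOSETS_def')

lemma cls_in_carrier: "x \<in> carrier M \<Longrightarrow> cls x \<in> carrier Q"
  by (simp add: carrier_quotient)

text \<open>Cosets are compared through differences: this is the form in which membership in a kernel is used
  below, both for the ideal of relations and for the kernel of the tensor product.\<close>

lemma mem_cls_iff: "x \<in> carrier M \<Longrightarrow> y \<in> cls x \<longleftrightarrow> y \<in> carrier M \<and> y \<ominus>\<^bsub>M\<^esub> x \<in> U"
proof
  assume x: "x \<in> carrier M" and "y \<in> cls x"
  then obtain u where u: "u \<in> U" "y = u \<oplus>\<^bsub>M\<^esub> x"
    by (auto simp: a_r_coset_def')
  then have "u \<in> carrier M" using U.subset by auto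
  then have "y \<ominus>\<^bsub>M\<^esub> x = u"
    using u x by (simp add: M.minus_eq M.a_assoc M.r_neg)
  with u \<open>u \<in> carrier M\<close> x show "y \<in> carrier M \<and> y \<ominus>\<^bsub>M\<^esub> x \<in> U" by simp
next
  assume x: "x \<in> carrier M" and y: "y \<in> carrier M \<and> y \<ominus>\<^bsub>M\<^esub> x \<in> U"
  then have "y = (y \<ominus>\<^bsub>M\<^esub> x) \<oplus>\<^bsub>M\<^esub> x"
    by (simp add: M.minus_eq M.a_assoc M.l_neg)
  with y show "y \<in> cls x" by (auto simp: a_r_coset_def')
qed

lemma cls_eq_iff:
  assumes "x \<in> carrier M" "y \<in> carrier M"
  shows "cls x = cls y \<longleftrightarrow> x \<ominus>\<^bsub>M\<^esub> y \<in> U"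
proof
  assume "cls x = cls y"
  then have "x \<in> cls y" using U.a_rcos_self[OF assms(1)] by simp
  then show "x \<ominus>\<^bsub>M\<^esub> y \<in> U" using mem_cls_iff assms by simp
next
  assume "x \<ominus>\<^bsub>M\<^esub> y \<in> U"
  then have "x \<in> cls y" using mem_cls_iff assms by simp
  then show "cls x = cls y"
    using M.a_repr_independence[OF _ assms(2) U.a_subgroup] by simp
qed

lemma zero_quotient: "\<zero>\<^bsub>Q\<^esub> = cls \<zero>\<^bsub>M\<^esub>"
  using U.a_subset by (simp add: quotient_module_def ring.defs module.defs FactRing_def)

lemma add_quotient:
  "x \<in> carrier M \<Longrightarrow> y \<in> carrier M \<Longrightarrow> cls x \<oplus>\<^bsub>Q\<^esub> cls y = cls (x \<oplus>\<^bsub>M\<^esub> y)"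
  by (simp add: quotient_module_def ring.defs module.defs FactRing_def U.a_rcos_sum)

lemma smult_quotient: 
  assumes x: "x \<in> carrier M" shows "c \<odot>\<^bsub>Q\<^esub> cls x = cls (c \<odot>\<^bsub>M\<^esub> x)"
proof -
  have "cls (c \<odot>\<^bsub>M\<^esub> y) = cls (c \<odot>\<^bsub>M\<^esub> x)" if "y \<in> cls x" for y
  proof -
    have y: "y \<in> carrier M" "y \<ominus>\<^bsub>M\<^esub> x \<in> U" using that x mem_cls_iff by auto
    have "c \<odot>\<^bsub>M\<^esub> (y \<ominus>\<^bsub>M\<^esub> x) \<in> U" using y by simp
    moreover have "c \<odot>\<^bsub>M\<^esub> (y \<ominus>\<^bsub>M\<^esub> x) = (c \<odot>\<^bsub>M\<^esub> y) \<ominus>\<^bsub>M\<^esub> (c \<odot>\<^bsub>M\<^esub> x)"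
      using x y by (simp add: M.minus_eq M.smult_r_distr M.smult_r_minus)
    ultimately show ?thesis using x y cls_eq_iff by simp
  qed
  then have "(\<Union>y\<in>cls x. cls (c \<odot>\<^bsub>M\<^esub> y)) = cls (c \<odot>\<^bsub>M\<^esub> x)"
    using U.a_rcos_self[OF x] by blast
  then show ?thesis by (simp add: quotient_module_def ring.defs module.defs)
qed

lemma vectorspace_quotient: "vectorspace class_ring Q"
proof (rule vectorspaceI)
  show "abelian_group Q"
  proof (rule abelian_groupI)
    show "\<exists>y\<in>carrier Q. y \<oplus>\<^bsub>Q\<^esub> x = \<zero>\<^bsub>Q\<^esub>" if x: "x \<in> carrier Q" for x
    proof -
      obtain z where z: "z \<in> carrier M" "x = cls z" using x unfolding carrier_quotient by auto
      then have "cls (\<ominus>\<^bsub>M\<^esub> z) \<oplus>\<^bsub>Q\<^esub> x = \<zero>\<^bsub>Q\<^esub>"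
        by (simp add: add_quotient zero_quotient M.l_neg)
      then show ?thesis using z cls_in_carrier by blast
    qed
  qed (auto simp: carrier_quotient add_quotient zero_quotient M.a_ac)
qed (auto simp: carrier_quotient add_quotient smult_quotient M.smult_add_left M.smult_add_right M.smult_smult)

lemma cls_linear: "cls \<in> linear_maps M Q"
  by (rule linear_mapsI) (simp_all add: cls_in_carrier add_quotient smult_quotient)

end

section \<open>Free vector spaces and tensor products\<close>

lemma free_space_simps:
  "f \<in> carrier (free_space X) \<longleftrightarrow> finite {x. f x \<noteq> 0} \<and> {x. f x \<noteq> 0} \<subseteq> X"
  "\<zero>\<^bsub>free_space X\<^esub> = (\<lambda>x. 0)"
  "f \<oplus>\<^bsub>free_space X\<^esub> g = (\<lambda>x. f x + g x)"
  "c \<odot>\<^bsub>free_space X\<^esub> f = (\<lambda>x. c * f x)"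
  by (auto simp: free_space_def)

lemma kspace_free_space: "kspace (free_space X :: ('k::field, 'x \<Rightarrow> 'k) module)"
proof (rule kspaceI, rule vectorspaceI)
  show "abelian_group (free_space X :: ('k, 'x \<Rightarrow> 'k) module)"
  proof (rule abelian_groupI)
    fix f g :: "'x \<Rightarrow> 'k"
    assume "f \<in> carrier (free_space X)" "g \<in> carrier (free_space X)"
    moreover have "{x. f x + g x \<noteq> 0} \<subseteq> {x. f x \<noteq> 0} \<union> {x. g x \<noteq> 0}" by auto
    ultimately show "f \<oplus>\<^bsub>free_space X\<^esub> g \<in> carrier (free_space X)"
      by (auto simp: free_space_simps intro: finite_subset)
  next
    fix f :: "'x \<Rightarrow> 'k"
    assume "f \<in> carrier (free_space X)"
    then show "\<exists>g\<in>carrier (free_space X). g \<oplus>\<^bsub>free_space X\<^esub> f = \<zero>\<^bsub>free_space X\<^esub>"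
      by (intro bexI[of _ "\<lambda>x. - f x"]) (auto simp: free_space_simps)
  qed (auto simp: free_space_simps ac_simps)
qed (auto simp: free_space_simps algebra_simps intro: finite_subset)

lemma single_in_free_space [simp]: "single x \<in> carrier (free_space X :: ('k::field, 'x \<Rightarrow> 'k) module) \<longleftrightarrow> x \<in> X"
proof -
  have "{y. (single x y :: 'k) \<noteq> 0} = {x}" by (auto simp: single_def)
  then show ?thesis by (simp add: free_space_simps)
qed

lemma finsum_single:
  assumes "finite K" "K \<subseteq> X"
  shows "(\<Oplus>\<^bsub>free_space X\<^esub>p\<in>K. c p \<odot>\<^bsub>free_space X\<^esub> single p) = (\<lambda>x. if x \<in> K then c x else 0 :: 'k::field)"
  using assms
proof (induction K rule: finite_induct)
  case empty
  interpret F: kspace "free_space X :: ('k, 'a \<Rightarrow> 'k) module" by (rule kspace_free_space)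
  show ?case using F.finsum_empty by (simp add: free_space_simps)
next
  case (insert p K)
  interpret F: kspace "free_space X :: ('k, 'a \<Rightarrow> 'k) module" by (rule kspace_free_space)
  have *: "c p \<odot>\<^bsub>free_space X\<^esub> single p \<in> carrier (free_space X)" if "p \<in> X" for p
    using that by (simp only: F.smult_closed' single_in_free_space)
  have "(\<Oplus>\<^bsub>free_space X\<^esub>p\<in>insert p K. c p \<odot>\<^bsub>free_space X\<^esub> single p) =
      c p \<odot>\<^bsub>free_space X\<^esub> single p \<oplus>\<^bsub>free_space X\<^esub> (\<Oplus>\<^bsub>free_space X\<^esub>p\<in>K. c p \<odot>\<^bsub>free_space X\<^esub> single p)"
    using insert.hyps insert.prems * by (intro F.finsum_insert) (auto)
  also have "\<dots> = (\<lambda>x. if x \<in> insert p K then c x else 0)"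
    using insert by (auto simp: free_space_simps single_def fun_eq_iff)
  finally show ?case .
qed

text \<open>The inner expression of \<^const>\<open>tensor_lift\<close>, isolated so that its linearity can be proved once for
  tensor products and for coefficient functionals on free algebras.\<close>

definition linear_extension :: "('k::field, 'p) module \<Rightarrow> ('x \<Rightarrow> 'p) \<Rightarrow> ('x \<Rightarrow> 'k) \<Rightarrow> 'p" where
  "linear_extension P b f = (\<Oplus>\<^bsub>P\<^esub>p\<in>{p. f p \<noteq> 0}. f p \<odot>\<^bsub>P\<^esub> b p)"

text \<open>The sum may be taken over any finite set containing the support; this makes two summands with
  different supports comparable.\<close>

lemma linear_extension_superset:
  assumes P: "kspace P" and b: "b \<in> X \<rightarrow> carrier P"
    and K: "finite K" "{p. f p \<noteq> 0} \<subseteq> K" "K \<subseteq> X"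
  shows "linear_extension P b f = (\<Oplus>\<^bsub>P\<^esub>p\<in>K. f p \<odot>\<^bsub>P\<^esub> b p)"
proof -
  interpret P: kspace P by fact
  show ?thesis unfolding linear_extension_def
    by (rule P.add.finprod_mono_neutral_cong_left) (use assms in \<open>auto simp: Pi_def\<close>)
qed

lemma linear_extension_linear:
  fixes X :: "'x set" and P :: "('k::field, 'p) module"
  assumes P: "kspace P" and b: "b \<in> X \<rightarrow> carrier P"
  shows "linear_extension P b \<in> linear_maps (free_space X) P"
proof (rule linear_mapsI)
  interpret P: kspace P by fact
  fix f g :: "'x \<Rightarrow> 'k"
  assume f: "f \<in> carrier (free_space X)"
  show "linear_extension P b f \<in> carrier P"
    unfolding linear_extension_def using f b by (intro P.finsum_closed) (auto simp: free_space_simps Pi_def)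
  have "linear_extension P b (c \<odot>\<^bsub>free_space X\<^esub> f) = (\<Oplus>\<^bsub>P\<^esub>p\<in>{p. f p \<noteq> 0}. (c * f p) \<odot>\<^bsub>P\<^esub> b p)" for c
    using f b by (subst linear_extension_superset[OF P b, where K="{p. f p \<noteq> 0}"]) (auto simp: free_space_simps)
  moreover have "(\<Oplus>\<^bsub>P\<^esub>p\<in>{p. f p \<noteq> 0}. (c * f p) \<odot>\<^bsub>P\<^esub> b p) = c \<odot>\<^bsub>P\<^esub> linear_extension P b f" for c
    unfolding linear_extension_def using f b
    by (subst P.smult_finsum) (auto simp: free_space_simps Pi_def P.smult_smult intro!: P.finsum_cong')
  ultimately show "linear_extension P b (c \<odot>\<^bsub>free_space X\<^esub> f) = c \<odot>\<^bsub>P\<^esub> linear_extension P b f" for c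
    by simp
  assume g: "g \<in> carrier (free_space X)"
  let ?K = "{p. f p \<noteq> 0} \<union> {p. g p \<noteq> 0}"
  have K: "finite ?K" "?K \<subseteq> X" using f g by (auto simp: free_space_simps)
  note E = linear_extension_superset[OF P b K(1) _ K(2)]
  have "linear_extension P b (f \<oplus>\<^bsub>free_space X\<^esub> g) = (\<Oplus>\<^bsub>P\<^esub>p\<in>?K. (f p + g p) \<odot>\<^bsub>P\<^esub> b p)"
    by (subst E) (auto simp: free_space_simps)
  also have "\<dots> = (\<Oplus>\<^bsub>P\<^esub>p\<in>?K. f p \<odot>\<^bsub>P\<^esub> b p \<oplus>\<^bsub>P\<^esub> g p \<odot>\<^bsub>P\<^esub> b p)"
    using b K by (intro P.finsum_cong') (auto simp: P.smult_add_left Pi_def)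
  also have "\<dots> = (\<Oplus>\<^bsub>P\<^esub>p\<in>?K. f p \<odot>\<^bsub>P\<^esub> b p) \<oplus>\<^bsub>P\<^esub> (\<Oplus>\<^bsub>P\<^esub>p\<in>?K. g p \<odot>\<^bsub>P\<^esub> b p)"
    using b K by (intro P.finsum_addf) (auto simp: free_space_simps Pi_def)
  also have "\<dots> = linear_extension P b f \<oplus>\<^bsub>P\<^esub> linear_extension P b g"
    by (subst (1 2) E) (auto simp: free_space_simps)
  finally show "linear_extension P b (f \<oplus>\<^bsub>free_space X\<^esub> g) = \<dots>" .
qed

lemma linear_extension_single:
  fixes P :: "('k::field, 'p) module"
  assumes "kspace P" and "b x \<in> carrier P"
  shows "linear_extension P b (single x) = b x"
proof -
  interpret P: kspace P by fact
  have "{y. (single x y :: 'k) \<noteq> 0} = {x}" by (auto simp: single_def)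
  then show ?thesis using assms by (simp add: linear_extension_def single_def)
qed

text \<open>A linear map on a free space is determined by its values on the basis; together with
  \<open>linear_extension_linear\<close> this is the universal property of \<^const>\<open>free_space\<close>.\<close>

lemma linear_maps_free_space_eq:
  fixes P :: "('k::field, 'p) module" and X :: "'x set"
  assumes P: "kspace P" and g: "g \<in> linear_maps (free_space X) P" and f: "f \<in> carrier (free_space X)"
  shows "g f = linear_extension P (\<lambda>x. g (single x)) f"
proof -
  interpret P: kspace P by fact
  interpret F: kspace "free_space X :: ('k, 'x \<Rightarrow> 'k) module" by (rule kspace_free_space)
  let ?K = "{p. f p \<noteq> 0}"
  have K: "finite ?K" "?K \<subseteq> X" using f by (auto simp: free_space_simps)
  then have s: "single p \<in> carrier (free_space X :: ('k, 'x \<Rightarrow> 'k) module)" if "p \<in> ?K" for p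
    using that by auto
  have "f = (\<Oplus>\<^bsub>free_space X\<^esub>p\<in>?K. f p \<odot>\<^bsub>free_space X\<^esub> single p)"
    by (subst finsum_single[OF K]) auto
  then have "g f = g (\<Oplus>\<^bsub>free_space X\<^esub>p\<in>?K. f p \<odot>\<^bsub>free_space X\<^esub> single p)"
    by (rule arg_cong)
  also have "\<dots> = (\<Oplus>\<^bsub>P\<^esub>p\<in>?K. g (f p \<odot>\<^bsub>free_space X\<^esub> single p))"
    by (rule linear_map_finsum[OF F.vectorspace_axioms P.vectorspace_axioms g]) (simp only: F.smult_closed' s)
  also have "\<dots> = linear_extension P (\<lambda>x. g (single x)) f"
    unfolding linear_extension_def
  proof (rule P.finsum_cong')
    show "(\<lambda>p. f p \<odot>\<^bsub>P\<^esub> g (single p)) \<in> ?K \<rightarrow> carrier P"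
      by (intro Pi_I P.smult_closed' linear_mapsD(1)[OF g s])
    show "g (f p \<odot>\<^bsub>free_space X\<^esub> single p) = f p \<odot>\<^bsub>P\<^esub> g (single p)" if "p \<in> ?K" for p
      by (rule linear_mapsD(3)[OF g s[OF that]])
  qed simp
  finally show ?thesis .
qed

definition bilinear_map ::
    "('k::field, 'a) module \<Rightarrow> ('k, 'b) module \<Rightarrow> ('k, 'p) module \<Rightarrow> ('a \<Rightarrow> 'b \<Rightarrow> 'p) \<Rightarrow> bool" where
  "bilinear_map M N P \<beta> \<longleftrightarrow>
     (\<forall>x\<in>carrier M. \<beta> x \<in> linear_maps N P) \<and> (\<forall>y\<in>carrier N. (\<lambda>x. \<beta> x y) \<in> linear_maps M P)"

lemma bilinear_mapD:
  assumes "bilinear_map M N P \<beta>" "x \<in> carrier M" "y \<in> carrier N"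
  shows "\<beta> x y \<in> carrier P"
    and "x' \<in> carrier M \<Longrightarrow> \<beta> (x \<oplus>\<^bsub>M\<^esub> x') y = \<beta> x y \<oplus>\<^bsub>P\<^esub> \<beta> x' y"
    and "y' \<in> carrier N \<Longrightarrow> \<beta> x (y \<oplus>\<^bsub>N\<^esub> y') = \<beta> x y \<oplus>\<^bsub>P\<^esub> \<beta> x y'"
    and "\<beta> (c \<odot>\<^bsub>M\<^esub> x) y = c \<odot>\<^bsub>P\<^esub> \<beta> x y"
    and "\<beta> x (c \<odot>\<^bsub>N\<^esub> y) = c \<odot>\<^bsub>P\<^esub> \<beta> x y"
  using assms linear_mapsD[of "\<lambda>x. \<beta> x y" M P] linear_mapsD[of "\<beta> x" N P]
  unfolding bilinear_map_def by auto

lemma bilinear_mapI: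
  assumes "\<And>x y. x \<in> carrier M \<Longrightarrow> y \<in> carrier N \<Longrightarrow> \<beta> x y \<in> carrier P"
    and "\<And>x x' y. x \<in> carrier M \<Longrightarrow> x' \<in> carrier M \<Longrightarrow> y \<in> carrier N \<Longrightarrow>
          \<beta> (x \<oplus>\<^bsub>M\<^esub> x') y = \<beta> x y \<oplus>\<^bsub>P\<^esub> \<beta> x' y"
    and "\<And>x y y'. x \<in> carrier M \<Longrightarrow> y \<in> carrier N \<Longrightarrow> y' \<in> carrier N \<Longrightarrow>
          \<beta> x (y \<oplus>\<^bsub>N\<^esub> y') = \<beta> x y \<oplus>\<^bsub>P\<^esub> \<beta> x y'"
    and "\<And>c x y. x \<in> carrier M \<Longrightarrow> y \<in> carrier N \<Longrightarrow> \<beta> (c \<odot>\<^bsub>M\<^esub> x) y = c \<odot>\<^bsub>P\<^esub> \<beta> x y"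
    and "\<And>c x y. x \<in> carrier M \<Longrightarrow> y \<in> carrier N \<Longrightarrow> \<beta> x (c \<odot>\<^bsub>N\<^esub> y) = c \<odot>\<^bsub>P\<^esub> \<beta> x y"
  shows "bilinear_map M N P \<beta>"
  unfolding bilinear_map_def by (auto intro!: linear_mapsI simp: assms)

lemma bilinear_map_comp:
  assumes f: "f \<in> linear_maps M M'" and g: "g \<in> linear_maps N N'" and \<beta>: "bilinear_map M' N' P \<beta>"
  shows "bilinear_map M N P (\<lambda>x y. \<beta> (f x) (g y))"
  by (rule bilinear_mapI) (simp_all add: linear_mapsD[OF f] linear_mapsD[OF g] bilinear_mapD[OF \<beta>])

lemma bilinear_map_left: "bilinear_map M N P \<beta> \<Longrightarrow> y \<in> carrier N \<Longrightarrow> (\<lambda>x. \<beta> x y) \<in> linear_maps M P"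
  and bilinear_map_right: "bilinear_map M N P \<beta> \<Longrightarrow> x \<in> carrier M \<Longrightarrow> \<beta> x \<in> linear_maps N P"
  unfolding bilinear_map_def by auto

locale tensor_pair = M: kspace M + N: kspace N
  for M :: "('k::field, 'a) module" and N :: "('k, 'b) module"
begin

sublocale F: kspace "pair_space M N" by (rule kspace_free_space)

lemma bilinear_relations_subset: "bilinear_relations M N \<subseteq> carrier (pair_space M N)"
  unfolding bilinear_relations_def
  by (auto simp: single_in_free_space
      intro!: F.minus_closed F.a_closed F.smult_closed')

sublocale quotient_space "pair_space M N" "tensor_kernel M N"
proof (rule quotient_space.intro)
  show "vectorspace class_ring (pair_space M N)" by (rule F.vectorspace_axioms)
  show "submodule class_ring (tensor_kernel M N) (pair_space M N)"
    unfolding tensor_kernel_def by (rule F.span_is_submodule[OF bilinear_relations_subset])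
qed

abbreviation T where "T \<equiv> tensor M N"

sublocale T: kspace T
  unfolding tensor_def by (rule kspaceI[OF vectorspace_quotient])

lemma relation_cls:
  assumes "f \<ominus>\<^bsub>pair_space M N\<^esub> g \<in> bilinear_relations M N"
    and "f \<in> carrier (pair_space M N)" "g \<in> carrier (pair_space M N)"
  shows "cls f = cls g"
  using assms F.in_own_span[OF bilinear_relations_subset] cls_eq_iff
  unfolding tensor_kernel_def by blast

lemma pure_in_carrier [simp]: "x \<in> carrier M \<Longrightarrow> y \<in> carrier N \<Longrightarrow> pure M N x y \<in> carrier T"
  unfolding pure_def tensor_def by (rule cls_in_carrier) simp

lemma pure_bilinear: "bilinear_map M N T (pure M N)"
proof (rule bilinear_mapI)
  fix x x' y assume *: "x \<in> carrier M" "x' \<in> carrier M" "y \<in> carrier N"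
  have "cls (single (x \<oplus>\<^bsub>M\<^esub> x', y)) = cls (single (x, y) \<oplus>\<^bsub>pair_space M N\<^esub> single (x', y))"
    by (rule relation_cls)
      (use * in \<open>auto simp: bilinear_relations_def intro!: F.a_closed\<close>)
  also have "\<dots> = cls (single (x, y)) \<oplus>\<^bsub>T\<^esub> cls (single (x', y))"
    unfolding tensor_def by (rule add_quotient[symmetric]) (use * in auto)
  finally show "pure M N (x \<oplus>\<^bsub>M\<^esub> x') y = pure M N x y \<oplus>\<^bsub>T\<^esub> pure M N x' y"
    unfolding pure_def .
next
  fix x y y' assume *: "x \<in> carrier M" "y \<in> carrier N" "y' \<in> carrier N"
  have "cls (single (x, y \<oplus>\<^bsub>N\<^esub> y')) = cls (single (x, y) \<oplus>\<^bsub>pair_space M N\<^esub> single (x, y'))"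
    by (rule relation_cls)
      (use * in \<open>auto simp: bilinear_relations_def intro!: F.a_closed\<close>)
  also have "\<dots> = cls (single (x, y)) \<oplus>\<^bsub>T\<^esub> cls (single (x, y'))"
    unfolding tensor_def by (rule add_quotient[symmetric]) (use * in auto)
  finally show "pure M N x (y \<oplus>\<^bsub>N\<^esub> y') = pure M N x y \<oplus>\<^bsub>T\<^esub> pure M N x y'"
    unfolding pure_def .
next
  fix c x y assume *: "x \<in> carrier M" "y \<in> carrier N"
  have "cls (single (c \<odot>\<^bsub>M\<^esub> x, y)) = cls (c \<odot>\<^bsub>pair_space M N\<^esub> single (x, y))"
    by (rule relation_cls)
      (use * in \<open>auto simp: bilinear_relations_def intro!: F.smult_closed'\<close>)
  also have "\<dots> = c \<odot>\<^bsub>T\<^esub> cls (single (x, y))"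
    unfolding tensor_def by (rule smult_quotient[symmetric]) (use * in auto)
  finally show "pure M N (c \<odot>\<^bsub>M\<^esub> x) y = c \<odot>\<^bsub>T\<^esub> pure M N x y"
    unfolding pure_def .
next
  fix c x y assume *: "x \<in> carrier M" "y \<in> carrier N"
  have "cls (single (x, c \<odot>\<^bsub>N\<^esub> y)) = cls (c \<odot>\<^bsub>pair_space M N\<^esub> single (x, y))"
    by (rule relation_cls)
      (use * in \<open>auto simp: bilinear_relations_def intro!: F.smult_closed'\<close>)
  also have "\<dots> = c \<odot>\<^bsub>T\<^esub> cls (single (x, y))"
    unfolding tensor_def by (rule smult_quotient[symmetric]) (use * in auto)
  finally show "pure M N x (c \<odot>\<^bsub>N\<^esub> y) = c \<odot>\<^bsub>T\<^esub> pure M N x y"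
    unfolding pure_def .
qed simp

text \<open>The scalars of a representative are absorbed into the left factors, so every tensor is a plain
  finite sum of pure ones. This is the Sweedler notation \<open>\<Sum> t\<^sub>1 \<otimes> t\<^sub>2\<close>.\<close>

lemma tensor_sum_of_pures:
  assumes "X \<in> carrier T"
  obtains K :: "('a \<times> 'b) set" and u w where "finite K" "\<And>k. k \<in> K \<Longrightarrow> u k \<in> carrier M" "\<And>k. k \<in> K \<Longrightarrow> w k \<in> carrier N"
    "X = (\<Oplus>\<^bsub>T\<^esub>k\<in>K. pure M N (u k) (w k))"
proof -
  obtain f where f: "f \<in> carrier (pair_space M N)" "X = cls f"
    using assms unfolding tensor_def carrier_quotient by auto
  let ?K = "{p. f p \<noteq> 0}"
  have K: "finite ?K" "?K \<subseteq> carrier M \<times> carrier N" using f by (auto simp: free_space_simps)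
  have "f = (\<Oplus>\<^bsub>pair_space M N\<^esub>p\<in>?K. f p \<odot>\<^bsub>pair_space M N\<^esub> single p)"
    by (subst finsum_single[OF K]) auto
  then have "X = cls (\<Oplus>\<^bsub>pair_space M N\<^esub>p\<in>?K. f p \<odot>\<^bsub>pair_space M N\<^esub> single p)"
    using f(2) by simp
  also have "\<dots> = (\<Oplus>\<^bsub>T\<^esub>p\<in>?K. cls (f p \<odot>\<^bsub>pair_space M N\<^esub> single p))"
    unfolding tensor_def
    by (rule linear_map_finsum[OF vectorspace_M vectorspace_quotient cls_linear])
      (use K in \<open>auto intro!: F.smult_closed'\<close>)
  also have "\<dots> = (\<Oplus>\<^bsub>T\<^esub>p\<in>?K. pure M N (f p \<odot>\<^bsub>M\<^esub> fst p) (snd p))"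
  proof (rule T.finsum_cong')
    fix p assume "p \<in> ?K"
    then have p: "fst p \<in> carrier M" "snd p \<in> carrier N" using K by auto
    then have "cls (f p \<odot>\<^bsub>pair_space M N\<^esub> single p) = f p \<odot>\<^bsub>T\<^esub> cls (single p)"
      unfolding tensor_def by (intro smult_quotient[symmetric]) (simp add: mem_Times_iff)
    also have "\<dots> = pure M N (f p \<odot>\<^bsub>M\<^esub> fst p) (snd p)"
      using bilinear_mapD(4)[OF pure_bilinear p] by (simp add: pure_def)
    finally show "cls (f p \<odot>\<^bsub>pair_space M N\<^esub> single p) = pure M N (f p \<odot>\<^bsub>M\<^esub> fst p) (snd p)" .
  qed (use K in auto)
  finally show thesis using K by (intro that[of ?K "\<lambda>p. f p \<odot>\<^bsub>M\<^esub> fst p" snd]) auto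
qed

text \<open>The uniqueness half of the universal property; all identities between maps out of a tensor product
  are checked with it.\<close>

lemma linear_maps_eq_on_pures:
  assumes P: "kspace P" and f: "f \<in> linear_maps T P" and g: "g \<in> linear_maps T P"
    and eq: "\<And>x y. x \<in> carrier M \<Longrightarrow> y \<in> carrier N \<Longrightarrow> f (pure M N x y) = g (pure M N x y)"
    and X: "X \<in> carrier T"
  shows "f X = g X"
proof -
  interpret P: kspace P by fact
  obtain K :: "('a \<times> 'b) set" and u w where K: "finite K" "\<And>k. k \<in> K \<Longrightarrow> u k \<in> carrier M" "\<And>k. k \<in> K \<Longrightarrow> w k \<in> carrier N"
    "X = (\<Oplus>\<^bsub>T\<^esub>k\<in>K. pure M N (u k) (w k))" by (rule tensor_sum_of_pures[OF X that])
  have "f X = (\<Oplus>\<^bsub>P\<^esub>k\<in>K. f (pure M N (u k) (w k)))" unfolding K(4)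
    by (rule linear_map_finsum[OF T.vectorspace_axioms P.vectorspace_axioms f]) (simp add: K(2,3))
  also have "\<dots> = (\<Oplus>\<^bsub>P\<^esub>k\<in>K. g (pure M N (u k) (w k)))"
    by (rule P.finsum_cong') (simp_all add: K(2,3) eq linear_mapsD(1)[OF g] Pi_iff)
  also have "\<dots> = g X" unfolding K(4)
    by (rule linear_map_finsum[OF T.vectorspace_axioms P.vectorspace_axioms g, symmetric]) (simp add: K(2,3))
  finally show ?thesis .
qed

context
  fixes P :: "('k, 'p) module" and \<beta> :: "'a \<Rightarrow> 'b \<Rightarrow> 'p"
  assumes P: "kspace P" and \<beta>: "bilinear_map M N P \<beta>"
begin

interpretation P: kspace P by (rule P)

abbreviation E where "E \<equiv> linear_extension P (\<lambda>p. \<beta> (fst p) (snd p))"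

lemma E_linear: "E \<in> linear_maps (pair_space M N) P"
  by (rule linear_extension_linear[OF P]) (use bilinear_mapD(1)[OF \<beta>] in auto)

lemma E_single: "x \<in> carrier M \<Longrightarrow> y \<in> carrier N \<Longrightarrow> E (single (x, y)) = \<beta> x y"
  using linear_extension_single[OF P, of "\<lambda>p. \<beta> (fst p) (snd p)" "(x, y)"] bilinear_mapD(1)[OF \<beta>, of x y]
  by simp

interpretation E: mod_hom class_ring "pair_space M N" P E
  by (rule mod_hom.intro) (auto simp: mod_hom_axioms_def E_linear F.module_axioms P.module_axioms)

text \<open>A bilinear map kills each of the four kinds of relations, and the kernel of its linear extension is
  a subspace, so it contains their span.\<close>

lemma E_kernel:
  assumes "f \<in> tensor_kernel M N"
  shows "E f = \<zero>\<^bsub>P\<^esub>"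
proof -
  have "bilinear_relations M N \<subseteq> E.ker"
  proof
    fix r assume r: "r \<in> bilinear_relations M N"
    then have "r \<in> carrier (pair_space M N)" using bilinear_relations_subset by blast
    moreover have "E r = \<zero>\<^bsub>P\<^esub>"
      using r unfolding bilinear_relations_def
      by (elim UnE CollectE exE conjE)
        (simp_all only: E.f_minus E.f_add linear_mapsD(3)[OF E_linear] F.a_closed F.smult_closed'
          single_in_free_space mem_Sigma_iff simp_thms M.a_closed N.a_closed M.smult_closed' N.smult_closed'
          E_single bilinear_mapD[OF \<beta>] P.minus_eq P.r_neg P.a_closed P.smult_closed')
    ultimately show "r \<in> E.ker" by (simp add: E.ker_def)
  qed
  then have "tensor_kernel M N \<subseteq> E.ker"
    unfolding tensor_kernel_def by (rule F.span_is_subset[OF _ E.ker_is_submodule])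
  with assms show ?thesis by (auto simp: E.ker_def)
qed

text \<open>By \<open>E_kernel\<close> the linear extension is constant on a coset, so \<^const>\<open>the_elem\<close> picks its
  common value.\<close>

lemma tensor_lift_cls:
  assumes f: "f \<in> carrier (pair_space M N)"
  shows "tensor_lift M N P \<beta> (cls f) = E f"
proof -
  have "E g = E f" if "g \<in> cls f" for g
  proof -
    from that f have g: "g \<in> carrier (pair_space M N)" "g \<ominus>\<^bsub>pair_space M N\<^esub> f \<in> tensor_kernel M N"
      using mem_cls_iff by auto
    let ?u = "g \<ominus>\<^bsub>pair_space M N\<^esub> f"
    have "g = ?u \<oplus>\<^bsub>pair_space M N\<^esub> f"
      using f g by (simp add: F.minus_eq F.a_assoc F.l_neg)
    then have "E g = E (?u \<oplus>\<^bsub>pair_space M N\<^esub> f)" by (rule arg_cong)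
    also have "\<dots> = E ?u \<oplus>\<^bsub>P\<^esub> E f"
      by (rule E.f_add[OF F.minus_closed[OF g(1) f] f])
    finally have "E g = E ?u \<oplus>\<^bsub>P\<^esub> E f" .
    then show ?thesis
      using E_kernel[OF g(2)] P.l_zero[OF E.f_im[OF f]] by simp
  qed
  then have "E ` cls f = {E f}" using U.a_rcos_self[OF f] by blast
  then show ?thesis unfolding tensor_lift_def linear_extension_def[symmetric] by simp
qed

lemma tensor_lift_pure:
  "x \<in> carrier M \<Longrightarrow> y \<in> carrier N \<Longrightarrow> tensor_lift M N P \<beta> (pure M N x y) = \<beta> x y"
  unfolding pure_def by (subst tensor_lift_cls) (simp_all add: E_single)

lemma tensor_lift_linear: "tensor_lift M N P \<beta> \<in> linear_maps T P"
proof (rule linear_mapsI)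
  fix X Y assume X: "X \<in> carrier T"
  then obtain f where f: "f \<in> carrier (pair_space M N)" "X = cls f"
    unfolding tensor_def carrier_quotient by auto
  show "tensor_lift M N P \<beta> X \<in> carrier P"
    using f E.f_im[OF f(1)] by (simp add: tensor_lift_cls)
  show "tensor_lift M N P \<beta> (c \<odot>\<^bsub>T\<^esub> X) = c \<odot>\<^bsub>P\<^esub> tensor_lift M N P \<beta> X" for c
    using f linear_mapsD(3)[OF E_linear f(1), of c] F.smult_closed'[OF f(1), of c]
    unfolding tensor_def by (simp add: smult_quotient tensor_lift_cls)
  assume "Y \<in> carrier T"
  then obtain g where g: "g \<in> carrier (pair_space M N)" "Y = cls g"
    unfolding tensor_def carrier_quotient by auto
  show "tensor_lift M N P \<beta> (X \<oplus>\<^bsub>T\<^esub> Y) = tensor_lift M N P \<beta> X \<oplus>\<^bsub>P\<^esub> tensor_lift M N P \<beta> Y"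
    using f g linear_mapsD(2)[OF E_linear f(1) g(1)] F.a_closed[OF f(1) g(1)]
    unfolding tensor_def by (simp add: add_quotient tensor_lift_cls)
qed

lemma tensor_lift_sum_of_pures:
  assumes "\<And>k. k \<in> K \<Longrightarrow> u k \<in> carrier M" "\<And>k. k \<in> K \<Longrightarrow> w k \<in> carrier N"
  shows "tensor_lift M N P \<beta> (\<Oplus>\<^bsub>T\<^esub>k\<in>K. pure M N (u k) (w k)) = (\<Oplus>\<^bsub>P\<^esub>k\<in>K. \<beta> (u k) (w k))"
proof -
  have "tensor_lift M N P \<beta> (\<Oplus>\<^bsub>T\<^esub>k\<in>K. pure M N (u k) (w k)) =
      (\<Oplus>\<^bsub>P\<^esub>k\<in>K. tensor_lift M N P \<beta> (pure M N (u k) (w k)))"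
    by (rule linear_map_finsum[OF T.vectorspace_axioms P.vectorspace_axioms tensor_lift_linear])
      (simp add: assms)
  also have "\<dots> = (\<Oplus>\<^bsub>P\<^esub>k\<in>K. \<beta> (u k) (w k))"
  proof (rule P.finsum_cong')
    show "(\<lambda>k. \<beta> (u k) (w k)) \<in> K \<rightarrow> carrier P"
      by (simp add: assms bilinear_mapD(1)[OF \<beta>] Pi_iff)
    show "tensor_lift M N P \<beta> (pure M N (u k) (w k)) = \<beta> (u k) (w k)" if "k \<in> K" for k
      using that by (simp add: assms tensor_lift_pure)
  qed simp
  finally show ?thesis .
qed

end

end

lemma tensor_pairI: "kspace M \<Longrightarrow> kspace N \<Longrightarrow> tensor_pair M N"
  by (simp add: tensor_pair_def)

lemma tensor_map_linear:
  assumes M: "kspace M" "kspace N" "kspace M'" "kspace N'"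
    and f: "f \<in> linear_maps M M'" and g: "g \<in> linear_maps N N'"
  shows "tensor_map M N M' N' f g \<in> linear_maps (tensor M N) (tensor M' N')"
    and "x \<in> carrier M \<Longrightarrow> y \<in> carrier N \<Longrightarrow> tensor_map M N M' N' f g (pure M N x y) = pure M' N' (f x) (g y)"
proof -
  interpret T: tensor_pair M N by (rule tensor_pairI[OF M(1,2)])
  interpret T': tensor_pair M' N' by (rule tensor_pairI[OF M(3,4)])
  note \<beta> = bilinear_map_comp[OF f g T'.pure_bilinear]
  show "tensor_map M N M' N' f g \<in> linear_maps (tensor M N) (tensor M' N')"
    unfolding tensor_map_def by (rule T.tensor_lift_linear[OF T'.T.kspace_axioms \<beta>])
  show "x \<in> carrier M \<Longrightarrow> y \<in> carrier N \<Longrightarrow> tensor_map M N M' N' f g (pure M N x y) = pure M' N' (f x) (g y)"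
    unfolding tensor_map_def by (rule T.tensor_lift_pure[OF T'.T.kspace_axioms \<beta>])
qed

text \<open>The inner \<^const>\<open>tensor_lift\<close> is linear in the tensor by construction; its linearity in the last
  factor \<open>z\<close> is checked on pure tensors.\<close>

lemma tensor_assoc_linear:
  assumes C: "kspace C"
  shows "tensor_assoc C \<in> linear_maps (tensor (tensor C C) C) (tensor C (tensor C C))"
    and "x \<in> carrier C \<Longrightarrow> y \<in> carrier C \<Longrightarrow> z \<in> carrier C \<Longrightarrow>
      tensor_assoc C (pure (tensor C C) C (pure C C x y) z) = pure C (tensor C C) x (pure C C y z)"
proof -
  interpret CC: tensor_pair C C by (rule tensor_pairI[OF C C])
  interpret L: tensor_pair "tensor C C" C by (rule tensor_pairI[OF CC.T.kspace_axioms C])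
  interpret R: tensor_pair C "tensor C C" by (rule tensor_pairI[OF C CC.T.kspace_axioms])
  let ?\<gamma> = "\<lambda>z x y. pure C (tensor C C) x (pure C C y z)"
  let ?\<beta> = "\<lambda>s z. tensor_lift C C (tensor C (tensor C C)) (?\<gamma> z) s"
  have \<gamma>: "bilinear_map C C R.T (?\<gamma> z)" if "z \<in> carrier C" for z
    by (rule bilinear_mapI)
      (simp_all add: that bilinear_mapD[OF R.pure_bilinear] bilinear_mapD[OF CC.pure_bilinear])
  have add: "?\<beta> s (z \<oplus>\<^bsub>C\<^esub> z') = ?\<beta> s z \<oplus>\<^bsub>R.T\<^esub> ?\<beta> s z'"
    if z: "z \<in> carrier C" "z' \<in> carrier C" and s: "s \<in> carrier CC.T" for s z z'
  proof (rule CC.linear_maps_eq_on_pures[OF R.T.kspace_axioms _ _ _ s])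
    show "(\<lambda>s. ?\<beta> s z \<oplus>\<^bsub>R.T\<^esub> ?\<beta> s z') \<in> linear_maps CC.T R.T"
      using linear_mapsD[OF CC.tensor_lift_linear[OF R.T.kspace_axioms \<gamma>]] z
      by (intro linear_mapsI) (simp_all add: R.T.a_ac R.T.smult_add_right)
    show "?\<beta> (pure C C x y) (z \<oplus>\<^bsub>C\<^esub> z') = ?\<beta> (pure C C x y) z \<oplus>\<^bsub>R.T\<^esub> ?\<beta> (pure C C x y) z'"
      if "x \<in> carrier C" "y \<in> carrier C" for x y
      using that z by (simp add: CC.tensor_lift_pure[OF R.T.kspace_axioms \<gamma>]
          bilinear_mapD[OF R.pure_bilinear] bilinear_mapD[OF CC.pure_bilinear])
  qed (rule CC.tensor_lift_linear[OF R.T.kspace_axioms \<gamma>], use z in simp)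
  have smult: "?\<beta> s (d \<odot>\<^bsub>C\<^esub> z) = d \<odot>\<^bsub>R.T\<^esub> ?\<beta> s z"
    if z: "z \<in> carrier C" and s: "s \<in> carrier CC.T" for s z d
  proof (rule CC.linear_maps_eq_on_pures[OF R.T.kspace_axioms _ _ _ s])
    show "(\<lambda>s. d \<odot>\<^bsub>R.T\<^esub> ?\<beta> s z) \<in> linear_maps CC.T R.T"
      using linear_mapsD[OF CC.tensor_lift_linear[OF R.T.kspace_axioms \<gamma>]] z
      by (intro linear_mapsI) (simp_all add: R.T.smult_add_right R.T.smult_smult mult.commute)
    show "?\<beta> (pure C C x y) (d \<odot>\<^bsub>C\<^esub> z) = d \<odot>\<^bsub>R.T\<^esub> ?\<beta> (pure C C x y) z"
      if "x \<in> carrier C" "y \<in> carrier C" for x y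
      using that z by (simp add: CC.tensor_lift_pure[OF R.T.kspace_axioms \<gamma>]
          bilinear_mapD[OF R.pure_bilinear] bilinear_mapD[OF CC.pure_bilinear])
  qed (rule CC.tensor_lift_linear[OF R.T.kspace_axioms \<gamma>], use z in simp)
  have \<beta>: "bilinear_map CC.T C R.T ?\<beta>"
    by (rule bilinear_mapI)
      (simp_all add: add smult linear_mapsD[OF CC.tensor_lift_linear[OF R.T.kspace_axioms \<gamma>]])
  show "tensor_assoc C \<in> linear_maps (tensor (tensor C C) C) (tensor C (tensor C C))"
    unfolding tensor_assoc_def by (rule L.tensor_lift_linear[OF R.T.kspace_axioms \<beta>])
  show "tensor_assoc C (pure (tensor C C) C (pure C C x y) z) = pure C (tensor C C) x (pure C C y z)"
    if "x \<in> carrier C" "y \<in> carrier C" "z \<in> carrier C"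
    unfolding tensor_assoc_def using that
    by (simp add: L.tensor_lift_pure[OF R.T.kspace_axioms \<beta>] CC.tensor_lift_pure[OF R.T.kspace_axioms \<gamma>])
qed

section \<open>Free algebras\<close>

lemma free_algebra_simps:
  "carrier (free_algebra X) = carrier (free_space (lists X))"
  "\<zero>\<^bsub>free_algebra X\<^esub> = (\<lambda>w. 0)"
  "\<one>\<^bsub>free_algebra X\<^esub> = single []"
  "f \<oplus>\<^bsub>free_algebra X\<^esub> g = (\<lambda>w. f w + g w)"
  "c \<odot>\<^bsub>free_algebra X\<^esub> f = (\<lambda>w. c * f w)"
  "f \<otimes>\<^bsub>free_algebra X\<^esub> g = (\<lambda>w. \<Sum>i\<le>length w. f (take i w) * g (drop i w))"
  by (auto simp: free_algebra_def free_space_def)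

lemma linear_maps_free_algebra:
  "linear_maps (free_algebra X) P = linear_maps (free_space (lists X)) P"
  by (simp add: LinearCombinations.module_hom_def free_algebra_simps free_space_simps)

lemma abelian_group_free_algebra:
  "abelian_group (free_algebra X :: ('k::field, 'x list \<Rightarrow> 'k) module)"
proof -
  interpret F: kspace "free_space (lists X) :: ('k, 'x list \<Rightarrow> 'k) module" by (rule kspace_free_space)
  have "add_monoid (free_algebra X :: ('k, 'x list \<Rightarrow> 'k) module) = add_monoid (free_space (lists X))"
    by (simp add: free_algebra_def free_space_def)
  then show ?thesis
    using F.M.abelian_group_axioms
    by (simp add: abelian_group_def abelian_monoid_def abelian_group_axioms_def)
qed

lemma kspace_free_algebra: "kspace (free_algebra X :: ('k::field, 'x list \<Rightarrow> 'k) module)"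
proof (rule kspaceI, rule vectorspaceI)
  interpret F: kspace "free_space (lists X) :: ('k, 'x list \<Rightarrow> 'k) module" by (rule kspace_free_space)
  fix c :: 'k and f :: "'x list \<Rightarrow> 'k"
  assume "f \<in> carrier (free_algebra X)"
  then show "c \<odot>\<^bsub>free_algebra X\<^esub> f \<in> carrier (free_algebra X)"
    using F.smult_closed'[of f c] by (simp only: free_algebra_simps free_space_simps(4))
qed (simp_all only: abelian_group_free_algebra free_algebra_simps(4,5) distrib_left distrib_right mult.assoc mult_1_left)

lemma free_algebra_mult_closed:
  assumes f: "f \<in> carrier (free_algebra X)" and g: "g \<in> carrier (free_algebra X)"
  shows "f \<otimes>\<^bsub>free_algebra X\<^esub> g \<in> carrier (free_algebra X)"
proof -
  have "{w. (f \<otimes>\<^bsub>free_algebra X\<^esub> g) w \<noteq> 0} \<subseteq> (\<lambda>(u, v). u @ v) ` ({w. f w \<noteq> 0} \<times> {w. g w \<noteq> 0})"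
  proof
    fix w assume "w \<in> {w. (f \<otimes>\<^bsub>free_algebra X\<^esub> g) w \<noteq> 0}"
    then have "(\<Sum>i\<le>length w. f (take i w) * g (drop i w)) \<noteq> 0"
      by (simp add: free_algebra_simps)
    then obtain i where "f (take i w) * g (drop i w) \<noteq> 0"
      by (rule sum.not_neutral_contains_not_neutral)
    then show "w \<in> (\<lambda>(u, v). u @ v) ` ({w. f w \<noteq> 0} \<times> {w. g w \<noteq> 0})"
      by (intro image_eqI[of _ _ "(take i w, drop i w)"]) auto
  qed
  moreover have "finite ((\<lambda>(u, v). u @ v) ` ({w. f w \<noteq> 0} \<times> {w. g w \<noteq> 0}))"
    "(\<lambda>(u, v). u @ v) ` ({w. f w \<noteq> 0} \<times> {w. g w \<noteq> 0}) \<subseteq> lists X"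
    using f g by (fastforce simp: free_algebra_simps free_space_simps subset_iff)+
  ultimately show ?thesis
    unfolding free_algebra_simps(1) free_space_simps(1) using finite_subset subset_trans by meson
qed

lemma free_algebra_mult_assoc:
  "f \<otimes>\<^bsub>free_algebra X\<^esub> g \<otimes>\<^bsub>free_algebra X\<^esub> h = f \<otimes>\<^bsub>free_algebra X\<^esub> (g \<otimes>\<^bsub>free_algebra X\<^esub> h)"
proof
  fix w :: "'a list"
  let ?l = "length w"
  have "(f \<otimes>\<^bsub>free_algebra X\<^esub> g \<otimes>\<^bsub>free_algebra X\<^esub> h) w =
      (\<Sum>k\<le>?l. \<Sum>i\<le>k. f (take i w) * g (drop i (take k w)) * h (drop k w))"
    by (auto simp: free_algebra_simps sum_distrib_right min_def intro!: sum.cong)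
  also have "\<dots> = (\<Sum>(k, i)\<in>(SIGMA k:{..?l}. {..k}). f (take i w) * g (drop i (take k w)) * h (drop k w))"
    by (simp add: sum.Sigma)
  also have "\<dots> = (\<Sum>(i, j)\<in>(SIGMA i:{..?l}. {..?l - i}).
      f (take i w) * (g (take j (drop i w)) * h (drop j (drop i w))))"
    by (rule sum.reindex_bij_witness[where j="\<lambda>(k, i). (i, k - i)" and i="\<lambda>(i, j). (i + j, i)"])
      (auto simp: drop_take mult.assoc)
  also have "\<dots> = (\<Sum>i\<le>?l. \<Sum>j\<le>?l - i. f (take i w) * (g (take j (drop i w)) * h (drop j (drop i w))))"
    by (simp add: sum.Sigma)
  also have "\<dots> = (f \<otimes>\<^bsub>free_algebra X\<^esub> (g \<otimes>\<^bsub>free_algebra X\<^esub> h)) w"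
    by (simp add: free_algebra_simps sum_distrib_left)
  finally show "(f \<otimes>\<^bsub>free_algebra X\<^esub> g \<otimes>\<^bsub>free_algebra X\<^esub> h) w =
    (f \<otimes>\<^bsub>free_algebra X\<^esub> (g \<otimes>\<^bsub>free_algebra X\<^esub> h)) w" .
qed

lemma free_algebra_mult_single:
  "single u \<otimes>\<^bsub>free_algebra X\<^esub> single v = (single (u @ v) :: 'x list \<Rightarrow> 'k::field)"
proof
  fix w :: "'x list"
  have "(single u \<otimes>\<^bsub>free_algebra X\<^esub> single v) w =
      (\<Sum>i\<le>length w. if take i w = u \<and> drop i w = v then 1 else 0 :: 'k)"
    by (auto simp: free_algebra_simps single_def intro!: sum.cong)
  also have "\<dots> = (\<Sum>i\<in>{i. i \<le> length w \<and> take i w = u \<and> drop i w = v}. 1 :: 'k)"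
    by (simp add: sum.If_cases Int_def)
  also have "{i. i \<le> length w \<and> take i w = u \<and> drop i w = v} = (if w = u @ v then {length u} else {})"
    by (auto simp: min_def dest: arg_cong[where f=length])
  finally show "(single u \<otimes>\<^bsub>free_algebra X\<^esub> single v) w = (single (u @ v) w :: 'k)"
    by (auto simp: single_def)
qed

lemma free_algebra_one:
  shows "single [] \<otimes>\<^bsub>free_algebra X\<^esub> f = f" and "f \<otimes>\<^bsub>free_algebra X\<^esub> single [] = f"
proof -
  have "(\<Sum>i\<le>length w. single [] (take i w) * f (drop i w)) = (\<Sum>i\<in>{0}. f (drop i w))" for w
    by (rule sum.mono_neutral_cong_right) (auto simp: single_def)
  then show "single [] \<otimes>\<^bsub>free_algebra X\<^esub> f = f"
    by (simp add: free_algebra_simps)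
  have "(\<Sum>i\<le>length w. f (take i w) * single [] (drop i w)) = (\<Sum>i\<in>{length w}. f (take i w))" for w
    by (rule sum.mono_neutral_cong_right) (auto simp: single_def)
  then show "f \<otimes>\<^bsub>free_algebra X\<^esub> single [] = f"
    by (simp add: free_algebra_simps)
qed

lemma free_algebra_smult_mult:
  shows "(c \<odot>\<^bsub>free_algebra X\<^esub> f) \<otimes>\<^bsub>free_algebra X\<^esub> g = c \<odot>\<^bsub>free_algebra X\<^esub> (f \<otimes>\<^bsub>free_algebra X\<^esub> g)"
    and "f \<otimes>\<^bsub>free_algebra X\<^esub> (c \<odot>\<^bsub>free_algebra X\<^esub> g) = c \<odot>\<^bsub>free_algebra X\<^esub> (f \<otimes>\<^bsub>free_algebra X\<^esub> g)"
  by (auto simp: free_algebra_simps sum_distrib_left algebra_simps)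

lemma ring_free_algebra: "ring (free_algebra X :: ('k::field, 'x list \<Rightarrow> 'k) module)"
proof (rule ringI)
  show "Group.monoid (free_algebra X :: ('k::field, 'x list \<Rightarrow> 'k) module)"
    by (rule monoidI)
      (simp_all add: free_algebra_mult_closed free_algebra_mult_assoc free_algebra_simps(1,3) free_algebra_one
        free_algebra_mult_closed[unfolded free_algebra_simps(1)])
qed (auto simp: abelian_group_free_algebra free_algebra_simps algebra_simps sum.distrib)

section \<open>Sorting words\<close>

text \<open>The scalar collected when a word is sorted: since \<open>x\<^sub>i x\<^sub>j = q\<^sub>j\<^sub>i x\<^sub>j x\<^sub>i\<close>, every letter \<open>j\<close> standing
  behind a larger letter \<open>i\<close> contributes \<open>q\<^sub>j\<^sub>i\<close>.\<close>

fun word_coeff :: "(nat \<Rightarrow> nat \<Rightarrow> 'k::field) \<Rightarrow> nat list \<Rightarrow> 'k" where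
  "word_coeff q [] = 1"
| "word_coeff q (i # w) = (\<Prod>j\<leftarrow>w. if j < i then q j i else 1) * word_coeff q w"

definition word_content :: "nat list \<Rightarrow> nat \<Rightarrow> int" where
  "word_content w i = int (count_list w i)"

definition sorted_word :: "nat \<Rightarrow> (nat \<Rightarrow> int) \<Rightarrow> nat list" where
  "sorted_word n v = concat (map (\<lambda>i. replicate (nat (v i)) i) [1..<Suc n])"

lemma word_content_append: "word_content (u @ v) = (\<lambda>i. word_content u i + word_content v i)"
  by (auto simp: word_content_def)

lemma word_content_Nil: "word_content [] = (\<lambda>i. 0)"
  by (auto simp: word_content_def)

lemma word_content_Cons: "word_content (i # w) = (\<lambda>j. basis_vec i j + word_content w j)"
  by (auto simp: word_content_def basis_vec_def)

lemma word_content_nonneg: "word_content w i \<ge> 0"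
  by (simp add: word_content_def)

lemma word_content_outside: "w \<in> lists X \<Longrightarrow> i \<notin> X \<Longrightarrow> word_content w i = 0"
  by (auto simp: word_content_def count_list_0_iff)

lemma sorted_word_in_lists: "sorted_word n v \<in> lists {1..n}"
  by (auto simp: sorted_word_def)

lemma sorted_sorted_word: "sorted (sorted_word n v)"
proof (induction n)
  case (Suc n)
  have "sorted_word (Suc n) v = sorted_word n v @ replicate (nat (v (Suc n))) (Suc n)"
    by (simp add: sorted_word_def)
  moreover have "\<forall>x\<in>set (sorted_word n v). x \<le> Suc n"
    using sorted_word_in_lists[of n v] by auto
  ultimately show ?case using Suc by (auto simp: sorted_append)
qed (simp add: sorted_word_def)

lemma word_content_sorted_word:
  "word_content (sorted_word n v) = (\<lambda>i. if i \<in> {1..n} \<and> 0 \<le> v i then v i else 0)"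
proof (induction n)
  case (Suc n)
  have "sorted_word (Suc n) v = sorted_word n v @ replicate (nat (v (Suc n))) (Suc n)"
    by (simp add: sorted_word_def)
  moreover have "word_content (replicate k j) = (\<lambda>i. if i = j then int k else 0)" for k j
  proof
    fix i show "word_content (replicate k j) i = (if i = j then int k else 0)"
      by (induction k) (auto simp: word_content_def)
  qed
  ultimately show ?case by (auto simp: word_content_append Suc fun_eq_iff)
qed (auto simp: sorted_word_def word_content_Nil)

lemma sort_eq_sorted_word:
  assumes "w \<in> lists {1..n}"
  shows "sort w = sorted_word n (word_content w)"
proof (rule properties_for_sort[symmetric, OF _ sorted_sorted_word, symmetric])
  have "word_content (sorted_word n (word_content w)) = word_content w"
    using assms word_content_outside[OF assms] by (auto simp: word_content_sorted_word word_content_nonneg)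
  then have "count_list (sorted_word n (word_content w)) i = count_list w i" for i
    unfolding word_content_def by (metis of_nat_eq_iff)
  then show "mset (sorted_word n (word_content w)) = mset w"
    by (intro multiset_eqI) (metis count_mset)
qed

lemma word_coeff_sorted: "sorted w \<Longrightarrow> word_coeff q w = 1"
proof (induction w)
  case (Cons i w)
  then have "map (\<lambda>j. if j < i then q j i else 1) w = map (\<lambda>j. 1) w" by auto
  with Cons show ?case by (simp add: map_replicate_const)
qed simp

section \<open>The standard basis\<close>

(* keeps the index set in the form {1..n}, in which the hypotheses on a and q are stated *)
declare One_nat_def [simp del]

locale quantum_complete_intersection =
  fixes n :: nat and a :: "nat \<Rightarrow> int" and q :: "nat \<Rightarrow> nat \<Rightarrow> 'k::field"
  assumes a_ge_2: "\<And>i. i \<in> {1..n} \<Longrightarrow> a i \<ge> 2"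
    and q_diag: "\<And>i. i \<in> {1..n} \<Longrightarrow> q i i = 1"
    and q_inverse: "\<And>i j. i \<in> {1..n} \<Longrightarrow> j \<in> {1..n} \<Longrightarrow> q i j * q j i = 1"
begin

lemma q_nonzero: "i \<in> {1..n} \<Longrightarrow> j \<in> {1..n} \<Longrightarrow> q i j \<noteq> 0"
  using q_inverse[of i j] by auto

lemma q_swap: "i \<in> {1..n} \<Longrightarrow> j \<in> {1..n} \<Longrightarrow> q j i = inverse (q i j)"
  using q_inverse[of i j] by (simp add: inverse_unique)

abbreviation "V \<equiv> exponents n a"
abbreviation "qp \<equiv> q_pow n q"

lemma qp_add_left: "qp (\<lambda>i. u i + u' i) v = qp u v * qp u' v"
  unfolding q_pow_def prod.distrib[symmetric]
  by (rule prod.cong) (auto simp: q_nonzero power_int_add distrib_right)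

lemma qp_add_right: "qp u (\<lambda>i. v i + v' i) = qp u v * qp u v'"
  unfolding q_pow_def prod.distrib[symmetric]
  by (rule prod.cong) (auto simp: q_nonzero power_int_add distrib_left)

lemma qp_zero [simp]: "qp (\<lambda>i. 0) v = 1" "qp u (\<lambda>i. 0) = 1"
  by (auto simp: q_pow_def intro!: prod.neutral)

lemma qp_nonzero [simp]: "qp u v \<noteq> 0"
proof -
  have "finite {(i, j). 1 \<le> i \<and> i < j \<and> j \<le> n}"
    by (rule finite_subset[of _ "{1..n} \<times> {1..n}"]) auto
  then show ?thesis by (auto simp: q_pow_def q_nonzero)
qed

text \<open>The factor in \<open>x\<^sub>i x\<^sub>j\<close>: it is trivial when the letters already stand in increasing order.\<close>

lemma qp_basis:
  assumes "i \<in> {1..n}" "j \<in> {1..n}"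
  shows "qp (basis_vec i) (basis_vec j) = (if j < i then q j i else 1)"
proof -
  have fin: "finite {(i, j). 1 \<le> i \<and> i < j \<and> j \<le> n}"
    by (rule finite_subset[of _ "{1..n} \<times> {1..n}"]) auto
  have "qp (basis_vec i) (basis_vec j) =
      (\<Prod>p\<in>{(i, j). 1 \<le> i \<and> i < j \<and> j \<le> n}. if p = (j, i) then q j i else 1)"
    unfolding q_pow_def
  proof (rule prod.cong, goal_cases)
    case (2 p)
    then show ?case by (cases p) (auto simp: basis_vec_def)
  qed simp
  also have "\<dots> = (if j < i then q j i else 1)"
    using assms fin by (subst prod.delta) auto
  finally show ?thesis .
qed

lemma qp_basis_content:
  assumes "i \<in> {1..n}" "w \<in> lists {1..n}"
  shows "(\<Prod>j\<leftarrow>w. if j < i then q j i else 1) = qp (basis_vec i) (word_content w)"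
  using assms(2)
proof (induction w)
  case (Cons j w)
  then show ?case
    using assms(1) qp_basis[of i j] by (simp add: word_content_Cons qp_add_right)
qed (simp add: word_content_Nil)

text \<open>The inversions of \<open>u @ v\<close> are those inside \<open>u\<close>, those inside \<open>v\<close> and those between a letter of
  \<open>u\<close> and a letter of \<open>v\<close>; the last kind depends on the contents of the two words only.\<close>

lemma word_coeff_append:
  assumes "u \<in> lists {1..n}" "v \<in> lists {1..n}"
  shows "word_coeff q (u @ v) = word_coeff q u * word_coeff q v * qp (word_content u) (word_content v)"
  using assms(1)
proof (induction u)
  case (Cons i u)
  then show ?case
    using assms(2) qp_basis_content[of i v] by (simp add: word_content_Cons qp_add_left)
qed (simp add: word_content_Nil)

text \<open>A function vanishing outside \<open>{1..n}\<close> is recovered from its restriction to \<open>{1..n}\<close>.\<close>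

lemma finite_V [simp, intro]: "finite V"
proof -
  have "V \<subseteq> (\<lambda>f i. if i \<in> {1..n} then f i else 0) ` (PiE {1..n} (\<lambda>i. {0..a i - 1}))"
  proof
    fix v assume "v \<in> V"
    then show "v \<in> (\<lambda>f i. if i \<in> {1..n} then f i else 0) ` (PiE {1..n} (\<lambda>i. {0..a i - 1}))"
      by (intro image_eqI[of _ _ "restrict v {1..n}"]) (auto simp: exponents_def fun_eq_iff)
  qed
  moreover have "finite ((\<lambda>f i. if i \<in> {1..n} then f i else 0) ` (PiE {1..n} (\<lambda>i. {0..a i - 1})))"
    by (intro finite_imageI finite_PiE) auto
  ultimately show ?thesis by (rule finite_subset)
qed

abbreviation "F \<equiv> (free_algebra {1..n} :: ('k, nat list \<Rightarrow> 'k) module)"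
abbreviation "I \<equiv> qci_ideal n q a"
abbreviation "A \<equiv> qci n q a"
abbreviation "x \<equiv> qci_monom n q a"
abbreviation mult_A (infixl "\<star>" 70) where "X \<star> Y \<equiv> X \<otimes>\<^bsub>A\<^esub> Y"
abbreviation smult_A (infixl "*\<^sub>A" 70) where "b *\<^sub>A X \<equiv> b \<odot>\<^bsub>A\<^esub> X"
abbreviation one_A ("\<one>\<^sub>A") where "\<one>\<^sub>A \<equiv> \<one>\<^bsub>A\<^esub>"

sublocale F: kspace F by (rule kspace_free_algebra)
sublocale FR: ring F by (rule ring_free_algebra)

lemma single_in_F [simp]: "w \<in> lists {1..n} \<Longrightarrow> single w \<in> carrier F"
  by (simp only: free_algebra_simps(1) single_in_free_space)

lemma single_pow: "single [i] [^]\<^bsub>F\<^esub> (k::nat) = single (replicate k i)"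
proof (induction k)
  case (Suc k)
  then show ?case
    by (simp add: free_algebra_mult_single replicate_append_same)
qed (simp add: free_algebra_simps(3))

lemma relations_subset: "qci_relations n q a \<subseteq> carrier F"
proof -
  have "single [i] \<in> carrier F" if "i \<in> {1..n}" for i
    using that by (intro single_in_F) auto
  then show ?thesis unfolding qci_relations_def Let_def
    by (auto intro!: FR.nat_pow_closed F.minus_closed FR.m_closed F.smult_closed')
qed

sublocale I: ideal I F
  unfolding qci_ideal_def by (rule FR.genideal_ideal[OF relations_subset])

lemma relations_in_I: "qci_relations n q a \<subseteq> I"
  unfolding qci_ideal_def by (rule FR.genideal_self[OF relations_subset])

lemma I_smult: 
  assumes "f \<in> I" shows "c \<odot>\<^bsub>F\<^esub> f \<in> I"
proof -
  have f: "f \<in> carrier F" using assms I.a_subset by auto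
  have "(c \<odot>\<^bsub>F\<^esub> \<one>\<^bsub>F\<^esub>) \<otimes>\<^bsub>F\<^esub> f \<in> I"
    using assms by (intro I.I_l_closed F.smult_closed') auto
  then show ?thesis using f by (simp add: free_algebra_smult_mult)
qed

sublocale quotient_space F I
proof (rule quotient_space.intro)
  show "submodule class_ring I F"
    by (rule submodule.intro) (use I.a_subset I_smult in \<open>auto intro: F.module_axioms\<close>)
qed (rule F.vectorspace_axioms)

sublocale A: kspace A
  unfolding qci_def by (rule kspaceI[OF vectorspace_quotient])

lemma carrier_A: "carrier A = cls ` carrier F"
  unfolding qci_def by (rule carrier_quotient)

lemma cls_mult: "f \<in> carrier F \<Longrightarrow> g \<in> carrier F \<Longrightarrow> cls f \<star> cls g = cls (f \<otimes>\<^bsub>F\<^esub> g)"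
  using I.rcoset_mult_add by (simp add: qci_def quotient_module_def ring.defs module.defs FactRing_def)

lemma cls_one: "\<one>\<^sub>A = cls \<one>\<^bsub>F\<^esub>"
  by (simp add: qci_def quotient_module_def ring.defs module.defs FactRing_def)

lemmas cls_add = add_quotient[folded qci_def]
lemmas cls_smult = smult_quotient[folded qci_def]
lemmas cls_closed = cls_in_carrier[folded qci_def]

lemma ring_A: "ring A"
proof (rule ringI)
  show "abelian_group A" by (rule A.M.abelian_group_axioms)
  show "Group.monoid A"
    by (rule monoidI) (auto simp: carrier_A cls_mult cls_one FR.m_assoc)
qed (auto simp: carrier_A cls_mult cls_add FR.l_distr FR.r_distr)

sublocale AR: ring A by (rule ring_A)

lemma smult_mult:
  assumes "X \<in> carrier A" "Y \<in> carrier A"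
  shows "(c *\<^sub>A X) \<star> Y = c *\<^sub>A (X \<star> Y)"
    and "X \<star> (c *\<^sub>A Y) = c *\<^sub>A (X \<star> Y)"
proof -
  obtain f g where "f \<in> carrier F" "g \<in> carrier F" "X = cls f" "Y = cls g"
    using assms unfolding carrier_A by auto
  then show "(c *\<^sub>A X) \<star> Y = c *\<^sub>A (X \<star> Y)"
    "X \<star> (c *\<^sub>A Y) = c *\<^sub>A (X \<star> Y)"
    by (simp_all add: cls_smult cls_mult free_algebra_smult_mult)
qed

definition word_class :: "nat list \<Rightarrow> (nat list \<Rightarrow> 'k) set" where
  "word_class w = cls (single w)"

lemma word_class_closed [simp]: "w \<in> lists {1..n} \<Longrightarrow> word_class w \<in> carrier A"
  unfolding word_class_def by (intro cls_closed single_in_F)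

lemma word_class_mult: "u \<in> lists {1..n} \<Longrightarrow> v \<in> lists {1..n} \<Longrightarrow> word_class u \<star> word_class v = word_class (u @ v)"
  unfolding word_class_def by (simp only: cls_mult single_in_F free_algebra_mult_single)

lemma word_class_Nil: "word_class [] = \<one>\<^sub>A"
  by (simp add: word_class_def cls_one free_algebra_simps(3))

lemma word_class_swap:
  assumes "i \<in> {1..n}" "j \<in> {1..n}"
  shows "word_class [j, i] = q i j *\<^sub>A word_class [i, j]"
proof -
  have "single [j] \<otimes>\<^bsub>F\<^esub> single [i] \<ominus>\<^bsub>F\<^esub> (q i j \<odot>\<^bsub>F\<^esub> (single [i] \<otimes>\<^bsub>F\<^esub> single [j])) \<in> qci_relations n q a"
    unfolding qci_relations_def Let_def using assms by blast
  then have *: "single [j, i] \<ominus>\<^bsub>F\<^esub> (q i j \<odot>\<^bsub>F\<^esub> single [i, j]) \<in> I"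
    using relations_in_I by (auto simp: free_algebra_mult_single)
  have s: "single [j, i] \<in> carrier F" "single [i, j] \<in> carrier F"
    using assms by (auto intro!: single_in_F)
  have "cls (single [j, i]) = cls (q i j \<odot>\<^bsub>F\<^esub> single [i, j])"
    using cls_eq_iff[OF s(1) F.smult_closed'[OF s(2)]] * by blast
  also have "\<dots> = q i j *\<^sub>A cls (single [i, j])"
    by (rule cls_smult[OF s(2), symmetric])
  finally show ?thesis unfolding word_class_def .
qed

lemma word_class_power_zero:
  assumes "i \<in> {1..n}"
  shows "word_class (replicate (nat (a i)) i) = \<zero>\<^bsub>A\<^esub>"
proof -
  have "single [i] [^]\<^bsub>F\<^esub> nat (a i) \<in> qci_relations n q a"
    unfolding qci_relations_def Let_def using assms by blast
  then have "single (replicate (nat (a i)) i) \<in> I"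
    using relations_in_I by (auto simp: single_pow)
  moreover have "single (replicate (nat (a i)) i) \<in> carrier F"
    using assms by (intro single_in_F) auto
  ultimately have "cls (single (replicate (nat (a i)) i)) = cls \<zero>\<^bsub>F\<^esub>"
    by (subst cls_eq_iff) (simp_all add: F.minus_eq)
  then show ?thesis unfolding word_class_def qci_def zero_quotient .
qed

text \<open>The letter \<open>i\<close> moves to the right past exactly the letters smaller than itself.\<close>

lemma word_class_insort:
  assumes "i \<in> {1..n}" "w \<in> lists {1..n}"
  shows "word_class (i # w) = qp (basis_vec i) (word_content (takeWhile (\<lambda>j. j < i) w)) *\<^sub>A word_class (insort i w)"
  using assms(2)
proof (induction w)
  case Nil
  have "word_class [i] \<in> carrier A" using assms(1) by (intro word_class_closed) auto
  then show ?case by (simp add: word_content_Nil)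
next
  case (Cons j w)
  then have j: "j \<in> {1..n}" "w \<in> lists {1..n}" by auto
  have l: "[i] \<in> lists {1..n}" "[j] \<in> lists {1..n}" "[i,j] \<in> lists {1..n}" "[j, i] \<in> lists {1..n}"
    "i # j # w \<in> lists {1..n}" "i # w \<in> lists {1..n}" "insort i w \<in> lists {1..n}"
    using assms(1) j by (auto simp: set_insort_key)
  show ?case
  proof (cases "i \<le> j")
    case True
    then show ?thesis using word_class_closed[OF l(5)] by (simp add: word_content_Nil)
  next
    case False
    have "word_class (i # j # w) = word_class [i, j] \<star> word_class w"
      by (subst word_class_mult[OF l(3) j(2)]) simp
    also have "\<dots> = (q j i *\<^sub>A word_class [j, i]) \<star> word_class w"
      by (simp only: word_class_swap[OF j(1) assms(1)])
    also have "\<dots> = q j i *\<^sub>A (word_class [j] \<star> word_class (i # w))"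
      by (simp add: smult_mult word_class_closed[OF l(4)] word_class_closed[OF j(2)] word_class_mult[OF l(4) j(2)] word_class_mult[OF l(2) l(6)])
    also have "\<dots> = q j i *\<^sub>A (word_class [j] \<star>
        (qp (basis_vec i) (word_content (takeWhile (\<lambda>j. j < i) w)) *\<^sub>A word_class (insort i w)))"
      using Cons.IH by (simp only:)
    also have "\<dots> = (q j i * qp (basis_vec i) (word_content (takeWhile (\<lambda>j. j < i) w))) *\<^sub>A word_class (j # insort i w)"
      using l by (simp add: smult_mult word_class_closed word_class_mult A.smult_smult)
    also have "q j i * qp (basis_vec i) (word_content (takeWhile (\<lambda>j. j < i) w)) =
        qp (basis_vec i) (word_content (takeWhile (\<lambda>j. j < i) (j # w)))"
      using False qp_basis[OF assms(1) j(1)] by (simp add: word_content_Cons qp_add_right)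
    finally show ?thesis using False by simp
  qed
qed

lemma prod_list_takeWhile_sorted:
  "sorted w \<Longrightarrow> (\<Prod>j\<leftarrow>takeWhile (\<lambda>j. j < i) w. if j < i then q j i else 1) = (\<Prod>j\<leftarrow>w. if j < i then q j i else 1)"
proof (induction w)
  case (Cons j w)
  show ?case
  proof (cases "j < i")
    case False
    then have "map (\<lambda>j. if j < i then q j i else 1) w = map (\<lambda>j. 1) w"
      using Cons.prems by auto
    then show ?thesis using False by (simp add: map_replicate_const)
  qed (use Cons in simp)
qed simp

lemma word_content_sort: "word_content (sort w) = word_content w"
  by (auto simp: word_content_def fun_eq_iff simp flip: count_mset)

text \<open>Insertion sort expresses the class of an arbitrary word through a standard monomial; this gives both
  the spanning property of the standard monomials and their multiplication rule.\<close>

lemma word_class_sort: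
  assumes "w \<in> lists {1..n}"
  shows "word_class w = word_coeff q w *\<^sub>A word_class (sorted_word n (word_content w))"
proof -
  have "word_class w = word_coeff q w *\<^sub>A word_class (sort w)"
    using assms
  proof (induction w)
    case Nil
    then show ?case using word_class_closed[of "[]"] by simp
  next
    case (Cons i w)
    then have i: "i \<in> {1..n}" "w \<in> lists {1..n}" by auto
    have l: "[i] \<in> lists {1..n}" "sort w \<in> lists {1..n}" "takeWhile (\<lambda>j. j < i) (sort w) \<in> lists {1..n}"
      "insort i (sort w) \<in> lists {1..n}"
      using i by (auto simp: set_insort_key dest: set_takeWhileD)
    have c: "qp (basis_vec i) (word_content (takeWhile (\<lambda>j. j < i) (sort w))) = qp (basis_vec i) (word_content w)"
      using qp_basis_content[OF i(1) l(3)] prod_list_takeWhile_sorted[of "sort w" i] qp_basis_content[OF i(1) l(2)]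
      by (simp add: word_content_sort)
    have "word_class (i # w) = word_class [i] \<star> word_class w"
      using word_class_mult[OF l(1) i(2)] by simp
    also have "\<dots> = word_class [i] \<star> (word_coeff q w *\<^sub>A word_class (sort w))"
      using Cons.IH by (simp only:)
    also have "\<dots> = word_coeff q w *\<^sub>A word_class (i # sort w)"
      using word_class_mult[OF l(1,2)] by (simp add: smult_mult word_class_closed[OF l(1)] word_class_closed[OF l(2)])
    also have "\<dots> = (word_coeff q w * qp (basis_vec i) (word_content w)) *\<^sub>A word_class (insort i (sort w))"
      by (simp add: word_class_insort[OF i(1) l(2)] c A.smult_smult word_class_closed[OF l(4)])
    finally show ?case using qp_basis_content[OF i] by (simp add: mult.commute)
  qed
  then show ?thesis using sort_eq_sorted_word[OF assms] by simp
qed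

lemma monom_eq_word_class: "x v = word_class (sorted_word n v)"
proof -
  have pow: "qci_gen n q a i [^]\<^bsub>A\<^esub> (k::nat) = word_class (replicate k i)" if "i \<in> {1..n}" for i k
  proof (induction k)
    case (Suc k)
    have "replicate k i \<in> lists {1..n}" "[i] \<in> lists {1..n}" using that by auto
    then show ?case using Suc word_class_mult[of "replicate k i" "[i]"]
      by (simp add: qci_gen_def word_class_def replicate_append_same)
  qed (simp add: word_class_Nil)
  have "foldr (\<lambda>i y. (qci_gen n q a i [^]\<^bsub>A\<^esub> nat (v i)) \<star> y) is \<one>\<^sub>A =
      word_class (concat (map (\<lambda>i. replicate (nat (v i)) i) is))" if "is \<in> lists {1..n}" for "is"
    using that
  proof (induction "is")
    case (Cons i "is")
    then have "replicate (nat (v i)) i \<in> lists {1..n}"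
      "concat (map (\<lambda>i. replicate (nat (v i)) i) is) \<in> lists {1..n}" by auto
    then show ?case using Cons word_class_mult pow by simp
  qed (simp add: word_class_Nil)
  moreover have "[1..<Suc n] \<in> lists {1..n}"
    by (simp add: in_lists_conv_set del: upt_Suc)
  ultimately show ?thesis
    unfolding qci_monom_def sorted_word_def by blast
qed

lemma monom_closed [simp]: "x v \<in> carrier A"
  unfolding monom_eq_word_class by (intro word_class_closed sorted_word_in_lists)

lemma monom_zero: "x (\<lambda>i. 0) = \<one>\<^sub>A"
proof -
  have "sorted_word n (\<lambda>i. 0) = []" by (auto simp: sorted_word_def)
  then show ?thesis by (simp add: monom_eq_word_class word_class_Nil)
qed

text \<open>The sorted word of \<open>v\<close> contains a block of at least \<open>a\<^sub>i\<close> letters \<open>i\<close>.\<close>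

lemma monom_vanish:
  assumes "i \<in> {1..n}" "v i \<ge> a i"
  shows "x v = \<zero>\<^bsub>A\<^esub>"
proof -
  let ?w = "\<lambda>is. concat (map (\<lambda>i. replicate (nat (v i)) i) is)"
  have "[1..<Suc n] = [1..<i] @ i # [Suc i..<Suc n]"
    using assms(1) upt_add_eq_append[of 1 i "Suc n - i"] upt_conv_Cons[of i "Suc n"] by (simp del: upt_Suc)
  moreover have "replicate (nat (v i)) i = replicate (nat (a i)) i @ replicate (nat (v i - a i)) i"
    using assms a_ge_2[of i] by (simp add: nat_diff_distrib flip: replicate_add)
  ultimately have "sorted_word n v = ?w [1..<i] @ replicate (nat (a i)) i @ replicate (nat (v i - a i)) i @ ?w [Suc i..<Suc n]"
    unfolding sorted_word_def by simp
  moreover have "?w [1..<i] \<in> lists {1..n}" "replicate (nat (a i)) i \<in> lists {1..n}"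
    "replicate (nat (v i - a i)) i @ ?w [Suc i..<Suc n] \<in> lists {1..n}"
    using assms(1) by auto
  ultimately have "x v = word_class (?w [1..<i]) \<star> (word_class (replicate (nat (a i)) i) \<star>
      word_class (replicate (nat (v i - a i)) i @ ?w [Suc i..<Suc n]))"
    unfolding monom_eq_word_class by (simp add: word_class_mult del: append.simps)
  then show ?thesis
    using word_class_power_zero[OF assms(1)] \<open>?w [1..<i] \<in> _\<close> \<open>replicate (nat (v i - a i)) i @ _ \<in> _\<close>
    by (simp del: replicate_append_same)
qed

text \<open>Concatenating two sorted words creates inversions between the two halves only.\<close>

lemma monom_mult_gen:
  assumes "\<And>i. 0 \<le> u i" "\<And>i. 0 \<le> v i" "\<And>i. i \<notin> {1..n} \<Longrightarrow> u i = 0" "\<And>i. i \<notin> {1..n} \<Longrightarrow> v i = 0"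
  shows "x u \<star> x v = qp u v *\<^sub>A x (\<lambda>i. u i + v i)"
proof -
  let ?u = "sorted_word n u" and ?v = "sorted_word n v"
  have l: "?u \<in> lists {1..n}" "?v \<in> lists {1..n}" by (rule sorted_word_in_lists)+
  have c: "word_content ?u = u" "word_content ?v = v"
    using assms by (auto simp: word_content_sorted_word fun_eq_iff)
  have "x u \<star> x v = word_class (?u @ ?v)"
    unfolding monom_eq_word_class by (rule word_class_mult[OF l])
  also have "\<dots> = word_coeff q (?u @ ?v) *\<^sub>A x (\<lambda>i. u i + v i)"
    using word_class_sort[of "?u @ ?v"] l unfolding monom_eq_word_class by (simp add: word_content_append c)
  also have "word_coeff q (?u @ ?v) = qp u v"
    using word_coeff_append[OF l] by (simp add: c word_coeff_sorted sorted_sorted_word)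
  finally show ?thesis .
qed

text \<open>The value of \<open>x\<^sub>v\<^sup>*\<close> on the class of a word. Extending it linearly to the free algebra gives the
  candidates \<open>lcoef v\<close> for the coordinates, which have to be shown to vanish on the ideal of relations.\<close>

definition word_functional :: "(nat \<Rightarrow> int) \<Rightarrow> nat list \<Rightarrow> 'k" where
  "word_functional v w = (if word_content w = v then word_coeff q w else 0)"

abbreviation "lcoef v \<equiv> linear_extension scalar_space (word_functional v)"

lemma lcoef_linear: "lcoef v \<in> linear_maps F scalar_space"
  unfolding linear_maps_free_algebra
  by (rule linear_extension_linear[OF kspace_scalar_space]) simp

lemma lcoef_single: "lcoef v (single w) = word_functional v w"
  by (rule linear_extension_single[OF kspace_scalar_space]) simp

lemma lcoef_negative: "v i < 0 \<Longrightarrow> lcoef v f = 0"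
  using word_content_nonneg[of _ i]
  by (auto simp: linear_extension_def word_functional_def not_less[symmetric] intro!: sum.neutral)

text \<open>A word of content \<open>v\<close> is cut into two words whose contents add up to \<open>v\<close>, and its coefficient
  factors by \<open>word_coeff_append\<close>. So the coordinates given by \<open>lcoef\<close> multiply by
  the rule expected in the quotient.\<close>

lemma lcoef_mult:
  assumes f: "f \<in> carrier F" and g: "g \<in> carrier F" and v: "v \<in> V"
  shows "lcoef v (f \<otimes>\<^bsub>F\<^esub> g) = (\<Sum>u\<in>V. qp u (\<lambda>i. v i - u i) * lcoef u f * lcoef (\<lambda>i. v i - u i) g)"
proof -
  let ?f = "{w. f w \<noteq> 0}" and ?g = "{w. g w \<noteq> 0}"
  have fin: "finite ?f" "finite ?g" and sub: "?f \<subseteq> lists {1..n}" "?g \<subseteq> lists {1..n}"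
    using f g unfolding free_algebra_simps(1) free_space_simps by auto
  \<comment> \<open>a finite set of words containing all products of words of \<open>f\<close> and \<open>g\<close>\<close>
  obtain S where S: "finite S" "\<And>u v. f u \<noteq> 0 \<Longrightarrow> g v \<noteq> 0 \<Longrightarrow> u @ v \<in> S"
    by (rule that[of "(\<lambda>(u, v). u @ v) ` (?f \<times> ?g)"]) (use fin in auto)
  have "{w. (f \<otimes>\<^bsub>F\<^esub> g) w \<noteq> 0} \<subseteq> S"
  proof
    fix w assume "w \<in> {w. (f \<otimes>\<^bsub>F\<^esub> g) w \<noteq> 0}"
    then have "(\<Sum>i\<le>length w. f (take i w) * g (drop i w)) \<noteq> 0"
      by (simp add: free_algebra_simps)
    then obtain i where "f (take i w) * g (drop i w) \<noteq> 0"
      by (rule sum.not_neutral_contains_not_neutral)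
    then show "w \<in> S"
      using S(2)[of "take i w" "drop i w"] by auto
  qed
  then have "lcoef v (f \<otimes>\<^bsub>F\<^esub> g) = (\<Sum>w\<in>S. (f \<otimes>\<^bsub>F\<^esub> g) w * word_functional v w)"
    by (subst linear_extension_superset[OF kspace_scalar_space, of _ UNIV S]) (use S in auto)
  also have "\<dots> = (\<Sum>w\<in>S. \<Sum>i\<le>length w. f (take i w) * g (drop i w) * word_functional v w)"
    by (simp add: free_algebra_simps sum_distrib_right)
  also have "\<dots> = (\<Sum>(w, i)\<in>(SIGMA w:S. {..length w}). f (take i w) * g (drop i w) * word_functional v w)"
    using S by (simp add: sum.Sigma)
  also have "\<dots> = (\<Sum>(w1, w2)\<in>?f \<times> ?g. f w1 * g w2 * word_functional v (w1 @ w2))"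
    by (rule sum.reindex_bij_witness_not_neutral[where
          S'="{p \<in> (SIGMA w:S. {..length w}). f (take (snd p) (fst p)) * g (drop (snd p) (fst p)) = 0}" and T'="{}"
          and j="\<lambda>(w, i). (take i w, drop i w)" and i="\<lambda>(w1, w2). (w1 @ w2, length w1)"])
      (use S fin in \<open>auto simp: min_def\<close>)
  also have "\<dots> = (\<Sum>(w1, w2)\<in>?f \<times> ?g. \<Sum>u\<in>V. qp u (\<lambda>i. v i - u i) *
      (f w1 * word_functional u w1) * (g w2 * word_functional (\<lambda>i. v i - u i) w2))"
  proof (intro sum.cong refl, clarify)
    fix w1 w2 assume "f w1 \<noteq> 0" "g w2 \<noteq> 0"
    then have l: "w1 \<in> lists {1..n}" "w2 \<in> lists {1..n}" using sub by auto
    let ?c = "word_content w1"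
    have "(\<Sum>u\<in>V. qp u (\<lambda>i. v i - u i) * (f w1 * word_functional u w1) * (g w2 * word_functional (\<lambda>i. v i - u i) w2)) =
      (\<Sum>u\<in>V. if u = ?c then qp u (\<lambda>i. v i - u i) * (f w1 * word_functional u w1) * (g w2 * word_functional (\<lambda>i. v i - u i) w2) else 0)"
      by (rule sum.cong) (auto simp: word_functional_def)
    also have "\<dots> = (if ?c \<in> V then qp ?c (\<lambda>i. v i - ?c i) * (f w1 * word_coeff q w1) * (g w2 * word_functional (\<lambda>i. v i - ?c i) w2) else 0)"
      by (subst sum.delta) (auto simp: word_functional_def)
    also have "\<dots> = f w1 * g w2 * word_functional v (w1 @ w2)"
    proof (cases "word_content (w1 @ w2) = v")
      case True
      then have eq: "word_content w2 = (\<lambda>i. v i - ?c i)" by (auto simp: word_content_append)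
      have "?c i \<le> v i" for i using fun_cong[OF eq, of i] word_content_nonneg[of w2 i] by simp
      moreover have "v i \<le> a i - 1" if "i \<in> {1..n}" for i
        using v that by (simp add: exponents_def)
      ultimately have "?c \<in> V"
        using word_content_nonneg[of w1] word_content_outside[OF l(1)] order_trans
        unfolding exponents_def by blast
      then show ?thesis using True eq word_coeff_append[OF l] by (simp add: word_functional_def)
    next
      case False
      moreover have "word_content (w1 @ w2) = v" if "word_content w2 = (\<lambda>i. v i - ?c i)"
        using that by (simp add: word_content_append)
      ultimately have "word_content w2 \<noteq> (\<lambda>i. v i - ?c i)" by blast
      then show ?thesis using False by (simp add: word_functional_def)
    qed
    finally show "f w1 * g w2 * word_functional v (w1 @ w2) = (\<Sum>u\<in>V. qp u (\<lambda>i. v i - u i) *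
      (f w1 * word_functional u w1) * (g w2 * word_functional (\<lambda>i. v i - u i) w2))" by simp
  qed
  also have "\<dots> = (\<Sum>u\<in>V. \<Sum>(w1, w2)\<in>?f \<times> ?g. qp u (\<lambda>i. v i - u i) *
      (f w1 * word_functional u w1) * (g w2 * word_functional (\<lambda>i. v i - u i) w2))"
    unfolding case_prod_unfold by (rule sum.swap)
  also have "\<dots> = (\<Sum>u\<in>V. qp u (\<lambda>i. v i - u i) * lcoef u f * lcoef (\<lambda>i. v i - u i) g)"
  proof (intro sum.cong refl)
    fix u
    let ?F = "\<lambda>w. f w * word_functional u w" and ?G = "\<lambda>w. g w * word_functional (\<lambda>i. v i - u i) w"
    let ?c = "qp u (\<lambda>i. v i - u i)"
    have "?c * lcoef u f * lcoef (\<lambda>i. v i - u i) g = ?c * (sum ?F ?f * sum ?G ?g)"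
      by (simp add: linear_extension_def)
    also have "\<dots> = (\<Sum>(w1, w2)\<in>?f \<times> ?g. ?c * (?F w1 * ?G w2))"
      unfolding sum_product sum.cartesian_product by (simp add: sum_distrib_left case_prod_unfold)
    finally show "(\<Sum>(w1, w2)\<in>?f \<times> ?g. ?c * ?F w1 * ?G w2) = ?c * lcoef u f * lcoef (\<lambda>i. v i - u i) g"
      by (simp add: mult.assoc)
  qed
  finally show ?thesis .
qed


text \<open>By \<open>lcoef_mult\<close> the common kernel of the functionals \<open>lcoef v\<close>, \<open>v \<in> V\<close>, is an ideal. It
  contains the relations: \<open>x\<^sub>i\<^bsup>a\<^sub>i\<^esup>\<close> has a content outside \<open>V\<close>, and both sides of a commutation
  relation have the same content and the same coefficient. This proves that the standard monomials are
  linearly independent.\<close>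

lemma I_lcoef:
  assumes "f \<in> I" "v \<in> V"
  shows "lcoef v f = 0"
proof -
  let ?K = "{f \<in> carrier F. \<forall>v\<in>V. lcoef v f = 0}"
  have mult: "lcoef v (f \<otimes>\<^bsub>F\<^esub> g) = 0"
    if f: "f \<in> carrier F" and g: "g \<in> carrier F" and v: "v \<in> V" and fg: "f \<in> ?K \<or> g \<in> ?K" for f g v
  proof -
    \<comment> \<open>\<open>v - u\<close> lies in \<open>V\<close> or has a negative entry\<close>
    have "lcoef u f = 0 \<or> lcoef (\<lambda>i. v i - u i) g = 0" if u: "u \<in> V" for u
    proof (cases "\<exists>i. v i - u i < 0")
      case True
      then show ?thesis using lcoef_negative[of "\<lambda>i. v i - u i"] by blast
    next
      case False
      then have "(\<lambda>i. v i - u i) \<in> V"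
        using u v unfolding exponents_def by (force simp: not_less)
      then show ?thesis using fg u by auto
    qed
    then show ?thesis unfolding lcoef_mult[OF f g v] by (intro sum.neutral) auto
  qed
  have add: "lcoef v (f \<oplus>\<^bsub>F\<^esub> g) = lcoef v f + lcoef v g" if "f \<in> carrier F" "g \<in> carrier F" for f g v
    using linear_mapsD(2)[OF lcoef_linear that] by simp
  have smult: "lcoef v (c \<odot>\<^bsub>F\<^esub> f) = c * lcoef v f" if "f \<in> carrier F" for f c v
    using linear_mapsD(3)[OF lcoef_linear that] by simp
  have "ideal ?K F"
  proof (rule idealI)
    show "subgroup ?K (add_monoid F)"
    proof (rule F.add.subgroupI)
      show "?K \<noteq> {}" using linear_map_zero[OF F.vectorspace_axioms _ lcoef_linear]
          kspace.axioms[OF kspace_scalar_space] by auto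
      show "\<ominus>\<^bsub>F\<^esub> f \<in> ?K" if "f \<in> ?K" for f
        using that smult[of f _ "- 1"] F.smult_minus_one_eq[of f] by auto
    qed (auto simp: add)
  qed (auto simp: mult ring_free_algebra)
  moreover have "qci_relations n q a \<subseteq> ?K"
  proof
    fix r assume r: "r \<in> qci_relations n q a"
    then consider (power) i where "i \<in> {1..n}" "r = single [i] [^]\<^bsub>F\<^esub> nat (a i)"
      | (swap) i j where "i \<in> {1..n}" "j \<in> {1..n}"
        "r = single [j] \<otimes>\<^bsub>F\<^esub> single [i] \<ominus>\<^bsub>F\<^esub> (q i j \<odot>\<^bsub>F\<^esub> (single [i] \<otimes>\<^bsub>F\<^esub> single [j]))"
      unfolding qci_relations_def Let_def by blast
    then have "lcoef v r = 0" if v: "v \<in> V" for v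
    proof cases
      case power
      have "word_content (replicate k i) i = int k" for k
        by (induction k) (auto simp: word_content_def)
      moreover have "v i < a i" using v power(1) by (auto simp: exponents_def)
      ultimately have "word_content (replicate (nat (a i)) i) \<noteq> v"
        using a_ge_2[OF power(1)] by (metis int_nat_eq order_less_irrefl zero_le_numeral order_trans)
      then show ?thesis unfolding power(2) single_pow lcoef_single word_functional_def by simp
    next
      case swap
      have s: "single [j, i] \<in> carrier F" "single [i, j] \<in> carrier F"
        using swap by (auto intro!: single_in_F)
      have "word_content [j, i] = word_content [i, j]" by (auto simp: word_content_def)
      moreover have "word_coeff q [j, i] = q i j * word_coeff q [i, j]"
        using q_inverse[OF swap(1,2)] q_diag[OF swap(1)] by (cases i j rule: linorder_cases) auto
      ultimately have "word_functional v [j, i] = q i j * word_functional v [i, j]"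
        unfolding word_functional_def by simp
      then have "lcoef v (single [j, i]) = lcoef v (q i j \<odot>\<^bsub>F\<^esub> single [i, j])"
        by (simp add: smult[OF s(2)] lcoef_single)
      moreover have "single [j, i] = (single [j, i] \<ominus>\<^bsub>F\<^esub> (q i j \<odot>\<^bsub>F\<^esub> single [i, j])) \<oplus>\<^bsub>F\<^esub> (q i j \<odot>\<^bsub>F\<^esub> single [i, j])"
        using s F.smult_closed'[OF s(2)] by (simp add: F.minus_eq F.a_assoc F.l_neg)
      ultimately show ?thesis unfolding swap(3) free_algebra_mult_single
        using add[OF F.minus_closed[OF s(1) F.smult_closed'[OF s(2)]] F.smult_closed'[OF s(2)]]
        by (metis add_0 add_right_cancel append_Cons append_Nil)
    qed
    then show "r \<in> ?K" using relations_subset r by auto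
  qed
  ultimately have "I \<subseteq> ?K" unfolding qci_ideal_def by (rule FR.genideal_minimal)
  then show ?thesis using assms by auto
qed

text \<open>The choice of a representative is immaterial by \<open>I_lcoef\<close>.\<close>

definition coeff :: "(nat \<Rightarrow> int) \<Rightarrow> (nat list \<Rightarrow> 'k) set \<Rightarrow> 'k" where
  "coeff v X = lcoef v (SOME f. f \<in> carrier F \<and> cls f = X)"

lemma coeff_cls:
  assumes f: "f \<in> carrier F" and v: "v \<in> V"
  shows "coeff v (cls f) = lcoef v f"
proof -
  define g where "g = (SOME g. g \<in> carrier F \<and> cls g = cls f)"
  have g: "g \<in> carrier F" "cls g = cls f"
    unfolding g_def by (rule someI2[of _ f]; use f in simp)+
  then have "g \<ominus>\<^bsub>F\<^esub> f \<in> I" using f cls_eq_iff by blast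
  then have "lcoef v (g \<ominus>\<^bsub>F\<^esub> f) = 0" using v by (rule I_lcoef)
  moreover have "g = (g \<ominus>\<^bsub>F\<^esub> f) \<oplus>\<^bsub>F\<^esub> f" using f g by (simp add: F.minus_eq F.a_assoc F.l_neg)
  ultimately have "lcoef v g = lcoef v f"
    using linear_mapsD(2)[OF lcoef_linear[of v] F.minus_closed[OF g(1) f] f] by simp
  then show ?thesis unfolding coeff_def g_def .
qed

lemma coeff_linear: "v \<in> V \<Longrightarrow> coeff v \<in> dual_space A"
proof (rule dual_spaceI)
  fix X Y assume v: "v \<in> V" and "X \<in> carrier A" "Y \<in> carrier A"
  then obtain f g where "f \<in> carrier F" "g \<in> carrier F" "X = cls f" "Y = cls g"
    unfolding carrier_A by auto
  then show "coeff v (X \<oplus>\<^bsub>A\<^esub> Y) = coeff v X + coeff v Y"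
    using linear_mapsD(2)[OF lcoef_linear[of v], of f g] v by (simp add: cls_add coeff_cls)
next
  fix c X assume v: "v \<in> V" and "X \<in> carrier A"
  then obtain f where f: "f \<in> carrier F" "X = cls f"
    unfolding carrier_A by auto
  then show "coeff v (c *\<^sub>A X) = c * coeff v X"
    using linear_mapsD(3)[OF lcoef_linear[of v], of f c] v F.smult_closed'[OF f(1)]
    by (simp add: cls_smult coeff_cls)
qed

lemma coeff_monom: "u \<in> V \<Longrightarrow> v \<in> V \<Longrightarrow> coeff v (x u) = (if u = v then 1 else 0)"
proof -
  assume u: "u \<in> V" and v: "v \<in> V"
  have "word_content (sorted_word n u) = u"
    using u by (auto simp: word_content_sorted_word exponents_def fun_eq_iff)
  then show ?thesis unfolding monom_eq_word_class word_class_def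
    by (subst coeff_cls[OF single_in_F[OF sorted_word_in_lists] v])
      (simp add: lcoef_single word_functional_def word_coeff_sorted sorted_sorted_word)
qed

lemma coeff_finsum:
  assumes "v \<in> V" "\<And>i. i \<in> K \<Longrightarrow> g i \<in> carrier A"
  shows "coeff v (\<Oplus>\<^bsub>A\<^esub>i\<in>K. g i) = (\<Sum>i\<in>K. coeff v (g i))"
  using linear_map_finsum[OF A.vectorspace_axioms kspace.axioms[OF kspace_scalar_space]
      coeff_linear[OF assms(1), unfolded dual_space_def] assms(2)] by simp

lemma coeff_combination:
  assumes "v \<in> V"
  shows "coeff v (\<Oplus>\<^bsub>A\<^esub>u\<in>V. \<alpha> u *\<^sub>A x u) = \<alpha> v"
proof -
  have "coeff v (\<Oplus>\<^bsub>A\<^esub>u\<in>V. \<alpha> u *\<^sub>A x u) = (\<Sum>u\<in>V. \<alpha> u * (if u = v then 1 else 0))"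
    using assms by (subst coeff_finsum) (auto simp: dual_spaceD(2)[OF coeff_linear] coeff_monom)
  also have "\<dots> = (\<Sum>u\<in>V. if u = v then \<alpha> u else 0)"
    by (rule sum.cong) auto
  finally show ?thesis using assms by simp
qed

text \<open>Both sides are linear in a representative, and for a single word the claim is \<open>word_class_sort\<close>.\<close>

lemma monom_expansion:
  assumes "X \<in> carrier A"
  shows "X = (\<Oplus>\<^bsub>A\<^esub>v\<in>V. coeff v X *\<^sub>A x v)"
proof -
  obtain f where f: "f \<in> carrier F" "X = cls f" using assms unfolding carrier_A by auto
  let ?g = "\<lambda>f. (\<Oplus>\<^bsub>A\<^esub>v\<in>V. lcoef v f *\<^sub>A x v)"
  have cls_lin: "cls \<in> linear_maps (free_space (lists {1..n})) A"
    using cls_linear unfolding qci_def linear_maps_free_algebra .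
  have g_lin: "?g \<in> linear_maps (free_space (lists {1..n})) A"
    unfolding linear_maps_free_algebra[symmetric]
  proof (rule linear_mapsI)
    fix f g c assume fg: "f \<in> carrier F" "g \<in> carrier F"
    show "?g (f \<oplus>\<^bsub>F\<^esub> g) = ?g f \<oplus>\<^bsub>A\<^esub> ?g g"
      using linear_mapsD(2)[OF lcoef_linear fg]
      by (simp add: A.smult_add_left A.finsum_addf)
  next
    fix f c assume f: "f \<in> carrier F"
    show "?g (c \<odot>\<^bsub>F\<^esub> f) = c *\<^sub>A ?g f"
      using linear_mapsD(3)[OF lcoef_linear f]
      by (simp add: A.smult_smult A.smult_finsum)
  qed (simp add: A.finsum_closed)
  have single: "cls (single w) = ?g (single w)" if w: "w \<in> lists {1..n}" for w
  proof -
    have "?g (single w) = (\<Oplus>\<^bsub>A\<^esub>v\<in>V. (if v = word_content w then word_coeff q w *\<^sub>A x v else \<zero>\<^bsub>A\<^esub>))"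
      by (rule A.finsum_cong') (auto simp: lcoef_single word_functional_def)
    also have "\<dots> = word_coeff q w *\<^sub>A x (word_content w)"
    proof (cases "word_content w \<in> V")
      case True
      then show ?thesis
        using A.finsum_singleton[of "word_content w" V "\<lambda>v. word_coeff q w *\<^sub>A x v"]
        by (simp add: eq_commute)
    next
      case False
      then obtain i where "i \<in> {1..n}" "word_content w i \<ge> a i"
        using word_content_nonneg[of w] word_content_outside[OF w] unfolding exponents_def
        by (auto simp: not_le)
      then have "x (word_content w) = \<zero>\<^bsub>A\<^esub>" by (rule monom_vanish)
      moreover have "(\<Oplus>\<^bsub>A\<^esub>v\<in>V. (if v = word_content w then word_coeff q w *\<^sub>A x v else \<zero>\<^bsub>A\<^esub>)) = (\<Oplus>\<^bsub>A\<^esub>v\<in>V. \<zero>\<^bsub>A\<^esub>)"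
        using False by (intro A.finsum_cong') auto
      ultimately show ?thesis by simp
    qed
    also have "\<dots> = cls (single w)" using word_class_sort[OF w] unfolding monom_eq_word_class word_class_def by simp
    finally show ?thesis by simp
  qed
  have "cls f = linear_extension A (\<lambda>w. cls (single w)) f"
    by (rule linear_maps_free_space_eq[OF A.kspace_axioms cls_lin]) (use f free_algebra_simps(1) in auto)
  also have "\<dots> = linear_extension A (\<lambda>w. ?g (single w)) f"
    unfolding linear_extension_def[of A]
  proof (rule A.finsum_cong')
    fix w assume "w \<in> {w. f w \<noteq> 0}"
    then have "w \<in> lists {1..n}" using f unfolding free_algebra_simps(1) free_space_simps by auto
    then show "f w *\<^sub>A cls (single w) = f w *\<^sub>A ?g (single w)"
      by (simp only: single)
  qed (auto intro!: A.finsum_closed A.smult_closed')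
  also have "\<dots> = ?g f"
    by (rule linear_maps_free_space_eq[OF A.kspace_axioms g_lin, symmetric]) (use f free_algebra_simps(1) in auto)
  also have "\<dots> = (\<Oplus>\<^bsub>A\<^esub>v\<in>V. coeff v X *\<^sub>A x v)"
    unfolding f(2) by (rule A.finsum_cong') (simp_all add: coeff_cls[OF f(1)])
  finally show ?thesis unfolding f(2) .
qed

lemma qci_dual_eq_coeff:
  assumes X: "X \<in> carrier A" and v: "v \<in> V"
  shows "qci_dual n q a v X = coeff v X"
proof -
  let ?P = "\<lambda>\<alpha>. \<alpha> \<in> V \<rightarrow>\<^sub>E UNIV \<and> X = (\<Oplus>\<^bsub>A\<^esub>u\<in>V. \<alpha> u *\<^sub>A x u)"
  have "?P (restrict (\<lambda>v. coeff v X) V)"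
  proof
    show "X = (\<Oplus>\<^bsub>A\<^esub>u\<in>V. restrict (\<lambda>v. coeff v X) V u *\<^sub>A x u)"
      by (subst monom_expansion[OF X]) (rule A.finsum_cong'; simp)
  qed auto
  moreover have "\<alpha> = restrict (\<lambda>v. coeff v X) V" if "?P \<alpha>" for \<alpha>
  proof
    fix u show "\<alpha> u = restrict (\<lambda>v. coeff v X) V u"
      using that coeff_combination[of u \<alpha>] by (cases "u \<in> V") auto
  qed
  ultimately have "(THE \<alpha>. ?P \<alpha>) = restrict (\<lambda>v. coeff v X) V"
    by (rule the_equality)
  then show ?thesis using v unfolding qci_dual_def by simp
qed

end

section \<open>Scalars attached to a compatible involution\<close>

lemma prod_involution:
  fixes f :: "'x \<Rightarrow> 'c::comm_monoid_mult"
  assumes "finite X" and "\<And>x. x \<in> X \<Longrightarrow> \<tau> x \<in> X" and "\<And>x. x \<in> X \<Longrightarrow> \<tau> (\<tau> x) = x"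
    and "\<And>x. x \<in> X \<Longrightarrow> \<tau> x \<noteq> x \<Longrightarrow> f x * f (\<tau> x) = 1" and "\<And>x. x \<in> X \<Longrightarrow> \<tau> x = x \<Longrightarrow> f x = 1"
  shows "prod f X = 1"
  using assms
proof (induction "card X" arbitrary: X rule: less_induct)
  case less
  show ?case
  proof (cases "X = {}")
    case False
    then obtain y where y: "y \<in> X" by blast
    let ?Y = "X - {y, \<tau> y}"
    have "card ?Y < card X"
      using y less.prems(1) by (intro psubset_card_mono) auto
    moreover have "\<tau> z \<in> ?Y" if "z \<in> ?Y" for z
    proof -
      have "\<tau> z \<noteq> y" "\<tau> z \<noteq> \<tau> y" using that y less.prems(3)[of z] less.prems(3)[of y] by auto
      then show ?thesis using that less.prems(2) by auto
    qed
    ultimately have "prod f ?Y = 1"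
      using less.hyps[of ?Y] less.prems by auto
    moreover have "prod f X = prod f ?Y * prod f {y, \<tau> y}"
      using y less.prems(1,2) by (intro prod.subset_diff) auto
    moreover have "prod f {y, \<tau> y} = 1"
      using y less.prems(4,5)[of y] by (cases "\<tau> y = y") auto
    ultimately show ?thesis by simp
  qed simp
qed

text \<open>Each orbit is represented by its smaller element.\<close>

lemma prod_orbit_pairs:
  fixes f :: "nat \<Rightarrow> 'c::comm_monoid_mult"
  assumes "finite X" and "\<And>i. i \<in> X \<Longrightarrow> \<tau> i \<in> X" and "\<And>i. i \<in> X \<Longrightarrow> \<tau> (\<tau> i) = i"
    and "\<And>i. i \<in> X \<Longrightarrow> \<tau> i \<noteq> i"
  shows "prod f X = (\<Prod>i\<in>{i \<in> X. i < \<tau> i}. f i * f (\<tau> i))"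
proof -
  have "X = {i \<in> X. i < \<tau> i} \<union> {i \<in> X. \<tau> i < i}"
    using assms(4) by (auto simp: neq_iff)
  then have "prod f X = prod f {i \<in> X. i < \<tau> i} * prod f {i \<in> X. \<tau> i < i}"
    using assms(1) by (subst prod.union_disjoint[symmetric]) auto
  also have "prod f {i \<in> X. \<tau> i < i} = (\<Prod>i\<in>{i \<in> X. i < \<tau> i}. f (\<tau> i))"
    by (rule prod.reindex_bij_witness[of _ \<tau> \<tau>]) (use assms in auto)
  finally show ?thesis by (simp add: prod.distrib)
qed

lemma card_orbit_pairs:
  assumes "finite X" and "\<And>i. i \<in> X \<Longrightarrow> \<tau> i \<in> X" and "\<And>i. i \<in> X \<Longrightarrow> \<tau> (\<tau> i) = i"
    and "\<And>i. i \<in> X \<Longrightarrow> \<tau> i \<noteq> i"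
  shows "card X = 2 * card {i \<in> X. i < (\<tau> i :: nat)}"
proof -
  have "X = {i \<in> X. i < \<tau> i} \<union> {i \<in> X. \<tau> i < i}"
    using assms(4) by (auto simp: neq_iff)
  then have "card X = card {i \<in> X. i < \<tau> i} + card {i \<in> X. \<tau> i < i}"
    using assms(1) by (subst card_Un_disjoint[symmetric]) auto
  also have "card {i \<in> X. \<tau> i < i} = card {i \<in> X. i < \<tau> i}"
    by (rule bij_betw_same_card[of \<tau>], rule bij_betw_byWitness[of _ \<tau>]) (use assms in auto)
  finally show ?thesis by simp
qed

abbreviation pairs :: "nat \<Rightarrow> (nat \<times> nat) set" where
  "pairs n \<equiv> {(i, j). 1 \<le> i \<and> i < j \<and> j \<le> n}"

lemma finite_pairs [simp]: "finite (pairs n)"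
  by (rule finite_subset[of _ "{1..n} \<times> {1..n}"]) auto

text \<open>The square without its diagonal is the union of the pairs above and below it. Products over all
  ordered pairs of indices are easier to reindex along a permutation than products over \<open>i < j\<close>.\<close>

lemma prod_square:
  fixes f :: "nat \<Rightarrow> nat \<Rightarrow> 'c::comm_monoid_mult"
  assumes diag: "\<And>i. i \<in> {1..n} \<Longrightarrow> f i i = 1"
  shows "(\<Prod>i\<in>{1..n}. \<Prod>j\<in>{1..n}. f i j) = (\<Prod>(i, j)\<in>pairs n. f i j * f j i)"
proof -
  let ?g = "\<lambda>(i, j). f i j" and ?D = "{(i, j). 1 \<le> j \<and> j < i \<and> i \<le> n}" and ?E = "(\<lambda>i. (i, i)) ` {1..n}"
  have "{1..n} \<times> {1..n} = pairs n \<union> ?D \<union> ?E" by (auto simp: image_iff)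
  moreover have fD: "finite ?D" by (rule finite_subset[of _ "{1..n} \<times> {1..n}"]) auto
  moreover have "pairs n \<inter> ?D = {}" "(pairs n \<union> ?D) \<inter> ?E = {}" by auto
  ultimately have "prod ?g ({1..n} \<times> {1..n}) = prod ?g (pairs n) * prod ?g ?D * prod ?g ?E"
    by (simp add: prod.union_disjoint)
  moreover have "prod ?g ?E = 1"
    by (rule prod.neutral) (auto simp: diag)
  moreover have "prod ?g ?D = (\<Prod>(i, j)\<in>pairs n. f j i)"
    by (rule prod.reindex_bij_witness[of _ prod.swap prod.swap]) auto
  ultimately show ?thesis
    by (simp add: prod.cartesian_product prod.distrib[symmetric] case_prod_unfold)
qed

context quantum_complete_intersection
begin

abbreviation "h \<equiv> h_coeff n q a"
abbreviation "\<tau> \<equiv> top_vec n a"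

lemma qp_cong:
  assumes "\<And>i. i \<in> {1..n} \<Longrightarrow> u i = u' i" "\<And>i. i \<in> {1..n} \<Longrightarrow> v i = v' i"
  shows "qp u v = qp u' v'"
  unfolding q_pow_def by (rule prod.cong) (use assms in auto)

text \<open>Since \<open>\<langle>\<cdot>|\<cdot>\<rangle>\<close> is biadditive, the contributions of \<open>\<langle>v|v\<rangle>\<close> cancel in the quotient; in this form
  \<open>h\<close> is visibly multiplicative in \<open>v\<close>, and \<open>h_top\<close> is immediate.\<close>

lemma h_eq_top: "h v = qp \<tau> v / qp v \<tau>"
proof -
  have "qp \<tau> v = qp (co_vec n a v) v * qp v v"
    unfolding qp_add_left[symmetric] by (rule qp_cong) (auto simp: co_vec_def)
  moreover have "qp v \<tau> = qp v (co_vec n a v) * qp v v"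
    unfolding qp_add_right[symmetric] by (rule qp_cong) (auto simp: co_vec_def)
  ultimately show ?thesis by (simp add: h_coeff_def)
qed

lemma h_formula: "h v = (\<Prod>i\<in>{1..n}. \<Prod>j\<in>{1..n}. q i j powi ((a j - 1) * v i))"
proof -
  have "h v = (\<Prod>(i, j)\<in>pairs n. q i j powi ((a j - 1) * v i) * q j i powi ((a i - 1) * v j))"
    unfolding h_eq_top q_pow_def prod_dividef[symmetric]
  proof (rule prod.cong, goal_cases)
    case (2 p)
    obtain i j where p: "p = (i, j)" "i \<in> {1..n}" "j \<in> {1..n}" using 2 by (cases p) auto
    then show ?case
      by (simp add: co_vec_def q_swap[of i j] power_int_inverse divide_inverse mult.commute)
  qed simp
  also have "\<dots> = (\<Prod>i\<in>{1..n}. \<Prod>j\<in>{1..n}. q i j powi ((a j - 1) * v i))"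
    by (rule prod_square[symmetric]) (simp add: q_diag)
  finally show ?thesis .
qed

lemma h_basis: 
  assumes "i \<in> {1..n}"
  shows "h (basis_vec i) = (\<Prod>j\<in>{1..n}. q i j powi (a j - 1))"
proof -
  have "h (basis_vec i) = (\<Prod>k\<in>{1..n}. if k = i then \<Prod>j\<in>{1..n}. q i j powi (a j - 1) else 1)"
    unfolding h_formula by (rule prod.cong) (auto simp: basis_vec_def)
  then show ?thesis using assms by simp
qed

lemma h_eq_prod: "h v = (\<Prod>i\<in>{1..n}. h (basis_vec i) powi v i)"
proof -
  have "(\<Prod>j\<in>K. f j) powi m = (\<Prod>j\<in>K. f j powi m)" for f :: "nat \<Rightarrow> 'k" and K m
    by (induction K rule: infinite_finite_induct) (auto simp: power_int_mult_distrib)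
  then show ?thesis unfolding h_formula[of v]
    by (intro prod.cong refl) (simp add: h_basis power_int_mult)
qed

lemma h_nonzero [simp]: "h v \<noteq> 0"
  by (simp add: h_coeff_def)

lemma h_top: "h \<tau> = 1"
  by (simp add: h_eq_top)

end

locale compatible_involution = quantum_complete_intersection n a q
  for n :: nat and a :: "nat \<Rightarrow> int" and q :: "nat \<Rightarrow> nat \<Rightarrow> 'k::field" +
  fixes \<pi> :: "nat \<Rightarrow> nat"
  assumes compatible: "compatible n q a \<pi>" and involution: "\<pi> \<circ> \<pi> = id"
begin

lemma pi_pi [simp]: "\<pi> (\<pi> i) = i"
  using fun_cong[OF involution, of i] by simp

lemma pi_permutes: "\<pi> permutes {1..n}"
  using compatible by (simp add: compatible_def)

lemma pi_in [simp]: "\<pi> i \<in> {1..n} \<longleftrightarrow> i \<in> {1..n}"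
  using permutes_in_image[OF pi_permutes] by blast

lemma pi_range [simp]: "1 \<le> i \<Longrightarrow> i \<le> n \<Longrightarrow> 1 \<le> \<pi> i" "1 \<le> i \<Longrightarrow> i \<le> n \<Longrightarrow> \<pi> i \<le> n"
  using pi_in[of i] by auto

lemma pi_bij: "bij_betw \<pi> {1..n} {1..n}"
  by (rule permutes_imp_bij[OF pi_permutes])

lemma pi_eq_iff [simp]: "\<pi> i = \<pi> j \<longleftrightarrow> i = j"
  by (metis pi_pi)

lemma a_pi: "i \<in> {1..n} \<Longrightarrow> a (\<pi> i) = a i"
  using compatible by (auto simp: compatible_def)

lemma q_pi: "i \<in> {1..n} \<Longrightarrow> j \<in> {1..n} \<Longrightarrow> q (\<pi> i) (\<pi> j) = q j i"
  using compatible by (auto simp: compatible_def)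

lemma perm_act_eq: "perm_act \<pi> v = (\<lambda>i. v (\<pi> i))"
proof -
  have "inv_into UNIV \<pi> = \<pi>" by (rule inv_unique_comp) (rule involution)+
  then show ?thesis by (simp add: perm_act_def)
qed

lemma perm_act_basis: "perm_act \<pi> (basis_vec i) = basis_vec (\<pi> i)"
  by (auto simp: perm_act_eq basis_vec_def fun_eq_iff) 

lemma qp_perm_basis:
  assumes "j \<in> {1..n}" "k \<in> {1..n}"
  shows "qp (perm_act \<pi> (basis_vec k)) (perm_act \<pi> (basis_vec j)) = (if \<pi> j < \<pi> k then q k j else 1)"
  using assms by (simp add: perm_act_basis qp_basis q_pi)

lemma s_coeff_eq:
  "s_coeff n q \<pi> c v = (\<Prod>i\<in>{1..n}. c i powi v i) *
     (\<Prod>(j, k)\<in>pairs n. if \<pi> j < \<pi> k then q k j powi (v j * v k) else 1)"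
proof -
  have "(\<Prod>(j, k)\<in>pairs n. qp (perm_act \<pi> (basis_vec k)) (perm_act \<pi> (basis_vec j)) powi (v j * v k)) =
     (\<Prod>(j, k)\<in>pairs n. if \<pi> j < \<pi> k then q k j powi (v j * v k) else 1)"
    by (rule prod.cong) (auto simp: qp_perm_basis)
  then show ?thesis by (simp add: s_coeff_def)
qed

text \<open>Reindexing along \<open>\<pi>\<close> turns \<open>q (\<pi> j) (\<pi> k)\<close> into \<open>q k j\<close>; the condition \<open>i < j\<close> becomes \<open>\<pi> j < \<pi> k\<close>, so both
  orders of a pair \<open>j < k\<close> have to be kept.\<close>

lemma qp_perm:
  "qp (perm_act \<pi> u) (perm_act \<pi> v) = (\<Prod>(j, k)\<in>pairs n.
     (if \<pi> j < \<pi> k then q k j powi (u k * v j) else 1) * (if \<pi> k < \<pi> j then q j k powi (u j * v k) else 1))"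
proof -
  have "qp (perm_act \<pi> u) (perm_act \<pi> v) =
      (\<Prod>(i, j)\<in>pairs n. (if i < j then q i j powi (u (\<pi> j) * v (\<pi> i)) else 1) * (if j < i then q j i powi (u (\<pi> i) * v (\<pi> j)) else 1))"
    unfolding q_pow_def by (rule prod.cong) (auto simp: perm_act_eq)
  also have "\<dots> = (\<Prod>i\<in>{1..n}. \<Prod>j\<in>{1..n}. if i < j then q i j powi (u (\<pi> j) * v (\<pi> i)) else 1)"
    by (rule prod_square[symmetric]) simp
  also have "\<dots> = (\<Prod>i\<in>{1..n}. \<Prod>j\<in>{1..n}. if \<pi> i < \<pi> j then q (\<pi> i) (\<pi> j) powi (u j * v i) else 1)"
  proof -
    have r: "(\<Prod>i\<in>{1..n}. g (\<pi> i)) = (\<Prod>i\<in>{1..n}. g i)" for g :: "nat \<Rightarrow> 'k"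
      by (rule prod.reindex_bij_betw[OF pi_bij])
    have "(\<Prod>i\<in>{1..n}. \<Prod>j\<in>{1..n}. G (\<pi> i) (\<pi> j)) = (\<Prod>i\<in>{1..n}. \<Prod>j\<in>{1..n}. G i j)" for G :: "nat \<Rightarrow> nat \<Rightarrow> 'k"
      by (rule trans[OF r[of "\<lambda>i. \<Prod>j\<in>{1..n}. G i (\<pi> j)"]]) (intro prod.cong refl r)
    from this[of "\<lambda>i j. if i < j then q i j powi (u (\<pi> j) * v (\<pi> i)) else 1"] show ?thesis
      by (simp only: pi_pi)
  qed
  also have "\<dots> = (\<Prod>i\<in>{1..n}. \<Prod>j\<in>{1..n}. if \<pi> i < \<pi> j then q j i powi (u j * v i) else 1)"
    by (intro prod.cong refl) (simp add: q_pi)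
  also have "\<dots> = (\<Prod>(j, k)\<in>pairs n.
     (if \<pi> j < \<pi> k then q k j powi (u k * v j) else 1) * (if \<pi> k < \<pi> j then q j k powi (u j * v k) else 1))"
    by (rule prod_square) simp
  finally show ?thesis .
qed

text \<open>\<open>\<pi> \<times> \<pi>\<close> permutes the pairs whose order it preserves, and it inverts \<open>q\<^sub>k\<^sub>j\<close>.\<close>

lemma prod_pairs_cancel:
  "(\<Prod>(j, k)\<in>pairs n. if \<pi> j < \<pi> k then q k j powi (v j * v k) else 1) *
   (\<Prod>(j, k)\<in>pairs n. if \<pi> j < \<pi> k then q k j powi (v (\<pi> j) * v (\<pi> k)) else 1) = 1"
proof -
  let ?D = "{p \<in> pairs n. \<pi> (fst p) < \<pi> (snd p)}"
  have D: "(\<Prod>(j, k)\<in>pairs n. if \<pi> j < \<pi> k then f j k else 1) = (\<Prod>p\<in>?D. f (fst p) (snd p))" for f :: "nat \<Rightarrow> nat \<Rightarrow> 'k"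
    by (rule prod.mono_neutral_cong_right) (auto split: if_splits)
  have "(\<Prod>p\<in>?D. q (snd p) (fst p) powi (v (\<pi> (fst p)) * v (\<pi> (snd p)))) =
      (\<Prod>p\<in>?D. q (\<pi> (snd p)) (\<pi> (fst p)) powi (v (fst p) * v (snd p)))"
  proof (rule prod.reindex_bij_witness[of _ "map_prod \<pi> \<pi>" "map_prod \<pi> \<pi>"])
    fix p assume "p \<in> ?D"
    then have "1 \<le> fst p" "fst p < snd p" "snd p \<le> n" "\<pi> (fst p) < \<pi> (snd p)" by auto
    then have "\<pi> (fst p) \<in> {1..n}" "\<pi> (snd p) \<in> {1..n}" by auto
    then show "map_prod \<pi> \<pi> p \<in> ?D" "map_prod \<pi> \<pi> p \<in> ?D" using \<open>p \<in> ?D\<close> by auto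
  qed auto
  also have "\<dots> = (\<Prod>p\<in>?D. inverse (q (snd p) (fst p) powi (v (fst p) * v (snd p))))"
  proof (rule prod.cong, goal_cases)
    case (2 p)
    then have "fst p \<in> {1..n}" "snd p \<in> {1..n}" by auto
    then show ?case by (simp add: q_pi q_swap[of "snd p" "fst p"] power_int_inverse)
  qed simp
  also have "\<dots> = inverse (\<Prod>p\<in>?D. q (snd p) (fst p) powi (v (fst p) * v (snd p)))"
    by (simp add: prod_inversef[symmetric] comp_def)
  finally have "(\<Prod>p\<in>?D. q (snd p) (fst p) powi (v (\<pi> (fst p)) * v (\<pi> (snd p)))) = \<dots>" .
  moreover have "(\<Prod>p\<in>?D. q (snd p) (fst p) powi (v (fst p) * v (snd p))) \<noteq> 0"
    by (auto simp: q_nonzero)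
  ultimately show ?thesis unfolding D by simp
qed

text \<open>Compatibility replaces every \<open>q\<^sub>i\<^sub>j\<close> by its inverse. Hence \<open>c\<^sub>i c\<^bsub>\<pi>(i)\<^esub> = h\<^sub>i\<close>, whose left side does
  not distinguish \<open>i\<close> from \<open>\<pi>(i)\<close>, forces \<open>h\<^sub>i\<^sup>2 = 1\<close>.\<close>

lemma h_pi:
  assumes "i \<in> {1..n}"
  shows "h (basis_vec (\<pi> i)) = inverse (h (basis_vec i))"
proof -
  have "h (basis_vec (\<pi> i)) = (\<Prod>j\<in>{1..n}. q (\<pi> i) (\<pi> j) powi (a (\<pi> j) - 1))"
    by (subst h_basis, use assms in simp)
      (rule prod.reindex_bij_betw[OF pi_bij, of "\<lambda>j. q (\<pi> i) j powi (a j - 1)", symmetric])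
  also have "\<dots> = (\<Prod>j\<in>{1..n}. inverse (q i j powi (a j - 1)))"
    by (rule prod.cong) (use assms in \<open>auto simp: a_pi q_pi q_swap[of i] power_int_inverse\<close>)
  also have "\<dots> = inverse (h (basis_vec i))"
    using assms by (simp add: h_basis prod_inversef[symmetric] comp_def)
  finally show ?thesis .
qed

lemma s_coeff_zero: "s_coeff n q \<pi> c (\<lambda>i. 0) = 1"
  by (auto simp: s_coeff_eq intro!: prod.neutral)

lemma perm_act_top: "perm_act \<pi> \<tau> = \<tau>"
proof
  fix i show "perm_act \<pi> \<tau> i = \<tau> i"
    using pi_in[of i] a_pi[of i] by (cases "i \<in> {1..n}") (simp_all add: perm_act_eq co_vec_def del: atLeastAtMost_iff)
qed

lemma s_coeff_top: "s_coeff n q \<pi> c \<tau> = q_perm n q a \<pi> * (\<Prod>i\<in>{1..n}. c i powi (a i - 1))"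
proof -
  have "(\<Prod>(j, k)\<in>pairs n. qp (perm_act \<pi> (basis_vec k)) (perm_act \<pi> (basis_vec j)) powi (\<tau> j * \<tau> k)) = q_perm n q a \<pi>"
    unfolding q_perm_def by (rule prod.cong) (auto simp: co_vec_def mult.commute)
  then show ?thesis by (simp add: s_coeff_def co_vec_def mult.commute)
qed

lemma s_coeff_basis:
  assumes "i \<in> {1..n}"
  shows "s_coeff n q \<pi> c (basis_vec i) = c i"
proof -
  have "(\<Prod>j\<in>{1..n}. c j powi basis_vec i j) = (\<Prod>j\<in>{1..n}. if j = i then c i else 1)"
    by (rule prod.cong) (auto simp: basis_vec_def)
  moreover have "(\<Prod>(j, k)\<in>pairs n. if \<pi> j < \<pi> k then q k j powi (basis_vec i j * basis_vec i k) else 1) = 1"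
    by (rule prod.neutral) (auto simp: basis_vec_def)
  ultimately show ?thesis using assms by (simp add: s_coeff_eq)
qed

text \<open>This is the statement that \<open>x\<^sub>v \<mapsto> s\<^sub>v x\<^bsub>\<pi>(v)\<^esub>\<close> reverses products. For each pair \<open>j < k\<close> there are two
  cases: if \<open>\<pi>\<close> keeps the order, then the cross terms of \<open>(u\<^sub>j + v\<^sub>j)(u\<^sub>k + v\<^sub>k)\<close> account for the
  difference of the two reordering factors; if \<open>\<pi>\<close> reverses it, then these factors agree.\<close>

lemma s_coeff_add:
  assumes c: "\<And>i. i \<in> {1..n} \<Longrightarrow> c i \<noteq> 0"
  shows "s_coeff n q \<pi> c (\<lambda>i. u i + v i) * qp u v =
    s_coeff n q \<pi> c u * s_coeff n q \<pi> c v * qp (perm_act \<pi> v) (perm_act \<pi> u)"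
proof -
  let ?w = "\<lambda>v j k. if \<pi> j < \<pi> k then q k j powi (v j * v k) else (1::'k)"
  have "(\<Prod>(j, k)\<in>pairs n. ?w (\<lambda>i. u i + v i) j k) * qp u v =
      (\<Prod>(j, k)\<in>pairs n. ?w u j k) * (\<Prod>(j, k)\<in>pairs n. ?w v j k) * qp (perm_act \<pi> v) (perm_act \<pi> u)"
    unfolding qp_perm unfolding q_pow_def prod.distrib[symmetric]
  proof (rule prod.cong, goal_cases)
    case (2 p)
    obtain j k where p: "p = (j, k)" "j \<in> {1..n}" "k \<in> {1..n}" "j < k" using 2 by (cases p) auto
    show ?case
    proof (cases "\<pi> j < \<pi> k")
      case True
      then have "\<not> \<pi> k < \<pi> j" by simp
      moreover have "q k j powi ((u j + v j) * (u k + v k)) * q j k powi (u k * v j) =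
        q k j powi (u j * u k) * q k j powi (v j * v k) * q k j powi (v k * u j)"
        using p q_nonzero[of j k] q_nonzero[of k j] q_swap[of k j]
        by (simp add: power_int_inverse power_int_add distrib_left distrib_right mult.commute[of "v k"] mult.commute[of "u k"])
      ultimately show ?thesis using True p by simp
    next
      case False
      moreover have "\<pi> j \<noteq> \<pi> k" using p by simp
      ultimately show ?thesis using p by (simp add: mult.commute)
    qed
  qed simp
  moreover have "(\<Prod>i\<in>{1..n}. c i powi (u i + v i)) = (\<Prod>i\<in>{1..n}. c i powi u i) * (\<Prod>i\<in>{1..n}. c i powi v i)"
    unfolding prod.distrib[symmetric] by (rule prod.cong) (auto simp: power_int_add c)
  ultimately show ?thesis unfolding s_coeff_eq by (simp add: ac_simps)
qed

text \<open>This is the statement \<open>S\<^sup>2(x\<^sub>v) = h\<^sub>v x\<^sub>v\<close>. The parts quadratic in \<open>v\<close> of the two factors cancel by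
  \<open>prod_pairs_cancel\<close>, and the linear parts combine to \<open>\<Prod> (c\<^sub>i c\<^bsub>\<pi>(i)\<^esub>)\<^bsup>v\<^sub>i\<^esup>\<close>.\<close>

lemma s_coeff_perm:
  assumes c: "\<And>i. i \<in> {1..n} \<Longrightarrow> c i * c (\<pi> i) = h (basis_vec i)"
  shows "s_coeff n q \<pi> c v * s_coeff n q \<pi> c (perm_act \<pi> v) = h v"
proof -
  have "(\<Prod>i\<in>{1..n}. c i powi v (\<pi> i)) = (\<Prod>i\<in>{1..n}. c (\<pi> i) powi v i)"
    by (subst prod.reindex_bij_betw[OF pi_bij, symmetric]) simp
  then have "(\<Prod>i\<in>{1..n}. c i powi v i) * (\<Prod>i\<in>{1..n}. c i powi v (\<pi> i)) = h v"
    unfolding h_eq_prod[of v]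
    by (simp add: prod.distrib[symmetric] c power_int_mult_distrib[symmetric])
  then show ?thesis
    using prod_pairs_cancel[of v] unfolding s_coeff_eq perm_act_eq by (simp add: ac_simps)
qed


text \<open>On fixed indices compatibility reads \<open>q\<^sub>i\<^sub>j = q\<^sub>j\<^sub>i\<close>, so \<open>q\<^sub>i\<^sub>j = \<plusminus>1\<close>.\<close>

lemma q_fixed:
  assumes "i \<in> {1..n}" "j \<in> {1..n}" "\<pi> i = i" "\<pi> j = j" "even k"
  shows "q i j powi k = 1"
proof -
  have "q i j * q i j = 1" using q_pi[OF assms(1,2)] q_inverse[OF assms(1,2)] assms(3,4) by simp
  then have "q i j powi 2 = 1" by (simp add: power_int_def power2_eq_square)
  moreover obtain m where "k = 2 * m" using assms(5) by blast
  ultimately show ?thesis by (simp add: power_int_mult)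
qed

end

locale antipode_scalars = compatible_involution n a q \<pi>
  for n :: nat and a :: "nat \<Rightarrow> int" and q :: "nat \<Rightarrow> nat \<Rightarrow> 'k::field" and \<pi> :: "nat \<Rightarrow> nat" +
  fixes c :: "nat \<Rightarrow> 'k"
  assumes c_pi: "\<And>i. i \<in> {1..n} \<Longrightarrow> c i * c (\<pi> i) = h (basis_vec i)"
begin

abbreviation "s \<equiv> s_coeff n q \<pi> c"

lemma c_nonzero: "i \<in> {1..n} \<Longrightarrow> c i \<noteq> 0"
  using c_pi[of i] h_nonzero[of "basis_vec i"] by auto

lemma s_add: "s (\<lambda>i. u i + v i) * qp u v = s u * s v * qp (perm_act \<pi> v) (perm_act \<pi> u)"
  by (rule s_coeff_add[OF c_nonzero])

lemma s_perm: "s v * s (perm_act \<pi> v) = h v"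
  by (rule s_coeff_perm[OF c_pi])

lemma s_nonzero [simp]: "s v \<noteq> 0"
  using s_perm[of v] h_nonzero[of v] by auto

text \<open>The scalar \<open>q\<^sub>\<pi> \<Prod> c\<^sub>i\<^bsup>a\<^sub>i-1\<^esup>\<close> is \<open>\<plusminus>1\<close> for every solution of \<open>c\<^sub>i c\<^bsub>\<pi>(i)\<^esub> = h\<^sub>i\<close>, because \<open>a - 1\<close>
  is fixed by \<open>\<pi>\<close> and \<open>h\<^bsub>a-1\<^esub> = 1\<close>.\<close>

lemma s_top_square: "s \<tau> * s \<tau> = 1"
  using s_perm[of \<tau>] by (simp add: perm_act_top h_top)

lemma h_square:
  assumes "i \<in> {1..n}"
  shows "h (basis_vec i) * h (basis_vec i) = 1"
proof -
  have "h (basis_vec (\<pi> i)) = h (basis_vec i)"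
    using c_pi[OF assms] c_pi[of "\<pi> i"] assms by (simp add: mult.commute)
  then have "h (basis_vec i) * h (basis_vec i) = h (basis_vec i) * inverse (h (basis_vec i))"
    using h_pi[OF assms] by simp
  then show ?thesis by simp
qed

lemma h_cases: "i \<in> {1..n} \<Longrightarrow> h (basis_vec i) = 1 \<or> h (basis_vec i) = - 1"
  using h_square[of i] by (simp add: square_eq_1_iff)

text \<open>If \<open>a\<^sub>i\<close> is odd for every fixed index \<open>i\<close>, then everything except the contribution of \<open>J\<^sub>3\<close> collapses:
  \<open>h\<^sub>i = 1\<close> for fixed \<open>i\<close> and \<open>q\<^sub>\<pi> = 1\<close>, because the factors over nontrivial orbits of \<open>\<pi>\<close> cancel and those over fixed
  indices are even powers of \<open>\<plusminus>1\<close>. An orbit \<open>{i, \<pi>(i)}\<close> contributes \<open>h\<^sub>i\<^bsup>a\<^sub>i-1\<^esup>\<close>, which is \<open>-1\<close> exactly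
  when it lies in \<open>J\<^sub>3\<close>.\<close>

lemma s_top_no_even_fixed:
  assumes odd: "\<And>i. i \<in> index_I n \<pi> \<Longrightarrow> odd (a i)" and char: "(- 1 :: 'k) \<noteq> 1"
  shows "s \<tau> = (- 1) ^ (card (index_J3 n q a \<pi>) div 2)"
proof -
  have I: "i \<in> {1..n}" "\<pi> i = i" "even (a i - 1)" if "i \<in> index_I n \<pi>" for i
    using that odd[OF that] by (auto simp: index_I_def)
  have J: "i \<in> {1..n}" "\<pi> i \<noteq> i" if "i \<in> index_J n \<pi>" for i
    using that by (auto simp: index_J_def)
  have fin: "finite (index_I n \<pi>)" "finite (index_J n \<pi>)" by (auto simp: index_I_def index_J_def)
  have h1: "h (basis_vec i) = 1" if i: "i \<in> index_I n \<pi>" for i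
    unfolding h_basis[OF I(1)[OF i]]
  proof (rule prod_involution[of _ \<pi>])
    fix j assume j: "j \<in> {1..n}"
    show "q i j powi (a j - 1) * q i (\<pi> j) powi (a (\<pi> j) - 1) = 1"
      using q_pi[OF I(1)[OF i] j] I(2)[OF i] q_inverse[OF I(1)[OF i] j] a_pi[OF j]
      by (simp add: power_int_mult_distrib[symmetric])
    show "q i j powi (a j - 1) = 1" if "\<pi> j = j"
      using q_fixed[OF I(1)[OF i] j I(2)[OF i] that] I(3)[of j] j that by (simp add: index_I_def)
  qed auto
  have "(\<Prod>i\<in>index_I n \<pi>. c i powi (a i - 1)) = 1"
  proof (rule prod.neutral, rule ballI)
    fix i assume i: "i \<in> index_I n \<pi>"
    obtain m where m: "a i - 1 = 2 * m" using I(3)[OF i] by blast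
    have "c i powi 2 = 1"
      using c_pi[OF I(1)[OF i]] I(2)[OF i] h1[OF i] by (simp add: power_int_def power2_eq_square)
    then show "c i powi (a i - 1) = 1" unfolding m by (simp add: power_int_mult)
  qed
  moreover have "(\<Prod>i\<in>index_J n \<pi>. c i powi (a i - 1)) = (- 1) ^ (card (index_J3 n q a \<pi>) div 2)"
  proof -
    let ?O = "{i \<in> index_J n \<pi>. i < \<pi> i}" and ?O3 = "{i \<in> index_J3 n q a \<pi>. i < \<pi> i}"
    have "(\<Prod>i\<in>index_J n \<pi>. c i powi (a i - 1)) = (\<Prod>i\<in>?O. c i powi (a i - 1) * c (\<pi> i) powi (a (\<pi> i) - 1))"
      by (rule prod_orbit_pairs) (auto simp: index_J_def)
    also have "\<dots> = (\<Prod>i\<in>?O. if i \<in> ?O3 then - 1 else 1)"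
    proof (rule prod.cong[OF refl])
      fix i assume i: "i \<in> ?O"
      then have i': "i \<in> {1..n}" using J by auto
      have "c i powi (a i - 1) * c (\<pi> i) powi (a (\<pi> i) - 1) = h (basis_vec i) powi (a i - 1)"
        by (simp add: a_pi[OF i'] power_int_mult_distrib[symmetric] c_pi[OF i'])
      also have "\<dots> = (if i \<in> ?O3 then - 1 else 1)"
        using i i' h_cases[OF i'] char by (cases "even (a i)") (auto simp: index_J3_def power_int_minus_left)
      finally show "c i powi (a i - 1) * c (\<pi> i) powi (a (\<pi> i) - 1) = (if i \<in> ?O3 then - 1 else 1)" .
    qed
    also have "\<dots> = (\<Prod>i\<in>?O3. - 1)"
      by (rule prod.mono_neutral_cong_right) (use fin in \<open>auto simp: index_J3_def\<close>)
    also have "card ?O3 = card (index_J3 n q a \<pi>) div 2"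
    proof -
      have "card (index_J3 n q a \<pi>) = 2 * card ?O3"
      proof (rule card_orbit_pairs)
        fix i assume i: "i \<in> index_J3 n q a \<pi>"
        then have i': "i \<in> {1..n}" by (auto simp: index_J3_def index_J_def)
        have "h (basis_vec (\<pi> i)) = h (basis_vec i)"
          using h_pi[OF i'] h_cases[OF i'] by auto
        then show "\<pi> i \<in> index_J3 n q a \<pi>"
          using i i' pi_in[of i] a_pi[OF i'] by (auto simp: index_J3_def index_J_def)
        show "\<pi> i \<noteq> i" using i by (auto simp: index_J3_def index_J_def)
      qed (auto simp: index_J3_def index_J_def)
      then show ?thesis by simp
    qed
    then have "(\<Prod>i\<in>?O3. - 1) = (- 1 :: 'k) ^ (card (index_J3 n q a \<pi>) div 2)"
      by simp
    finally show ?thesis .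
  qed
  moreover have "{1..n} = index_I n \<pi> \<union> index_J n \<pi>" "index_I n \<pi> \<inter> index_J n \<pi> = {}"
    by (auto simp: index_I_def index_J_def)
  ultimately have c: "(\<Prod>i\<in>{1..n}. c i powi (a i - 1)) = (- 1) ^ (card (index_J3 n q a \<pi>) div 2)"
    using fin by (simp add: prod.union_disjoint)
  let ?D = "{p \<in> pairs n. \<pi> (fst p) < \<pi> (snd p)}"
  let ?f = "\<lambda>p. q (snd p) (fst p) powi ((a (fst p) - 1) * (a (snd p) - 1))"
  have "(\<Prod>(j, k)\<in>pairs n. if \<pi> j < \<pi> k then q k j powi (\<tau> j * \<tau> k) else 1) = prod ?f ?D"
    by (rule prod.mono_neutral_cong_right) (auto simp: co_vec_def split: if_splits)
  also have "\<dots> = 1"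
  proof (rule prod_involution[of _ "map_prod \<pi> \<pi>"])
    fix p assume p: "p \<in> ?D"
    then have p': "fst p \<in> {1..n}" "snd p \<in> {1..n}" "fst p < snd p" "\<pi> (fst p) < \<pi> (snd p)" by auto
    then have "\<pi> (fst p) \<in> {1..n}" "\<pi> (snd p) \<in> {1..n}" by auto
    then show "map_prod \<pi> \<pi> p \<in> ?D" using p by auto
    show "?f p * ?f (map_prod \<pi> \<pi> p) = 1"
      using q_pi[OF p'(2,1)] q_inverse[OF p'(2,1)] a_pi[OF p'(1)] a_pi[OF p'(2)]
      by (simp add: power_int_mult_distrib[symmetric])
    show "?f p = 1" if "map_prod \<pi> \<pi> p = p"
    proof -
      have fixed: "\<pi> (fst p) = fst p" "\<pi> (snd p) = snd p" using that by (metis fst_map_prod, metis snd_map_prod)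
      then have "fst p \<in> index_I n \<pi>" using p' by (simp add: index_I_def)
      then show ?thesis by (intro q_fixed p' fixed) (metis I(3) dvd_mult2)
    qed
  qed (use finite_subset[OF _ finite_pairs] in \<open>auto simp: map_prod_def\<close>)
  finally have "(\<Prod>(j, k)\<in>pairs n. if \<pi> j < \<pi> k then q k j powi (\<tau> j * \<tau> k) else 1) = 1" .
  moreover have "(\<Prod>i\<in>{1..n}. c i powi \<tau> i) = (\<Prod>i\<in>{1..n}. c i powi (a i - 1))"
    by (rule prod.cong) (auto simp: co_vec_def)
  ultimately show ?thesis using c by (simp add: s_coeff_eq)
qed

end

context compatible_involution
begin

text \<open>Any solution of \<open>c\<^sub>i c\<^bsub>\<pi>(i)\<^esub> = h\<^sub>i\<close> has \<open>s\<^bsub>a-1\<^esub> = \<plusminus>1\<close>. A fixed index \<open>k\<close> with \<open>a\<^sub>k\<close> even allows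
  to correct the sign by passing from \<open>c\<^sub>k\<close> to \<open>-c\<^sub>k\<close>; if there is none, then the sign is the one
  computed in \<open>s_top_no_even_fixed\<close>.\<close>

lemma exists_scalars:
  assumes h_sq: "\<And>i. i \<in> {1..n} \<Longrightarrow> h (basis_vec i) ^ 2 = 1" and char: "(- 1 :: 'k) \<noteq> 1"
    and sqrt: "\<exists>r::'k. r ^ 2 = - 1"
    and parity: "card (index_I1 n q a \<pi>) + card (index_I3 n q a \<pi>) \<noteq> 0 \<or> even (card (index_J3 n q a \<pi>) div 2)"
  shows "\<exists>c. (\<forall>i\<in>{1..n}. c i * c (\<pi> i) = h (basis_vec i)) \<and>
     q_perm n q a \<pi> * (\<Prod>i\<in>{1..n}. c i powi (a i - 1)) = 1"
proof -
  obtain r :: 'k where r: "r ^ 2 = - 1" using sqrt by blast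
  have h_cases: "h (basis_vec i) = 1 \<or> h (basis_vec i) = - 1" if "i \<in> {1..n}" for i
    using h_sq[OF that] by (simp add: power2_eq_1_iff)
  have h_inv: "h (basis_vec (\<pi> i)) = h (basis_vec i)" if "i \<in> {1..n}" for i
    using h_pi[OF that] h_cases[OF that] by auto
  \<comment> \<open>a square root of \<open>h\<^sub>i\<close> at a fixed index; on an orbit of two indices the larger one carries \<open>h\<^sub>i\<close>\<close>
  define c where "c i = (if \<pi> i = i then (if h (basis_vec i) = 1 then 1 else r)
    else if i < \<pi> i then 1 else h (basis_vec i))" for i
  have c: "c i * c (\<pi> i) = h (basis_vec i)" if i: "i \<in> {1..n}" for i
  proof (cases "\<pi> i = i")
    case True
    then show ?thesis using h_cases[OF i] r by (auto simp: c_def power2_eq_square)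
  next
    case False
    then show ?thesis using h_inv[OF i] by (cases "i < \<pi> i") (auto simp: c_def)
  qed
  interpret c: antipode_scalars n a q \<pi> c by unfold_locales (rule c)
  have "s_coeff n q \<pi> c \<tau> = 1 \<or> s_coeff n q \<pi> c \<tau> = - 1"
    using c.s_top_square by (simp add: square_eq_1_iff)
  then consider "s_coeff n q \<pi> c \<tau> = 1" | (flip) "s_coeff n q \<pi> c \<tau> = - 1" by blast
  then show ?thesis
  proof cases
    case 1
    then show ?thesis using c unfolding s_coeff_top by blast
  next
    case flip
    show ?thesis
    proof (cases "\<exists>k\<in>index_I n \<pi>. even (a k)")
      case True
      then obtain k where k: "k \<in> {1..n}" "\<pi> k = k" "even (a k)" by (auto simp: index_I_def)
      \<comment> \<open>the relation at the fixed index \<open>k\<close> only involves \<open>c\<^sub>k\<^sup>2\<close>, and \<open>a\<^sub>k - 1\<close> is odd\<close>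
      let ?c = "c(k := - c k)"
      have "\<pi> i = k \<longleftrightarrow> i = k" for i using k(2) pi_pi by metis
      then have "?c i * ?c (\<pi> i) = h (basis_vec i)" if "i \<in> {1..n}" for i
        using c[OF that] k(2) \<open>\<pi> i = k \<longleftrightarrow> i = k\<close> by (cases "i = k") (simp_all only: fun_upd_def if_True if_False minus_mult_minus)
      moreover have "(\<Prod>i\<in>{1..n}. ?c i powi (a i - 1)) = - (\<Prod>i\<in>{1..n}. c i powi (a i - 1))"
        using k by (simp add: prod.remove[of "{1..n}" k] power_int_minus_left)
      moreover have "q_perm n q a \<pi> * (\<Prod>i\<in>{1..n}. c i powi (a i - 1)) = - 1"
        using flip by (simp add: s_coeff_top)
      ultimately show ?thesis by (intro exI[of _ ?c]) simp
    next
      case False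
      then have "index_I1 n q a \<pi> = {}" "index_I3 n q a \<pi> = {}"
        by (auto simp: index_I1_def index_I3_def)
      then have "even (card (index_J3 n q a \<pi>) div 2)" using parity by simp
      then have "s_coeff n q \<pi> c \<tau> = 1"
        using c.s_top_no_even_fixed False char by auto
      then show ?thesis using flip char by simp
    qed
  qed
qed

end

section \<open>Coordinates and the Nakayama automorphism\<close>

context quantum_complete_intersection
begin

lemma V_iff: "v \<in> V \<longleftrightarrow> (\<forall>i\<in>{1..n}. 0 \<le> v i \<and> v i \<le> a i - 1) \<and> (\<forall>i. i \<notin> {1..n} \<longrightarrow> v i = 0)"
  by (simp add: exponents_def)

lemma V_nonneg: "v \<in> V \<Longrightarrow> 0 \<le> v i"
  unfolding V_iff by (cases "i \<in> {1..n}") auto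

lemma V_outside: "v \<in> V \<Longrightarrow> i \<notin> {1..n} \<Longrightarrow> v i = 0"
  unfolding V_iff by blast

lemma V_le_top: "v \<in> V \<Longrightarrow> v i \<le> \<tau> i"
  unfolding V_iff co_vec_def by auto

lemma top_eq: "\<tau> i = (if i \<in> {1..n} then a i - 1 else 0)"
  by (simp add: co_vec_def)

lemma VI:
  assumes "\<And>i. 0 \<le> v i" "\<And>i. v i \<le> \<tau> i"
  shows "v \<in> V"
  unfolding V_iff
proof (intro conjI ballI allI impI)
  fix i assume "i \<in> {1..n}"
  then show "v i \<le> a i - 1" using assms(2)[of i] by (simp add: top_eq)
next
  fix i assume "i \<notin> {1..n}"
  then have "\<tau> i = 0" unfolding top_eq by (rule if_not_P)
  then show "v i = 0" using assms[of i] by simp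
qed (rule assms(1))

lemma top_nonneg: "0 \<le> \<tau> i"
  using a_ge_2[of i] by (cases "i \<in> {1..n}") (auto simp: top_eq)

lemma zero_in_V [simp]: "(\<lambda>i. 0) \<in> V"
  by (rule VI) (simp_all add: top_nonneg)

lemma top_in_V [simp]: "\<tau> \<in> V"
  by (rule VI) (simp_all add: top_nonneg)

lemma basis_in_V [simp]: "i \<in> {1..n} \<Longrightarrow> basis_vec i \<in> V"
  using a_ge_2 unfolding V_iff by (fastforce simp: basis_vec_def)

abbreviation "co \<equiv> co_vec n a"

lemma co_eq: "v \<in> V \<Longrightarrow> co v = (\<lambda>i. \<tau> i - v i)"
  using V_outside[of v] by (auto simp: co_vec_def fun_eq_iff)

lemma co_in_V [simp]: assumes "v \<in> V" shows "co v \<in> V"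
  by (rule VI) (use assms V_le_top[OF assms] V_nonneg[OF assms] in \<open>simp_all add: co_eq[OF assms]\<close>)

lemma co_co [simp]: assumes "v \<in> V" shows "co (co v) = v"
  unfolding co_eq[OF co_in_V[OF assms]] unfolding co_eq[OF assms] by simp

lemma co_zero: "co (\<lambda>i. 0) = \<tau>" ..

lemma co_top: "co \<tau> = (\<lambda>i. 0)"
  unfolding co_eq[OF top_in_V] by simp

lemma add_eq_top_iff: assumes "u \<in> V" "v \<in> V" shows "(\<lambda>i. u i + v i) = \<tau> \<longleftrightarrow> u = co v"
  unfolding co_eq[OF assms(2)] fun_eq_iff by (simp add: eq_diff_eq)

lemma monom_notin_V:
  assumes "\<And>i. 0 \<le> v i" "\<And>i. i \<notin> {1..n} \<Longrightarrow> v i = 0" "v \<notin> V"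
  shows "x v = \<zero>\<^bsub>A\<^esub>"
proof -
  obtain i where "i \<in> {1..n}" "a i \<le> v i" using assms unfolding V_iff by fastforce
  then show ?thesis by (rule monom_vanish)
qed

lemma monom_mult:
  assumes "u \<in> V" "v \<in> V"
  shows "x u \<star> x v = (if (\<lambda>i. u i + v i) \<in> V then qp u v *\<^sub>A x (\<lambda>i. u i + v i) else \<zero>\<^bsub>A\<^esub>)"
proof -
  have "x u \<star> x v = qp u v *\<^sub>A x (\<lambda>i. u i + v i)"
    using assms V_nonneg V_outside by (intro monom_mult_gen) auto
  moreover have "x (\<lambda>i. u i + v i) = \<zero>\<^bsub>A\<^esub>" if "(\<lambda>i. u i + v i) \<notin> V"
    by (rule monom_notin_V[OF _ _ that])
      (simp_all only: V_nonneg[OF assms(1)] V_nonneg[OF assms(2)] V_outside[OF assms(1)] V_outside[OF assms(2)] add_nonneg_nonneg add_0_left not_False_eq_True)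
  ultimately show ?thesis by simp
qed

text \<open>All identities between linear maps on \<open>A\<close> are reduced to the standard basis with this lemma.\<close>

lemma linear_maps_eq_on_monoms:
  assumes P: "kspace P" and f: "f \<in> linear_maps A P" and g: "g \<in> linear_maps A P"
    and eq: "\<And>v. v \<in> V \<Longrightarrow> f (x v) = g (x v)" and X: "X \<in> carrier A"
  shows "f X = g X"
proof -
  interpret P: kspace P by fact
  have c: "coeff v X *\<^sub>A x v \<in> carrier A" for v by simp
  have "f X = (\<Oplus>\<^bsub>P\<^esub>v\<in>V. f (coeff v X *\<^sub>A x v))"
    by (subst monom_expansion[OF X]) (rule linear_map_finsum[OF A.vectorspace_axioms P.vectorspace_axioms f c])
  also have "\<dots> = (\<Oplus>\<^bsub>P\<^esub>v\<in>V. g (coeff v X *\<^sub>A x v))"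
    using linear_mapsD[OF g monom_closed] linear_mapsD[OF f monom_closed]
    by (intro P.finsum_cong') (auto simp: eq)
  also have "\<dots> = g X"
    by (subst (2) monom_expansion[OF X]) (rule linear_map_finsum[OF A.vectorspace_axioms P.vectorspace_axioms g c, symmetric])
  finally show ?thesis .
qed

lemma functionals_eq_on_monoms:
  assumes "f \<in> dual_space A" "g \<in> dual_space A" "\<And>v. v \<in> V \<Longrightarrow> f (x v) = g (x v)" "X \<in> carrier A"
  shows "f X = g X"
  by (rule linear_maps_eq_on_monoms[OF kspace_scalar_space assms(1,2)[unfolded dual_space_def] assms(3,4)])

lemma eq_if_coeffs_eq:
  assumes "X \<in> carrier A" "Y \<in> carrier A" "\<And>v. v \<in> V \<Longrightarrow> coeff v X = coeff v Y"
  shows "X = Y"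
proof -
  have "(\<Oplus>\<^bsub>A\<^esub>v\<in>V. coeff v X *\<^sub>A x v) = (\<Oplus>\<^bsub>A\<^esub>v\<in>V. coeff v Y *\<^sub>A x v)"
    by (rule A.finsum_cong') (simp_all add: assms(3))
  then show ?thesis using monom_expansion[OF assms(1)] monom_expansion[OF assms(2)] by simp
qed

lemma mult_left_linear: "Y \<in> carrier A \<Longrightarrow> (\<lambda>X. X \<star> Y) \<in> linear_maps A A"
  by (rule linear_mapsI) (simp_all add: AR.l_distr smult_mult)

lemma mult_right_linear: "Y \<in> carrier A \<Longrightarrow> (\<lambda>X. Y \<star> X) \<in> linear_maps A A"
  by (rule linear_mapsI) (simp_all add: AR.r_distr smult_mult)

lemma id_linear: "(\<lambda>X. X) \<in> linear_maps A A"
  by (rule linear_mapsI) simp_all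

lemma dual_comp: "f \<in> linear_maps A A \<Longrightarrow> g \<in> dual_space A \<Longrightarrow> (\<lambda>X. g (f X)) \<in> dual_space A"
  unfolding dual_space_def by (rule linear_maps_comp)

lemma coeff_zero [simp]: "v \<in> V \<Longrightarrow> coeff v \<zero>\<^bsub>A\<^esub> = 0"
  using linear_map_zero[OF A.vectorspace_axioms kspace.axioms[OF kspace_scalar_space]
      coeff_linear[unfolded dual_space_def]] by simp

lemma coeff_smult: "v \<in> V \<Longrightarrow> X \<in> carrier A \<Longrightarrow> coeff v (c *\<^sub>A X) = c * coeff v X"
  by (rule dual_spaceD(2)[OF coeff_linear])

lemma coeff_mult_monom:
  assumes "u \<in> V" "v \<in> V" "w \<in> V"
  shows "coeff w (x u \<star> x v) = (if (\<lambda>i. u i + v i) = w then qp u v else 0)"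
  using assms by (auto simp: monom_mult coeff_smult coeff_monom)

text \<open>The form \<open>(X, Y) \<mapsto> x\<^bsub>a-1\<^esub>\<^sup>*(X Y)\<close> pairs \<open>x\<^sub>v\<close> with \<open>x\<^bsub>a-1-v\<^esub>\<close> only, with a nonzero value; this is why
  \<open>A\<close> is a Frobenius algebra.\<close>

lemma top_coeff_mult:
  assumes "X \<in> carrier A" "v \<in> V"
  shows "coeff \<tau> (X \<star> x v) = coeff (co v) X * qp (co v) v"
    and "coeff \<tau> (x v \<star> X) = coeff (co v) X * qp v (co v)"
proof -
  have l: "(\<lambda>X. coeff (co v) X * b) \<in> dual_space A" for b
    using coeff_linear[of "co v"] assms(2)
    by (intro dual_spaceI) (simp_all add: dual_spaceD[OF coeff_linear] algebra_simps)
  show "coeff \<tau> (X \<star> x v) = coeff (co v) X * qp (co v) v"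
    by (rule functionals_eq_on_monoms[OF dual_comp[OF mult_left_linear coeff_linear] l _ assms(1)])
      (use assms(2) in \<open>auto simp: coeff_mult_monom add_eq_top_iff coeff_monom\<close>)
  show "coeff \<tau> (x v \<star> X) = coeff (co v) X * qp v (co v)"
  proof (rule functionals_eq_on_monoms[OF dual_comp[OF mult_right_linear coeff_linear] l _ assms(1)])
    fix u assume "u \<in> V"
    moreover from this have "(v = co u) = (u = co v)" using assms(2) co_co by metis
    ultimately show "coeff \<tau> (x v \<star> x u) = coeff (co v) (x u) * qp v (co v)"
      using assms(2) by (auto simp: coeff_mult_monom add_eq_top_iff coeff_monom)
  qed simp_all
qed

lemma finsum_coeff_closed [simp]: "(\<Oplus>\<^bsub>A\<^esub>v\<in>V. \<alpha> v *\<^sub>A x v) \<in> carrier A"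
  by (rule A.finsum_closed) simp

lemma fin_dim_A: "vectorspace.fin_dim class_ring A"
  unfolding A.fin_dim_def
proof (intro exI conjI)
  show "A.gen_set (x ` V)"
  proof (intro equalityI subsetI)
    show "X \<in> carrier A" if "X \<in> A.span (x ` V)" for X
      using A.span_is_subset2[of "x ` V"] that image_subsetI[of V x "carrier A"] by auto
    fix X assume X: "X \<in> carrier A"
    have sub: "submodule class_ring (A.span (x ` V)) A"
      by (rule A.span_is_submodule) auto
    have "(\<Oplus>\<^bsub>A\<^esub>v\<in>K. coeff v X *\<^sub>A x v) \<in> A.span (x ` V)" if "finite K" "K \<subseteq> V" for K
      using that
    proof (induction K rule: finite_induct)
      case empty
      then show ?case using submodule.zero_closed[OF sub] by simp
    next
      case (insert v K)
      then have "x v \<in> A.span (x ` V)" by (intro subsetD[OF A.in_own_span[OF image_subsetI]]) auto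
      then have "coeff v X *\<^sub>A x v \<in> A.span (x ` V)" using submodule.smult_closed[OF sub] by simp
      then show ?case using insert submodule.m_closed[OF sub] by simp
    qed
    from this[of V] show "X \<in> A.span (x ` V)"
      using monom_expansion[OF X] by simp
  qed
qed auto

lemma fin_dim_algebra_A: "fin_dim_algebra A"
  by unfold_locales (simp_all add: smult_mult fin_dim_A)

text \<open>Testing \<open>\<phi>(X y) = \<phi>(y z)\<close> on the monomials \<open>y = x\<^bsub>a-1-v\<^esub>\<close> determines every coordinate of \<open>z\<close>. With
  this side convention the eigenvalue on \<open>x\<^sub>v\<close> is \<open>h\<^sub>v\<^bsup>-1\<^esup>\<close>, so the square is the identity exactly when
  all \<open>h\<^sub>v\<^sup>2\<close> equal \<open>1\<close>.\<close>

lemma nakayama_eq: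
  assumes X: "X \<in> carrier A"
  shows "qci_nakayama n q a X = (\<Oplus>\<^bsub>A\<^esub>v\<in>V. (inverse (h v) * coeff v X) *\<^sub>A x v)" (is "_ = ?N")
proof -
  let ?P = "\<lambda>z. z \<in> carrier A \<and> (\<forall>y\<in>carrier A. qci_dual n q a \<tau> (X \<star> y) = qci_dual n q a \<tau> (y \<star> z))"
  have P_iff: "?P z \<longleftrightarrow> z \<in> carrier A \<and> (\<forall>v\<in>V. coeff v X * qp v (co v) = coeff v z * qp (co v) v)" for z
  proof -
    have "(\<forall>y\<in>carrier A. qci_dual n q a \<tau> (X \<star> y) = qci_dual n q a \<tau> (y \<star> z)) \<longleftrightarrow>
        (\<forall>v\<in>V. coeff \<tau> (X \<star> x (co v)) = coeff \<tau> (x (co v) \<star> z))" (is "?l = ?r") if z: "z \<in> carrier A"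
    proof
      assume ?l
      then show ?r using X z by (auto simp: qci_dual_eq_coeff)
    next
      assume r: ?r
      show ?l
      proof
        fix y assume y: "y \<in> carrier A"
        have "coeff \<tau> (X \<star> y) = coeff \<tau> (y \<star> z)"
        proof (rule functionals_eq_on_monoms[OF dual_comp[OF mult_right_linear coeff_linear] dual_comp[OF mult_left_linear coeff_linear] _ y])
          fix v assume "v \<in> V"
          then show "coeff \<tau> (X \<star> x v) = coeff \<tau> (x v \<star> z)"
            using r[rule_format, of "co v"] by simp
        qed (use X z in simp_all)
        then show "qci_dual n q a \<tau> (X \<star> y) = qci_dual n q a \<tau> (y \<star> z)"
          using X y z by (simp add: qci_dual_eq_coeff)
      qed
    qed
    then show ?thesis using X by (auto simp: top_coeff_mult)
  qed
  have "coeff v X * qp v (co v) = coeff v ?N * qp (co v) v" if "v \<in> V" for v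
    using that by (simp add: coeff_combination h_coeff_def)
  then have "?P ?N" unfolding P_iff by simp
  moreover have "z = ?N" if "?P z" for z
  proof (rule eq_if_coeffs_eq)
    fix v assume v: "v \<in> V"
    then have "coeff v X * qp v (co v) = coeff v z * qp (co v) v"
      using that unfolding P_iff by blast
    then show "coeff v z = coeff v ?N"
      using v by (simp add: coeff_combination h_coeff_def field_simps)
  qed (use that in simp_all)
  ultimately have "(THE z. ?P z) = ?N" by (rule the_equality)
  then show ?thesis by (simp add: qci_nakayama_def nakayama_automorphism_def)
qed

lemma nakayama_square_iff:
  "(\<forall>X\<in>carrier A. qci_nakayama n q a (qci_nakayama n q a X) = X) \<longleftrightarrow>
   (\<forall>i\<in>{1..n}. h (basis_vec i) ^ 2 = 1)"
proof -
  have sq: "qci_nakayama n q a (qci_nakayama n q a X) = (\<Oplus>\<^bsub>A\<^esub>v\<in>V. (inverse (h v) ^ 2 * coeff v X) *\<^sub>A x v)"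
    if X: "X \<in> carrier A" for X
  proof -
    let ?N = "\<Oplus>\<^bsub>A\<^esub>v\<in>V. (inverse (h v) * coeff v X) *\<^sub>A x v"
    have "qci_nakayama n q a (qci_nakayama n q a X) = (\<Oplus>\<^bsub>A\<^esub>v\<in>V. (inverse (h v) * coeff v ?N) *\<^sub>A x v)"
      using X by (simp add: nakayama_eq)
    also have "\<dots> = (\<Oplus>\<^bsub>A\<^esub>v\<in>V. (inverse (h v) ^ 2 * coeff v X) *\<^sub>A x v)"
      by (rule A.finsum_cong') (simp_all add: coeff_combination power2_eq_square mult.assoc)
    finally show ?thesis .
  qed
  show ?thesis
  proof
    assume l: "\<forall>X\<in>carrier A. qci_nakayama n q a (qci_nakayama n q a X) = X"
    show "\<forall>i\<in>{1..n}. h (basis_vec i) ^ 2 = 1"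
    proof
      fix i assume i: "i \<in> {1..n}"
      let ?e = "basis_vec i"
      have "coeff ?e (x ?e) = inverse (h ?e) ^ 2 * coeff ?e (x ?e)"
        using sq[of "x ?e"] l coeff_combination[OF basis_in_V[OF i], of "\<lambda>v. inverse (h v) ^ 2 * coeff v (x ?e)"] by simp
      then show "h ?e ^ 2 = 1"
        using basis_in_V[OF i] by (simp add: coeff_monom field_simps)
    qed
  next
    assume r: "\<forall>i\<in>{1..n}. h (basis_vec i) ^ 2 = 1"
    have h: "h v ^ 2 = 1" for v
    proof -
      have "h v ^ 2 = (\<Prod>i\<in>{1..n}. (h (basis_vec i) ^ 2) powi v i)"
        unfolding h_eq_prod[of v] prod_power_distrib
        by (rule prod.cong) (simp_all add: power2_eq_square power_int_mult_distrib)
      also have "\<dots> = 1" using r by simp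
      finally show ?thesis .
    qed
    show "\<forall>X\<in>carrier A. qci_nakayama n q a (qci_nakayama n q a X) = X"
    proof
      fix X assume X: "X \<in> carrier A"
      show "qci_nakayama n q a (qci_nakayama n q a X) = X"
        unfolding sq[OF X] by (subst (2) monom_expansion[OF X]) (simp add: h power_inverse)
    qed
  qed
qed

lemma qci_linear_linear:
  assumes P: "kspace P" and f: "\<And>v. v \<in> V \<Longrightarrow> f v \<in> carrier P"
  shows "qci_linear n q a P f \<in> linear_maps A P"
proof -
  interpret P: kspace P by fact
  have c: "qci_linear n q a P f X = (\<Oplus>\<^bsub>P\<^esub>v\<in>V. coeff v X \<odot>\<^bsub>P\<^esub> f v)" if "X \<in> carrier A" for X
    unfolding qci_linear_def by (rule P.finsum_cong') (use f that in \<open>auto simp: qci_dual_eq_coeff\<close>)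
  show ?thesis
  proof (rule linear_mapsI)
    fix X assume X: "X \<in> carrier A"
    show "qci_linear n q a P f X \<in> carrier P" unfolding c[OF X] by (rule P.finsum_closed) (use f in auto)
    show "qci_linear n q a P f (b *\<^sub>A X) = b \<odot>\<^bsub>P\<^esub> qci_linear n q a P f X" for b
      unfolding c[OF X] c[OF A.smult_closed'[OF X]]
      by (subst P.smult_finsum) (auto simp: f X coeff_smult P.smult_smult intro!: P.finsum_cong')
    fix Y assume Y: "Y \<in> carrier A"
    show "qci_linear n q a P f (X \<oplus>\<^bsub>A\<^esub> Y) = qci_linear n q a P f X \<oplus>\<^bsub>P\<^esub> qci_linear n q a P f Y"
    proof -
      have "(\<Oplus>\<^bsub>P\<^esub>v\<in>V. coeff v (X \<oplus>\<^bsub>A\<^esub> Y) \<odot>\<^bsub>P\<^esub> f v) =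
          (\<Oplus>\<^bsub>P\<^esub>v\<in>V. coeff v X \<odot>\<^bsub>P\<^esub> f v \<oplus>\<^bsub>P\<^esub> coeff v Y \<odot>\<^bsub>P\<^esub> f v)"
        by (rule P.finsum_cong') (simp_all add: f X Y dual_spaceD[OF coeff_linear] P.smult_add_left Pi_iff)
      also have "\<dots> = (\<Oplus>\<^bsub>P\<^esub>v\<in>V. coeff v X \<odot>\<^bsub>P\<^esub> f v) \<oplus>\<^bsub>P\<^esub> (\<Oplus>\<^bsub>P\<^esub>v\<in>V. coeff v Y \<odot>\<^bsub>P\<^esub> f v)"
        by (rule P.finsum_addf) (simp_all add: f Pi_iff)
      finally show ?thesis unfolding c[OF X] c[OF Y] c[OF A.a_closed[OF X Y]] .
    qed
  qed
qed

lemma qci_linear_monom: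
  assumes P: "kspace P" and f: "\<And>v. v \<in> V \<Longrightarrow> f v \<in> carrier P" and v: "v \<in> V"
  shows "qci_linear n q a P f (x v) = f v"
proof -
  interpret P: kspace P by fact
  have "qci_linear n q a P f (x v) = (\<Oplus>\<^bsub>P\<^esub>u\<in>V. if v = u then f u else \<zero>\<^bsub>P\<^esub>)"
    unfolding qci_linear_def by (rule P.finsum_cong') (use f v in \<open>auto simp: qci_dual_eq_coeff coeff_monom\<close>)
  also have "\<dots> = f v"
    by (rule P.finsum_singleton) (use f v in auto)
  finally show ?thesis .
qed

lemma functional_bilinear:
  assumes "f \<in> dual_space A"
  shows "bilinear_map A A A (\<lambda>y z. f y *\<^sub>A z)" "bilinear_map A A A (\<lambda>y z. f z *\<^sub>A y)"
  by (rule bilinear_mapI;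
      simp add: dual_spaceD[OF assms] A.smult_add_left A.smult_add_right A.smult_smult mult.commute)+

lemma dual_right_mult:
  assumes "f \<in> dual_space A" "X \<in> carrier A"
  shows "(\<lambda>Y. f (Y \<star> X)) \<in> dual_space A"
  by (rule dual_comp[OF mult_left_linear[OF assms(2)] assms(1)])

lemma qci_dual_linear: "v \<in> V \<Longrightarrow> qci_dual n q a v \<in> dual_space A"
  by (rule dual_spaceI) (simp_all add: qci_dual_eq_coeff dual_spaceD[OF coeff_linear])

end

section \<open>The structure attached to a compatible involution\<close>

text \<open>The hypothesis on \<open>s\<close> is the normalization \<open>q\<^sub>\<pi> \<Prod> c\<^sub>i\<^bsup>a\<^sub>i-1\<^esup> = 1\<close>, see \<open>s_coeff_top\<close>.\<close>

locale compatible_structure = antipode_scalars n a q \<pi> c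
  for n :: nat and a :: "nat \<Rightarrow> int" and q :: "nat \<Rightarrow> nat \<Rightarrow> 'k::field" and \<pi> :: "nat \<Rightarrow> nat"
    and c :: "nat \<Rightarrow> 'k" +
  assumes s_top: "s \<tau> = 1" and n_pos: "n \<ge> 1"
begin

sublocale AA: tensor_pair A A by (rule tensor_pairI[OF A.kspace_axioms A.kspace_axioms])
sublocale L3: tensor_pair AA.T A by (rule tensor_pairI[OF AA.T.kspace_axioms A.kspace_axioms])
sublocale R3: tensor_pair A AA.T by (rule tensor_pairI[OF A.kspace_axioms AA.T.kspace_axioms])

abbreviation "p \<equiv> pure A A"
abbreviation "g \<equiv> g_coeff n q a \<pi> c"
abbreviation "\<Delta> \<equiv> qci_comult n q a \<pi> c"
abbreviation "\<epsilon> \<equiv> qci_counit n q a"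
abbreviation "S \<equiv> qci_antipode n q a \<pi> c"
abbreviation "act \<equiv> perm_act \<pi>"
abbreviation "inner \<equiv> V - {(\<lambda>i. 0), \<tau>}"

lemma act_act [simp]: "act (act v) = v"
  by (simp add: perm_act_eq)

lemma act_in_V [simp]: "act v \<in> V \<longleftrightarrow> v \<in> V"
proof -
  have "act v \<in> V" if "v \<in> V" for v
  proof (rule VI)
    fix i
    show "0 \<le> act v i" using V_nonneg[OF that] by (simp add: perm_act_eq)
    have "\<tau> (\<pi> i) = \<tau> i" using fun_cong[OF perm_act_top, of i] unfolding perm_act_eq .
    then show "act v i \<le> \<tau> i" using V_le_top[OF that, of "\<pi> i"] by (simp only: perm_act_eq)
  qed
  then show ?thesis using act_act by metis
qed

lemma act_zero [simp]: "act (\<lambda>i. 0) = (\<lambda>i. 0)"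
  by (simp add: perm_act_eq)

lemma inner_closed:
  assumes "u \<in> inner"
  shows "co u \<in> inner" "act u \<in> inner"
proof -
  have v: "u \<in> V" "u \<noteq> (\<lambda>i. 0)" "u \<noteq> \<tau>" using assms by simp_all
  have "co u \<noteq> (\<lambda>i. 0)" using co_co[OF v(1)] v(3) by metis
  moreover have "co u \<noteq> \<tau>" using co_co[OF v(1)] v(2) co_top by metis
  ultimately show "co u \<in> inner" using v(1) by simp
  have "act u \<noteq> (\<lambda>i. 0)" "act u \<noteq> \<tau>" using v(2,3) act_act[of u] act_zero perm_act_top by metis+
  then show "act u \<in> inner" using v(1) by simp
qed

lemma top_nonzero: "\<tau> \<noteq> (\<lambda>i. 0)"
proof
  assume "\<tau> = (\<lambda>i. 0)"
  then have "\<tau> 1 = 0" by simp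
  then show False using a_ge_2[of 1] n_pos by (simp add: top_eq)
qed

lemma g_eq: "g v = s v / qp (co v) v"
  by (simp add: g_coeff_def)

lemma g_zero: "g (\<lambda>i. 0) = 1"
  by (simp add: g_eq s_coeff_zero)

lemma g_top: "g \<tau> = 1"
  unfolding g_eq co_top by (simp add: s_top)

lemma g_nonzero [simp]: "g v \<noteq> 0"
  by (simp add: g_eq)

lemma one_closed: "\<one>\<^sub>A \<in> carrier A"
  by simp

lemma comult_linear: "\<Delta> \<in> linear_maps A AA.T"
  and comult_one: "\<Delta> (x (\<lambda>i. 0)) = p \<one>\<^sub>A \<one>\<^sub>A"
  and comult_top: "\<Delta> (x \<tau>) = (\<Oplus>\<^bsub>AA.T\<^esub>u\<in>V. g u \<odot>\<^bsub>AA.T\<^esub> p (x (co u)) (x (act u)))"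
  and comult_inner: "v \<in> inner \<Longrightarrow> \<Delta> (x v) = p \<one>\<^sub>A (x v) \<oplus>\<^bsub>AA.T\<^esub> p (x v) \<one>\<^sub>A"
proof -
  let ?f = "\<lambda>v. if v = (\<lambda>i. 0) then p \<one>\<^sub>A \<one>\<^sub>A
            else if v = \<tau> then (\<Oplus>\<^bsub>AA.T\<^esub>u\<in>V. g u \<odot>\<^bsub>AA.T\<^esub> p (x (co u)) (x (act u)))
            else p \<one>\<^sub>A (x v) \<oplus>\<^bsub>AA.T\<^esub> p (x v) \<one>\<^sub>A"
  have \<Delta>: "\<Delta> = qci_linear n q a AA.T ?f" by (simp add: qci_comult_def Let_def)
  have f: "?f v \<in> carrier AA.T" for v by (simp add: AA.T.finsum_closed)
  note m = qci_linear_monom[OF AA.T.kspace_axioms f]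
  show "\<Delta> \<in> linear_maps A AA.T"
    unfolding \<Delta> by (rule qci_linear_linear[OF AA.T.kspace_axioms f])
  show "\<Delta> (x (\<lambda>i. 0)) = p \<one>\<^sub>A \<one>\<^sub>A"
    unfolding \<Delta> m[OF zero_in_V] by simp
  show "\<Delta> (x \<tau>) = (\<Oplus>\<^bsub>AA.T\<^esub>u\<in>V. g u \<odot>\<^bsub>AA.T\<^esub> p (x (co u)) (x (act u)))"
    unfolding \<Delta> m[OF top_in_V] using top_nonzero by simp
  show "v \<in> inner \<Longrightarrow> \<Delta> (x v) = p \<one>\<^sub>A (x v) \<oplus>\<^bsub>AA.T\<^esub> p (x v) \<one>\<^sub>A"
    unfolding \<Delta> using m[of v] by simp
qed

text \<open>The summands for \<open>v = a - 1\<close> and \<open>v = 0\<close> have coefficient \<open>1\<close>, the first one by the normalization of \<open>s\<close>.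
  So \<open>\<Delta>\<close> of the top monomial differs from that of a primitive element only by tensors of primitive
  monomials.\<close>

lemma comult_top_split:
  "\<Delta> (x \<tau>) = p \<one>\<^sub>A (x \<tau>) \<oplus>\<^bsub>AA.T\<^esub> (p (x \<tau>) \<one>\<^sub>A \<oplus>\<^bsub>AA.T\<^esub>
     (\<Oplus>\<^bsub>AA.T\<^esub>u\<in>inner. g u \<odot>\<^bsub>AA.T\<^esub> p (x (co u)) (x (act u))))"
proof -
  have V: "V = insert \<tau> (insert (\<lambda>i. 0) inner)" using zero_in_V top_in_V by blast
  have "(\<Oplus>\<^bsub>AA.T\<^esub>u\<in>insert \<tau> (insert (\<lambda>i. 0) inner). g u \<odot>\<^bsub>AA.T\<^esub> p (x (co u)) (x (act u))) =
      g \<tau> \<odot>\<^bsub>AA.T\<^esub> p (x (co \<tau>)) (x (act \<tau>)) \<oplus>\<^bsub>AA.T\<^esub>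
      (g (\<lambda>i. 0) \<odot>\<^bsub>AA.T\<^esub> p (x (co (\<lambda>i. 0))) (x (act (\<lambda>i. 0))) \<oplus>\<^bsub>AA.T\<^esub>
      (\<Oplus>\<^bsub>AA.T\<^esub>u\<in>inner. g u \<odot>\<^bsub>AA.T\<^esub> p (x (co u)) (x (act u))))"
    using top_nonzero by (subst AA.T.finsum_insert; (subst AA.T.finsum_insert)?) (auto simp: Pi_iff)
  then show ?thesis
    unfolding comult_top V[symmetric] by (simp only: g_zero g_top co_top perm_act_top act_zero monom_zero
        AA.T.smult_1 AA.pure_in_carrier one_closed monom_closed)
qed

lemma counit_eq: "X \<in> carrier A \<Longrightarrow> \<epsilon> X = coeff (\<lambda>i. 0) X"
  and counit_dual: "\<epsilon> \<in> dual_space A"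
proof -
  let ?f = "\<lambda>v. if v = (\<lambda>i. 0) then 1 else (0 :: 'k)"
  have l: "qci_linear n q a scalar_space ?f \<in> linear_maps A scalar_space"
    by (rule qci_linear_linear[OF kspace_scalar_space]) simp
  then show "\<epsilon> \<in> dual_space A" by (simp add: qci_counit_def dual_space_def)
  show "\<epsilon> X = coeff (\<lambda>i. 0) X" if "X \<in> carrier A"
    unfolding qci_counit_def
    by (rule functionals_eq_on_monoms[OF l[folded dual_space_def] coeff_linear _ that])
      (simp_all add: qci_linear_monom[OF kspace_scalar_space] coeff_monom)
qed

lemma counit_monom: "v \<in> V \<Longrightarrow> \<epsilon> (x v) = (if v = (\<lambda>i. 0) then 1 else 0)"
  by (simp add: counit_eq coeff_monom)

lemma counit_unit: "\<epsilon> \<one>\<^sub>A = 1"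
  using counit_monom[OF zero_in_V] by (simp add: monom_zero)

lemma antipode_linear: "S \<in> linear_maps A A"
  and antipode_monom: "v \<in> V \<Longrightarrow> S (x v) = s v *\<^sub>A x (act v)"
  unfolding qci_antipode_def
  by (rule qci_linear_linear[OF A.kspace_axioms], simp)
    (simp add: qci_linear_monom[OF A.kspace_axioms])

lemma antipode_one: "S \<one>\<^sub>A = \<one>\<^sub>A"
  using antipode_monom[OF zero_in_V] by (simp add: s_coeff_zero monom_zero)

lemma lift_comult_top:
  assumes P: "kspace P" and \<beta>: "bilinear_map A A P \<beta>"
  shows "tensor_lift A A P \<beta> (\<Delta> (x \<tau>)) = (\<Oplus>\<^bsub>P\<^esub>u\<in>V. g u \<odot>\<^bsub>P\<^esub> \<beta> (x (co u)) (x (act u)))"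
proof -
  interpret P: kspace P by fact
  note l = AA.tensor_lift_linear[OF P \<beta>]
  have "tensor_lift A A P \<beta> (\<Delta> (x \<tau>)) = (\<Oplus>\<^bsub>P\<^esub>u\<in>V. tensor_lift A A P \<beta> (g u \<odot>\<^bsub>AA.T\<^esub> p (x (co u)) (x (act u))))"
    unfolding comult_top
    by (rule linear_map_finsum[OF AA.T.vectorspace_axioms P.vectorspace_axioms l]) simp
  also have "\<dots> = (\<Oplus>\<^bsub>P\<^esub>u\<in>V. g u \<odot>\<^bsub>P\<^esub> \<beta> (x (co u)) (x (act u)))"
    by (rule P.finsum_cong') (simp_all add: linear_mapsD[OF l] AA.tensor_lift_pure[OF P \<beta>] bilinear_mapD[OF \<beta>] Pi_iff)
  finally show ?thesis .
qed

text \<open>Write \<open>\<Delta>(x\<^bsub>a-1\<^esub>)\<close> as a primitive part plus \<open>D = \<Sum> g y \<otimes> z\<close> with \<open>y\<close>, \<open>z\<close> primitive. Both sides then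
  consist of the three ways to place \<open>x\<^bsub>a-1\<^esub>\<close> in one factor, and of the three sums \<open>S1\<close>, \<open>S2\<close>,
  \<open>S3\<close> obtained from \<open>D\<close> by inserting \<open>1\<close> in the first, second or third factor.\<close>

lemma coassociative:
  assumes X: "X \<in> carrier A"
  shows "tensor_assoc A (tensor_map A A AA.T A \<Delta> (\<lambda>y. y) (\<Delta> X)) = tensor_map A A A AA.T (\<lambda>y. y) \<Delta> (\<Delta> X)"
proof -
  let ?L = "\<lambda>Y. tensor_assoc A (tensor_map A A AA.T A \<Delta> (\<lambda>y. y) Y)"
  let ?R = "tensor_map A A A AA.T (\<lambda>y. y) \<Delta>"
  let ?K = "\<lambda>Y. tensor_assoc A (pure AA.T A Y \<one>\<^sub>A)"
  let ?M = "\<lambda>Y. pure A AA.T \<one>\<^sub>A Y"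
  define t3 where "t3 y z w = pure A AA.T y (p z w)" for y z w
  note [simp] = A.kspace_axioms AA.T.kspace_axioms
  note mapL = tensor_map_linear[OF A.kspace_axioms A.kspace_axioms AA.T.kspace_axioms A.kspace_axioms comult_linear id_linear]
  note mapR = tensor_map_linear[OF A.kspace_axioms A.kspace_axioms A.kspace_axioms AA.T.kspace_axioms id_linear comult_linear]
  note assoc = tensor_assoc_linear[OF A.kspace_axioms]
  have Llin: "?L \<in> linear_maps AA.T R3.T" by (rule linear_maps_comp[OF mapL(1) assoc(1)])
  have Rlin: "?R \<in> linear_maps AA.T R3.T" by (rule mapR(1))
  have Klin: "?K \<in> linear_maps AA.T R3.T"
    by (rule linear_maps_comp[OF bilinear_map_left[OF L3.pure_bilinear one_closed] assoc(1)])
  have Mlin: "?M \<in> linear_maps AA.T R3.T"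
    by (rule bilinear_map_right[OF R3.pure_bilinear one_closed])
  have t3 [simp]: "t3 y z w \<in> carrier R3.T" if "y \<in> carrier A" "z \<in> carrier A" "w \<in> carrier A" for y z w
    using that by (simp add: t3_def)
  have K: "?K (p y z) = t3 y z \<one>\<^sub>A" if "y \<in> carrier A" "z \<in> carrier A" for y z
    using that by (simp add: assoc(2) t3_def)
  have M: "?M (p y z) = t3 \<one>\<^sub>A y z" if "y \<in> carrier A" "z \<in> carrier A" for y z
    by (simp add: t3_def)
  have L: "?L (p y z) = tensor_assoc A (pure AA.T A (\<Delta> y) z)" if "y \<in> carrier A" "z \<in> carrier A" for y z
    using that by (simp add: mapL(2))
  have R: "?R (p y z) = pure A AA.T y (\<Delta> z)" if "y \<in> carrier A" "z \<in> carrier A" for y z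
    using that by (rule mapR(2))
  have one: "\<Delta> \<one>\<^sub>A = p \<one>\<^sub>A \<one>\<^sub>A" using comult_one by (simp add: monom_zero)
  have L1: "?L (p \<one>\<^sub>A z) = t3 \<one>\<^sub>A \<one>\<^sub>A z" if "z \<in> carrier A" for z
    using that by (simp add: L one assoc(2) t3_def)
  have R1: "?R (p y \<one>\<^sub>A) = t3 y \<one>\<^sub>A \<one>\<^sub>A" if "y \<in> carrier A" for y
    using that by (simp add: R one t3_def)
  have Lv: "?L (p (x v) z) = t3 \<one>\<^sub>A (x v) z \<oplus>\<^bsub>R3.T\<^esub> t3 (x v) \<one>\<^sub>A z" if "v \<in> inner" "z \<in> carrier A" for v z
    using that by (simp add: L comult_inner bilinear_mapD[OF L3.pure_bilinear] linear_mapsD[OF assoc(1)] assoc(2) t3_def)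
  have Rv: "?R (p y (x v)) = t3 y \<one>\<^sub>A (x v) \<oplus>\<^bsub>R3.T\<^esub> t3 y (x v) \<one>\<^sub>A" if "v \<in> inner" "y \<in> carrier A" for v y
    using that by (simp add: R comult_inner bilinear_mapD[OF R3.pure_bilinear] t3_def)
  have Ltop: "?L (p (x \<tau>) \<one>\<^sub>A) = ?K (\<Delta> (x \<tau>))" by (simp add: L)
  have Rtop: "?R (p \<one>\<^sub>A (x \<tau>)) = ?M (\<Delta> (x \<tau>))" by (simp add: R)
  let ?D = "\<Oplus>\<^bsub>AA.T\<^esub>u\<in>inner. g u \<odot>\<^bsub>AA.T\<^esub> p (x (co u)) (x (act u))"
  let ?S = "\<lambda>f. \<Oplus>\<^bsub>R3.T\<^esub>u\<in>inner. g u \<odot>\<^bsub>R3.T\<^esub> f (x (co u)) (x (act u))"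
  have D: "?D \<in> carrier AA.T" by (rule AA.T.finsum_closed) simp
  have fD: "f ?D = (\<Oplus>\<^bsub>R3.T\<^esub>u\<in>inner. g u \<odot>\<^bsub>R3.T\<^esub> f (p (x (co u)) (x (act u))))"
    if f: "f \<in> linear_maps AA.T R3.T" for f
  proof -
    have "f ?D = (\<Oplus>\<^bsub>R3.T\<^esub>u\<in>inner. f (g u \<odot>\<^bsub>AA.T\<^esub> p (x (co u)) (x (act u))))"
      by (rule linear_map_finsum[OF AA.T.vectorspace_axioms R3.T.vectorspace_axioms f]) simp
    also have "\<dots> = (\<Oplus>\<^bsub>R3.T\<^esub>u\<in>inner. g u \<odot>\<^bsub>R3.T\<^esub> f (p (x (co u)) (x (act u))))"
      by (rule R3.T.finsum_cong') (simp_all add: linear_mapsD[OF f] Pi_iff)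
    finally show ?thesis .
  qed
  let ?S1 = "?S (\<lambda>y z. t3 \<one>\<^sub>A y z)" and ?S2 = "?S (\<lambda>y z. t3 y \<one>\<^sub>A z)" and ?S3 = "?S (\<lambda>y z. t3 y z \<one>\<^sub>A)"
  have S: "?S1 \<in> carrier R3.T" "?S2 \<in> carrier R3.T" "?S3 \<in> carrier R3.T"
    by (rule R3.T.finsum_closed, simp)+
  have KD: "?K ?D = ?S3" unfolding fD[OF Klin] by (rule R3.T.finsum_cong') (simp_all add: K)
  have MD: "?M ?D = ?S1" unfolding fD[OF Mlin] by (rule R3.T.finsum_cong') (simp_all add: M)
  have LD: "?L ?D = ?S1 \<oplus>\<^bsub>R3.T\<^esub> ?S2"
  proof -
    have "?L ?D = (\<Oplus>\<^bsub>R3.T\<^esub>u\<in>inner. g u \<odot>\<^bsub>R3.T\<^esub> t3 \<one>\<^sub>A (x (co u)) (x (act u)) \<oplus>\<^bsub>R3.T\<^esub> g u \<odot>\<^bsub>R3.T\<^esub> t3 (x (co u)) \<one>\<^sub>A (x (act u)))"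
      unfolding fD[OF Llin] by (rule R3.T.finsum_cong') (simp_all add: Lv[OF inner_closed(1)] R3.T.smult_add_right)
    also have "\<dots> = ?S1 \<oplus>\<^bsub>R3.T\<^esub> ?S2" by (rule R3.T.finsum_addf) simp_all
    finally show ?thesis .
  qed
  have RD: "?R ?D = ?S2 \<oplus>\<^bsub>R3.T\<^esub> ?S3"
  proof -
    have "?R ?D = (\<Oplus>\<^bsub>R3.T\<^esub>u\<in>inner. g u \<odot>\<^bsub>R3.T\<^esub> t3 (x (co u)) \<one>\<^sub>A (x (act u)) \<oplus>\<^bsub>R3.T\<^esub> g u \<odot>\<^bsub>R3.T\<^esub> t3 (x (co u)) (x (act u)) \<one>\<^sub>A)"
      unfolding fD[OF Rlin] by (rule R3.T.finsum_cong') (simp_all add: Rv[OF inner_closed(2)] R3.T.smult_add_right)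
    also have "\<dots> = ?S2 \<oplus>\<^bsub>R3.T\<^esub> ?S3" by (rule R3.T.finsum_addf) simp_all
    finally show ?thesis .
  qed
  have split: "f (\<Delta> (x \<tau>)) = f (p \<one>\<^sub>A (x \<tau>)) \<oplus>\<^bsub>R3.T\<^esub> (f (p (x \<tau>) \<one>\<^sub>A) \<oplus>\<^bsub>R3.T\<^esub> f ?D)"
    if f: "f \<in> linear_maps AA.T R3.T" for f
    unfolding comult_top_split by (simp add: linear_mapsD[OF f] D)
  show ?thesis
  proof (rule linear_maps_eq_on_monoms[OF R3.T.kspace_axioms linear_maps_comp[OF comult_linear Llin]
        linear_maps_comp[OF comult_linear Rlin] _ X])
    fix v assume "v \<in> V"
    then consider "v = (\<lambda>i. 0)" | "v \<in> inner" | "v = \<tau>" by blast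
    then show "?L (\<Delta> (x v)) = ?R (\<Delta> (x v))"
    proof cases
      case 1
      then show ?thesis by (simp add: comult_one L1 R1)
    next
      case 2
      have "?L (\<Delta> (x v)) = t3 \<one>\<^sub>A \<one>\<^sub>A (x v) \<oplus>\<^bsub>R3.T\<^esub> (t3 \<one>\<^sub>A (x v) \<one>\<^sub>A \<oplus>\<^bsub>R3.T\<^esub> t3 (x v) \<one>\<^sub>A \<one>\<^sub>A)"
        unfolding comult_inner[OF 2] using Lv[OF 2] by (simp add: linear_mapsD(2)[OF Llin] L1)
      moreover have "?R (\<Delta> (x v)) = (t3 \<one>\<^sub>A \<one>\<^sub>A (x v) \<oplus>\<^bsub>R3.T\<^esub> t3 \<one>\<^sub>A (x v) \<one>\<^sub>A) \<oplus>\<^bsub>R3.T\<^esub> t3 (x v) \<one>\<^sub>A \<one>\<^sub>A"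
        unfolding comult_inner[OF 2] using Rv[OF 2] by (simp add: linear_mapsD(2)[OF Rlin] R1)
      ultimately show ?thesis by (simp add: R3.T.a_assoc)
    next
      case 3
      have "?L (\<Delta> (x \<tau>)) = t3 \<one>\<^sub>A \<one>\<^sub>A (x \<tau>) \<oplus>\<^bsub>R3.T\<^esub> ((t3 \<one>\<^sub>A (x \<tau>) \<one>\<^sub>A \<oplus>\<^bsub>R3.T\<^esub> (t3 (x \<tau>) \<one>\<^sub>A \<one>\<^sub>A \<oplus>\<^bsub>R3.T\<^esub> ?S3)) \<oplus>\<^bsub>R3.T\<^esub> (?S1 \<oplus>\<^bsub>R3.T\<^esub> ?S2))"
        by (simp only: split[OF Llin] L1[OF monom_closed] Ltop split[OF Klin] K[OF one_closed monom_closed] K[OF monom_closed one_closed] KD LD)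
      moreover have "?R (\<Delta> (x \<tau>)) = (t3 \<one>\<^sub>A \<one>\<^sub>A (x \<tau>) \<oplus>\<^bsub>R3.T\<^esub> (t3 \<one>\<^sub>A (x \<tau>) \<one>\<^sub>A \<oplus>\<^bsub>R3.T\<^esub> ?S1)) \<oplus>\<^bsub>R3.T\<^esub> (t3 (x \<tau>) \<one>\<^sub>A \<one>\<^sub>A \<oplus>\<^bsub>R3.T\<^esub> (?S2 \<oplus>\<^bsub>R3.T\<^esub> ?S3))"
        by (simp only: split[OF Rlin] R1[OF monom_closed] Rtop split[OF Mlin] M[OF one_closed monom_closed] M[OF monom_closed one_closed] MD RD)
      moreover have "t3 \<one>\<^sub>A \<one>\<^sub>A (x \<tau>) \<in> carrier R3.T" "t3 \<one>\<^sub>A (x \<tau>) \<one>\<^sub>A \<in> carrier R3.T" "t3 (x \<tau>) \<one>\<^sub>A \<one>\<^sub>A \<in> carrier R3.T"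
        by simp_all
      ultimately show ?thesis unfolding 3 using S by (simp add: R3.T.a_ac)
    qed
  qed
qed

abbreviation "\<phi> \<equiv> qci_dual n q a \<tau>"

text \<open>Both counit laws are instances: a bilinear map that is unital on primitive elements and vanishes
  on pairs of primitive monomials inverts \<open>\<Delta>\<close>.\<close>

lemma lift_comult_eq_self:
  assumes \<beta>: "bilinear_map A A A \<beta>" and one: "\<beta> \<one>\<^sub>A \<one>\<^sub>A = \<one>\<^sub>A"
    and primitive: "\<And>v. v \<in> V \<Longrightarrow> v \<noteq> (\<lambda>i. 0) \<Longrightarrow> \<beta> \<one>\<^sub>A (x v) \<oplus>\<^bsub>A\<^esub> \<beta> (x v) \<one>\<^sub>A = x v"
    and vanish: "\<And>u v. u \<in> inner \<Longrightarrow> v \<in> inner \<Longrightarrow> \<beta> (x u) (x v) = \<zero>\<^bsub>A\<^esub>"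
    and X: "X \<in> carrier A"
  shows "tensor_lift A A A \<beta> (\<Delta> X) = X"
proof -
  note l = AA.tensor_lift_linear[OF A.kspace_axioms \<beta>] and lp = AA.tensor_lift_pure[OF A.kspace_axioms \<beta>]
  note \<beta>_closed = bilinear_mapD(1)[OF \<beta>]
  let ?D = "\<Oplus>\<^bsub>AA.T\<^esub>u\<in>inner. g u \<odot>\<^bsub>AA.T\<^esub> p (x (co u)) (x (act u))"
  have D: "?D \<in> carrier AA.T" by (rule AA.T.finsum_closed) simp
  have "tensor_lift A A A \<beta> ?D = (\<Oplus>\<^bsub>A\<^esub>u\<in>inner. tensor_lift A A A \<beta> (g u \<odot>\<^bsub>AA.T\<^esub> p (x (co u)) (x (act u))))"
    by (rule linear_map_finsum[OF AA.T.vectorspace_axioms A.vectorspace_axioms l]) simp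
  also have "\<dots> = (\<Oplus>\<^bsub>A\<^esub>u\<in>inner. \<zero>\<^bsub>A\<^esub>)"
    by (rule A.finsum_cong') (simp_all add: linear_mapsD(3)[OF l] lp vanish[OF inner_closed])
  finally have lD: "tensor_lift A A A \<beta> ?D = \<zero>\<^bsub>A\<^esub>" by simp
  show ?thesis
  proof (rule linear_maps_eq_on_monoms[OF A.kspace_axioms linear_maps_comp[OF comult_linear l] id_linear _ X])
    fix v assume "v \<in> V"
    then consider "v = (\<lambda>i. 0)" | "v \<in> inner" | "v = \<tau>" by blast
    then show "tensor_lift A A A \<beta> (\<Delta> (x v)) = x v"
    proof cases
      case 1
      then show ?thesis using comult_one by (simp add: lp one monom_zero)
    next
      case 2
      then show ?thesis using primitive[of v] by (simp add: comult_inner linear_mapsD(2)[OF l] lp)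
    next
      case 3
      then show ?thesis
        using primitive[OF top_in_V top_nonzero] unfolding 3 comult_top_split
        by (simp add: D linear_mapsD(2)[OF l] lp lD \<beta>_closed)
    qed
  qed
qed

lemma counit_left: "X \<in> carrier A \<Longrightarrow> tensor_lift A A A (\<lambda>y z. \<epsilon> y *\<^sub>A z) (\<Delta> X) = X"
  by (rule lift_comult_eq_self[OF functional_bilinear(1)[OF counit_dual]])
    (simp_all add: counit_unit counit_monom)

lemma counit_right: "X \<in> carrier A \<Longrightarrow> tensor_lift A A A (\<lambda>y z. \<epsilon> z *\<^sub>A y) (\<Delta> X) = X"
  by (rule lift_comult_eq_self[OF functional_bilinear(2)[OF counit_dual]])
    (simp_all add: counit_unit counit_monom)

lemma coalgebra_A: "coalgebra A \<Delta> \<epsilon>"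
  by (intro coalgebra.intro A.vectorspace_axioms comult_linear counit_dual coassociative counit_left counit_right)

text \<open>The factor \<open>1 / q\<^bsup>\<langle>a-1-v|v\<rangle>\<^esup>\<close> in \<open>g\<close> compensates the one produced by \<open>x\<^bsub>a-1-v\<^esub> x\<^sub>v\<close>.\<close>

lemma antipode_from_comult:
  assumes X: "X \<in> carrier A"
  shows "S X = tensor_lift A A A (\<lambda>y z. \<phi> (y \<star> X) *\<^sub>A z) (\<Delta> (x \<tau>))"
proof -
  note \<beta> = functional_bilinear(1)[OF dual_right_mult[OF qci_dual_linear[OF top_in_V] X]]
  have "tensor_lift A A A (\<lambda>y z. \<phi> (y \<star> X) *\<^sub>A z) (\<Delta> (x \<tau>)) =
      (\<Oplus>\<^bsub>A\<^esub>u\<in>V. g u *\<^sub>A (\<phi> (x (co u) \<star> X) *\<^sub>A x (act u)))"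
    by (rule lift_comult_top[OF A.kspace_axioms \<beta>])
  also have "\<dots> = (\<Oplus>\<^bsub>A\<^esub>u\<in>V. qci_dual n q a u X *\<^sub>A (s u *\<^sub>A x (act u)))"
    by (rule A.finsum_cong')
      (simp_all add: X qci_dual_eq_coeff top_coeff_mult A.smult_smult g_eq mult.commute)
  also have "\<dots> = S X" by (simp add: qci_antipode_def qci_linear_def)
  finally show ?thesis by simp
qed

lemma counit_ring_hom: "\<epsilon> \<in> Ring.ring_hom A class_ring"
proof -
  have mon: "\<epsilon> (x u \<star> x v) = \<epsilon> (x u) * \<epsilon> (x v)" if "u \<in> V" "v \<in> V" for u v
  proof -
    have "(\<lambda>i. u i + v i) = (\<lambda>i. 0) \<longleftrightarrow> u = (\<lambda>i. 0) \<and> v = (\<lambda>i. 0)"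
      using V_nonneg[OF that(1)] V_nonneg[OF that(2)] by (auto simp: fun_eq_iff add_nonneg_eq_0_iff)
    then show ?thesis using that by (auto simp: counit_eq coeff_mult_monom coeff_monom)
  qed
  have l: "(\<lambda>X. \<epsilon> X * b) \<in> dual_space A" "(\<lambda>X. b * \<epsilon> X) \<in> dual_space A" for b
    by (rule dual_spaceI; simp add: dual_spaceD[OF counit_dual] algebra_simps)+
  have mon': "\<epsilon> (X \<star> x v) = \<epsilon> X * \<epsilon> (x v)" if "X \<in> carrier A" "v \<in> V" for X v
    by (rule functionals_eq_on_monoms[OF dual_comp[OF mult_left_linear counit_dual] l(1) _ that(1)])
      (simp_all add: mon that)
  have "\<epsilon> (X \<star> Y) = \<epsilon> X * \<epsilon> Y" if X: "X \<in> carrier A" and Y: "Y \<in> carrier A" for X Y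
    by (rule functionals_eq_on_monoms[OF dual_comp[OF mult_right_linear counit_dual] l(2) _ Y])
      (simp_all add: mon' X)
  then show ?thesis
    by (intro ring_hom_memI) (simp_all add: dual_spaceD[OF counit_dual] counit_unit)
qed

text \<open>On monomials this is \<open>s_add\<close>.\<close>

lemma antipode_anti_mult:
  assumes "X \<in> carrier A" "Y \<in> carrier A"
  shows "S (X \<star> Y) = S Y \<star> S X"
proof -
  note Sc = linear_mapsD(1)[OF antipode_linear]
  have mon: "S (x u \<star> x v) = S (x v) \<star> S (x u)" if u: "u \<in> V" and v: "v \<in> V" for u v
  proof -
    let ?w = "\<lambda>i. u i + v i"
    have w: "(\<lambda>i. act v i + act u i) = act ?w" by (simp add: perm_act_eq add.commute)
    have *: "S (x v) \<star> S (x u) = (s v * s u) *\<^sub>A (x (act v) \<star> x (act u))"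
      using u v by (simp add: antipode_monom smult_mult A.smult_smult mult.commute)
    show ?thesis
    proof (cases "?w \<in> V")
      case True
      have "S (x u \<star> x v) = (qp u v * s ?w) *\<^sub>A x (act ?w)"
        using True u v by (simp add: monom_mult linear_mapsD(3)[OF antipode_linear] antipode_monom A.smult_smult)
      moreover have "qp u v * s ?w = s v * s u * qp (act v) (act u)"
        using s_add[of u v] by (simp add: mult_ac)
      ultimately show ?thesis
        unfolding * using True u v by (simp add: monom_mult w A.smult_smult)
    next
      case False
      then show ?thesis using u v
          linear_map_zero[OF A.vectorspace_axioms A.vectorspace_axioms antipode_linear]
        by (simp add: * monom_mult w)
    qed
  qed
  have mon': "S (X \<star> x v) = S (x v) \<star> S X" if "X \<in> carrier A" "v \<in> V" for X v
    by (rule linear_maps_eq_on_monoms[OF A.kspace_axioms linear_maps_comp[OF mult_left_linear antipode_linear]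
          linear_maps_comp[OF antipode_linear mult_right_linear] _ that(1)])
      (simp_all add: mon that Sc)
  show ?thesis
    by (rule linear_maps_eq_on_monoms[OF A.kspace_axioms linear_maps_comp[OF mult_right_linear antipode_linear]
          linear_maps_comp[OF antipode_linear mult_left_linear] _ assms(2)])
      (simp_all add: mon' assms Sc)
qed

lemma counit_antipode: "X \<in> carrier A \<Longrightarrow> \<epsilon> (S X) = \<epsilon> X"
proof (rule functionals_eq_on_monoms[OF dual_comp[OF antipode_linear counit_dual] counit_dual])
  fix v assume v: "v \<in> V"
  have "act v = (\<lambda>i. 0) \<longleftrightarrow> v = (\<lambda>i. 0)" using act_act[of v] act_zero by metis
  then show "\<epsilon> (S (x v)) = \<epsilon> (x v)"
    using v by (auto simp: antipode_monom dual_spaceD[OF counit_dual] counit_monom s_coeff_zero)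
qed

text \<open>Only the top monomial needs an argument: \<open>S\<close> fixes it, and applying \<open>S \<otimes> S\<close> and the flip to its
  coproduct returns the same sum after the substitution \<open>v \<mapsto> a - 1 - v\<close>, because \<open>S\<^sup>2\<close> acts on \<open>x\<^sub>v\<close> by
  \<open>h\<^sub>v\<close>.\<close>

lemma comult_antipode:
  assumes X: "X \<in> carrier A"
  shows "\<Delta> (S X) = tensor_lift A A AA.T (\<lambda>y z. p (S z) (S y)) (\<Delta> X)"
proof -
  note Sc = linear_mapsD(1)[OF antipode_linear]
  have \<beta>: "bilinear_map A A AA.T (\<lambda>y z. p (S z) (S y))"
    by (rule bilinear_mapI) (simp_all add: linear_mapsD[OF antipode_linear] bilinear_mapD[OF AA.pure_bilinear])
  note l = AA.tensor_lift_linear[OF AA.T.kspace_axioms \<beta>] and lp = AA.tensor_lift_pure[OF AA.T.kspace_axioms \<beta>]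
  show ?thesis
  proof (rule linear_maps_eq_on_monoms[OF AA.T.kspace_axioms linear_maps_comp[OF antipode_linear comult_linear]
        linear_maps_comp[OF comult_linear l] _ X])
    fix v assume "v \<in> V"
    then consider "v = (\<lambda>i. 0)" | "v \<in> inner" | "v = \<tau>" by blast
    then show "\<Delta> (S (x v)) = tensor_lift A A AA.T (\<lambda>y z. p (S z) (S y)) (\<Delta> (x v))"
    proof cases
      case 1
      then show ?thesis using comult_one by (simp add: lp antipode_one monom_zero)
    next
      case 2
      then have v: "v \<in> V" by simp
      have "\<Delta> (S (x v)) = s v \<odot>\<^bsub>AA.T\<^esub> (p \<one>\<^sub>A (x (act v)) \<oplus>\<^bsub>AA.T\<^esub> p (x (act v)) \<one>\<^sub>A)"
        using v by (simp add: antipode_monom linear_mapsD(3)[OF comult_linear] comult_inner[OF inner_closed(2)[OF 2]])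
      moreover have "tensor_lift A A AA.T (\<lambda>y z. p (S z) (S y)) (\<Delta> (x v)) =
          p (S (x v)) \<one>\<^sub>A \<oplus>\<^bsub>AA.T\<^esub> p \<one>\<^sub>A (S (x v))"
        using 2 by (simp add: comult_inner linear_mapsD(2)[OF l] lp antipode_one)
      ultimately show ?thesis
        using v by (simp add: antipode_monom bilinear_mapD[OF AA.pure_bilinear] AA.T.smult_add_right AA.T.a_comm)
    next
      case 3
      have "S (x \<tau>) = x \<tau>" by (simp add: antipode_monom s_top perm_act_top)
      moreover have "(\<Oplus>\<^bsub>AA.T\<^esub>u\<in>V. g u \<odot>\<^bsub>AA.T\<^esub> p (S (x (act u))) (S (x (co u)))) =
          (\<Oplus>\<^bsub>AA.T\<^esub>u\<in>V. g (co u) \<odot>\<^bsub>AA.T\<^esub> p (S (x (act (co u)))) (S (x (co (co u)))))"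
      proof -
        have "co ` V = V"
        proof
          show "V \<subseteq> co ` V"
          proof
            fix u assume "u \<in> V"
            then show "u \<in> co ` V" by (intro image_eqI[of _ _ "co u"]) simp_all
          qed
        qed auto
        moreover have "inj_on co V" using co_co by (intro inj_on_inverseI)
        ultimately show ?thesis
          using AA.T.add.finprod_reindex[of "\<lambda>u. g u \<odot>\<^bsub>AA.T\<^esub> p (S (x (act u))) (S (x (co u)))" co V]
          by (simp add: Sc Pi_iff)
      qed
      moreover have "\<dots> = (\<Oplus>\<^bsub>AA.T\<^esub>u\<in>V. g u \<odot>\<^bsub>AA.T\<^esub> p (x (co u)) (x (act u)))"
      proof (rule AA.T.finsum_cong')
        fix u assume u: "u \<in> V"
        have "g (co u) * (s u * s (act (co u))) = s u * (s (co u) * s (act (co u))) / qp (co (co u)) (co u)"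
          unfolding g_eq by simp
        also have "\<dots> = g u" using u unfolding s_perm by (simp add: g_eq h_coeff_def)
        finally have "g (co u) * (s u * s (act (co u))) = g u" .
        then show "g (co u) \<odot>\<^bsub>AA.T\<^esub> p (S (x (act (co u)))) (S (x (co (co u)))) = g u \<odot>\<^bsub>AA.T\<^esub> p (x (co u)) (x (act u))"
          using u by (simp add: antipode_monom bilinear_mapD[OF AA.pure_bilinear] AA.T.smult_smult)
      qed simp_all
      ultimately show ?thesis unfolding 3 lift_comult_top[OF AA.T.kspace_axioms \<beta>]
        by (simp only: comult_top)
    qed
  qed
qed

lemma frobenius_algebra_A: "frobenius_algebra A \<phi>"
  unfolding frobenius_algebra_def
proof (intro conjI ballI qci_dual_linear[OF top_in_V])
  fix f assume f: "f \<in> dual_space A"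
  \<comment> \<open>\<open>x\<^sub>v\<close> is dual, up to the factor \<open>q\<^bsup>\<langle>v|a-1-v\<rangle>\<^esup>\<close>, to \<open>x\<^bsub>a-1-v\<^esub>\<close>\<close>
  let ?b = "\<Oplus>\<^bsub>A\<^esub>v\<in>V. (f (x (co v)) / qp v (co v)) *\<^sub>A x v"
  show "\<exists>b\<in>carrier A. \<forall>X\<in>carrier A. f X = \<phi> (b \<star> X)"
  proof (intro bexI ballI)
    fix X assume X: "X \<in> carrier A"
    have "f X = coeff \<tau> (?b \<star> X)"
      by (rule functionals_eq_on_monoms[OF f dual_comp[OF mult_right_linear coeff_linear] _ X])
        (simp_all add: top_coeff_mult coeff_combination)
    then show "f X = \<phi> (?b \<star> X)" using X by (simp add: qci_dual_eq_coeff)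
  qed simp
qed

lemma frobenius_coalgebra_A: "frobenius_coalgebra A \<Delta> (x \<tau>)"
  unfolding frobenius_coalgebra_def
proof (intro conjI equalityI subsetI)
  fix X assume X: "X \<in> carrier A"
  \<comment> \<open>the coefficients of \<open>\<Delta>(x\<^bsub>a-1\<^esub>)\<close> are nonzero, so a functional on the left factors can prescribe all coordinates\<close>
  let ?f = "\<lambda>Y. \<Sum>u\<in>V. coeff (co u) Y * (coeff (act u) X / g u)"
  have f: "?f \<in> dual_space A"
    by (rule dual_spaceI)
      (simp_all add: dual_spaceD[OF coeff_linear] sum.distrib sum_distrib_left algebra_simps add_divide_distrib)
  have fm: "?f (x (co v)) = coeff (act v) X / g v" if v: "v \<in> V" for v
  proof -
    have "?f (x (co v)) = (\<Sum>u\<in>V. if u = v then coeff (act v) X / g v else 0)"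
    proof (rule sum.cong[OF refl])
      fix u assume u: "u \<in> V"
      have "co u = co v \<longleftrightarrow> u = v" using co_co[OF u] co_co[OF v] by metis
      then show "coeff (co u) (x (co v)) * (coeff (act u) X / g u) = (if u = v then coeff (act v) X / g v else 0)"
        using u v by (auto simp: coeff_monom)
    qed
    then show ?thesis using v by simp
  qed
  have "tensor_lift A A A (\<lambda>y z. ?f y *\<^sub>A z) (\<Delta> (x \<tau>)) = (\<Oplus>\<^bsub>A\<^esub>u\<in>V. g u *\<^sub>A (?f (x (co u)) *\<^sub>A x (act u)))"
    by (rule lift_comult_top[OF A.kspace_axioms functional_bilinear(1)[OF f]])
  also have "\<dots> = (\<Oplus>\<^bsub>A\<^esub>u\<in>V. coeff (act u) X *\<^sub>A x (act u))"
  proof (rule A.finsum_cong')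
    fix u assume u: "u \<in> V"
    show "g u *\<^sub>A (?f (x (co u)) *\<^sub>A x (act u)) = coeff (act u) X *\<^sub>A x (act u)"
      unfolding fm[OF u] by (simp add: A.smult_smult)
  qed simp_all
  also have "\<dots> = (\<Oplus>\<^bsub>A\<^esub>u\<in>act ` V. coeff u X *\<^sub>A x u)"
    by (rule A.add.finprod_reindex[symmetric]) (simp, rule inj_on_inverseI[of _ act], simp)
  also have "act ` V = V"
  proof
    show "V \<subseteq> act ` V"
    proof
      fix u assume "u \<in> V"
      then show "u \<in> act ` V" by (intro image_eqI[of _ _ "act u"]) simp_all
    qed
  qed auto
  also have "(\<Oplus>\<^bsub>A\<^esub>u\<in>V. coeff u X *\<^sub>A x u) = X"
    by (rule monom_expansion[OF X, symmetric])
  finally show "X \<in> {tensor_lift A A A (\<lambda>x y. f x *\<^sub>A y) (\<Delta> (x \<tau>)) |f. f \<in> dual_space A}"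
    using f by (intro CollectI exI[of _ ?f] conjI) simp_all
next
  fix X assume "X \<in> {tensor_lift A A A (\<lambda>x y. f x *\<^sub>A y) (\<Delta> (x \<tau>)) |f. f \<in> dual_space A}"
  then obtain f where f: "f \<in> dual_space A" "X = tensor_lift A A A (\<lambda>x y. f x *\<^sub>A y) (\<Delta> (x \<tau>))" by blast
  show "X \<in> carrier A" unfolding f(2)
    by (intro linear_mapsD(1)[OF AA.tensor_lift_linear[OF A.kspace_axioms functional_bilinear(1)[OF f(1)]]]
        linear_mapsD(1)[OF comult_linear]) simp
qed simp

theorem bi_frobenius: "bi_frobenius_algebra A \<Delta> \<epsilon> \<phi> (x \<tau>) S"
  by (intro bi_frobenius_algebra.intro fin_dim_algebra_A coalgebra_A bi_frobenius_algebra_axioms.intro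
      antipode_from_comult counit_ring_hom frobenius_algebra_A frobenius_coalgebra_A antipode_one
      antipode_anti_mult counit_antipode comult_antipode comult_one[unfolded monom_zero])

lemma permutation_antipode_S: "permutation_antipode n q a S"
  unfolding permutation_antipode_def
proof (intro exI conjI ballI)
  show "bij_betw act V V" by (rule bij_betw_byWitness[of _ act]) auto
  show "S (x v) = s v *\<^sub>A x (act v)" if "v \<in> V" for v
    by (rule antipode_monom[OF that])
qed

end

section \<open>Bi-Frobenius structures with permutation antipode\<close>

context quantum_complete_intersection
begin

definition weight :: "(nat \<Rightarrow> int) \<Rightarrow> nat" where
  "weight v = (\<Sum>i\<in>{1..n}. nat (v i))"

lemma weight_add: "u \<in> V \<Longrightarrow> v \<in> V \<Longrightarrow> weight (\<lambda>i. u i + v i) = weight u + weight v"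
  using V_nonneg by (simp add: weight_def nat_add_distrib sum.distrib)

lemma weight_eq_0_iff: "v \<in> V \<Longrightarrow> weight v = 0 \<longleftrightarrow> v = (\<lambda>i. 0)"
proof
  assume v: "v \<in> V" and "weight v = 0"
  then have "v i = 0" for i
    using V_nonneg[OF v, of i] V_outside[OF v, of i] by (cases "i \<in> {1..n}") (auto simp: weight_def intro: antisym)
  then show "v = (\<lambda>i. 0)" by auto
qed (simp add: weight_def)

lemma weight_diff:
  assumes "u \<in> V" "v \<in> V" "\<And>i. u i \<le> v i"
  shows "(\<lambda>i. v i - u i) \<in> V" "weight v = weight u + weight (\<lambda>i. v i - u i)"
proof -
  show *: "(\<lambda>i. v i - u i) \<in> V"
  proof (rule VI)
    fix i
    show "0 \<le> v i - u i" using assms(3)[of i] by simp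
    show "v i - u i \<le> \<tau> i" using V_le_top[OF assms(2), of i] V_nonneg[OF assms(1), of i] by linarith
  qed
  show "weight v = weight u + weight (\<lambda>i. v i - u i)"
    using weight_add[OF assms(1) *] by simp
qed

lemma weight_less: "u \<in> V \<Longrightarrow> v \<in> V \<Longrightarrow> (\<And>i. u i \<le> v i) \<Longrightarrow> u \<noteq> v \<Longrightarrow> weight u < weight v"
  using weight_diff[of u v] weight_eq_0_iff[of "\<lambda>i. v i - u i"] by (fastforce simp: fun_eq_iff)

lemma V_split:
  assumes "v \<in> V" "v \<noteq> (\<lambda>i. 0)"
  obtains i u where "i \<in> {1..n}" "u \<in> V" "v = (\<lambda>j. basis_vec i j + u j)" "weight u < weight v"
proof -
  obtain i where i: "v i \<noteq> 0" using assms(2) by (auto simp: fun_eq_iff)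
  then have i': "i \<in> {1..n}" using V_outside[OF assms(1)] by blast
  have le: "basis_vec i j \<le> v j" for j
    using i V_nonneg[OF assms(1), of j] by (auto simp: basis_vec_def)
  have "weight (basis_vec i) \<noteq> 0"
    using weight_eq_0_iff[OF basis_in_V[OF i']] by (auto simp: basis_vec_def fun_eq_iff)
  then show thesis
    using that[OF i' weight_diff(1)[OF basis_in_V[OF i'] assms(1) le]] weight_diff(2)[OF basis_in_V[OF i'] assms(1) le]
    by simp
qed

lemma smult_monom_eq_iff:
  assumes "u \<in> V" "v \<in> V" "b \<noteq> 0"
  shows "b *\<^sub>A x u = d *\<^sub>A x v \<longleftrightarrow> u = v \<and> b = d"
proof
  assume eq: "b *\<^sub>A x u = d *\<^sub>A x v"
  have "b = (if v = u then d else 0)"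
    using arg_cong[OF eq, of "coeff u"] assms by (simp add: coeff_smult coeff_monom split: if_splits)
  then show "u = v \<and> b = d" using assms(3) by (auto split: if_splits)
qed auto

text \<open>The top monomial spans the socle: every nonconstant monomial annihilates it.\<close>

lemma mult_top:
  assumes X: "X \<in> carrier A"
  shows "X \<star> x \<tau> = coeff (\<lambda>i. 0) X *\<^sub>A x \<tau>"
proof (rule linear_maps_eq_on_monoms[OF A.kspace_axioms mult_left_linear
      linear_map_scale_by_functional[OF A.kspace_axioms coeff_linear] _ X])
  fix v assume v: "v \<in> V"
  show "x v \<star> x \<tau> = coeff (\<lambda>i. 0) (x v) *\<^sub>A x \<tau>"
  proof (cases "v = (\<lambda>i. 0)")
    case True
    then show ?thesis by (simp add: monom_mult coeff_monom)
  next
    case False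
    have "(\<lambda>i. v i + \<tau> i) \<notin> V"
    proof
      assume "(\<lambda>i. v i + \<tau> i) \<in> V"
      then have "v i = 0" for i using V_le_top[of "\<lambda>i. v i + \<tau> i" i] V_nonneg[OF v, of i] by simp
      then show False using False by auto
    qed
    then show ?thesis using v False by (simp add: monom_mult coeff_monom)
  qed
qed simp_all

text \<open>A monomial \<open>x\<^sub>u\<close> survives multiplication by \<open>x\<^bsub>a-1-v\<^esub>\<close> only if \<open>u \<le> v\<close>; if \<open>v\<close> has minimal weight
  among the monomials occurring in \<open>X\<close>, then \<open>u = v\<close> is the only such term.\<close>

lemma mult_co_minimal:
  assumes X: "X \<in> carrier A" and v: "v \<in> V"
    and minimal: "\<And>u. u \<in> V \<Longrightarrow> coeff u X \<noteq> 0 \<Longrightarrow> weight v \<le> weight u"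
  shows "X \<star> x (co v) = (coeff v X * qp v (co v)) *\<^sub>A x \<tau>"
proof -
  have c: "coeff u X *\<^sub>A x u \<in> carrier A" for u by simp
  have "X \<star> x (co v) = (\<Oplus>\<^bsub>A\<^esub>u\<in>V. (coeff u X *\<^sub>A x u) \<star> x (co v))"
    by (subst monom_expansion[OF X])
      (rule linear_map_finsum[OF A.vectorspace_axioms A.vectorspace_axioms mult_left_linear c], simp)
  also have "\<dots> = (\<Oplus>\<^bsub>A\<^esub>u\<in>V. if v = u then (coeff v X * qp v (co v)) *\<^sub>A x \<tau> else \<zero>\<^bsub>A\<^esub>)"
  proof (rule A.finsum_cong')
    fix u assume u: "u \<in> V"
    have sum: "(\<lambda>i. v i + co v i) = \<tau>" using v by (simp add: co_eq[OF v])
    show "(coeff u X *\<^sub>A x u) \<star> x (co v) = (if v = u then (coeff v X * qp v (co v)) *\<^sub>A x \<tau> else \<zero>\<^bsub>A\<^esub>)"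
    proof (cases "v = u")
      case True
      then show ?thesis using v sum by (auto simp: smult_mult monom_mult A.smult_smult)
    next
      case False
      have "coeff u X = 0 \<or> (\<lambda>i. u i + co v i) \<notin> V"
      proof (rule ccontr)
        assume *: "\<not> ?thesis"
        then have "u i \<le> v i" for i
          using V_le_top[of "\<lambda>i. u i + co v i" i] by (simp add: co_eq[OF v])
        then have "weight u < weight v" using weight_less[OF u v] False by auto
        then show False using minimal[OF u] * by simp
      qed
      then show ?thesis using False u v by (auto simp: smult_mult monom_mult)
    qed
  qed simp_all
  also have "\<dots> = (coeff v X * qp v (co v)) *\<^sub>A x \<tau>"
    by (rule A.finsum_singleton) (use v in simp_all)
  finally show ?thesis .
qed

lemma q_from_qp:
  assumes "i \<in> {1..n}" "j \<in> {1..n}"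
  shows "qp (basis_vec i) (basis_vec j) = q j i * qp (basis_vec j) (basis_vec i)"
  using assms q_inverse[OF assms] q_diag by (cases i j rule: linorder_cases) (auto simp: qp_basis mult.commute)

end

text \<open>An arbitrary bi-Frobenius structure with permutation antipode, together with a presentation
  \<open>\<Delta>(t) = \<Sum> u\<^sub>k \<otimes> w\<^sub>k\<close>. Such a presentation exists by \<open>tensor_sum_of_pures\<close>; fixing it turns Sweedler
  calculus into finite sums.\<close>

locale bi_frobenius_permutation =
  quantum_complete_intersection n a q + B: bi_frobenius_algebra "qci n q a" \<Delta> \<epsilon> \<phi> t S
  for n :: nat and a :: "nat \<Rightarrow> int" and q :: "nat \<Rightarrow> nat \<Rightarrow> 'k::field" and \<Delta> \<epsilon> \<phi> t S +
  fixes \<sigma> :: "(nat \<Rightarrow> int) \<Rightarrow> nat \<Rightarrow> int" and c :: "(nat \<Rightarrow> int) \<Rightarrow> 'k"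
    and K :: "((nat list \<Rightarrow> 'k) set \<times> (nat list \<Rightarrow> 'k) set) set"
    and u w :: "(nat list \<Rightarrow> 'k) set \<times> (nat list \<Rightarrow> 'k) set \<Rightarrow> (nat list \<Rightarrow> 'k) set"
  assumes \<sigma>: "bij_betw \<sigma> V V"
    and S_monom: "\<And>v. v \<in> V \<Longrightarrow> S (x v) = c v *\<^sub>A x (\<sigma> v)"
    and finite_K: "finite K"
    and u_closed [simp]: "\<And>k. k \<in> K \<Longrightarrow> u k \<in> carrier A"
    and w_closed [simp]: "\<And>k. k \<in> K \<Longrightarrow> w k \<in> carrier A"
    and comult_t: "\<Delta> t = (\<Oplus>\<^bsub>tensor A A\<^esub>k\<in>K. pure A A (u k) (w k))"
begin

sublocale AA: tensor_pair A A by (rule tensor_pairI[OF A.kspace_axioms A.kspace_axioms])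

lemma phi_dual: "\<phi> \<in> dual_space A"
  using B.frobenius_algebra by (simp add: frobenius_algebra_def)

lemma t_closed [simp]: "t \<in> carrier A"
  using B.frobenius_coalgebra unfolding frobenius_coalgebra_def by (rule conjunct1)

lemma \<sigma>_in_V [simp]: "v \<in> V \<Longrightarrow> \<sigma> v \<in> V"
  using \<sigma> by (auto simp: bij_betw_def)

lemma \<sigma>_eq_iff: "v \<in> V \<Longrightarrow> v' \<in> V \<Longrightarrow> \<sigma> v = \<sigma> v' \<longleftrightarrow> v = v'"
  using \<sigma> by (auto simp: bij_betw_def inj_on_def)

lemma functional_finsum:
  assumes "f \<in> dual_space A" "\<And>k. k \<in> K \<Longrightarrow> y k \<in> carrier A"
  shows "f (\<Oplus>\<^bsub>A\<^esub>k\<in>K. y k) = (\<Sum>k\<in>K. f (y k))"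
  using linear_map_finsum[OF A.vectorspace_axioms kspace.axioms[OF kspace_scalar_space] assms(1)[unfolded dual_space_def] assms(2)]
  by simp

lemma S_sum: "X \<in> carrier A \<Longrightarrow> S X = (\<Oplus>\<^bsub>A\<^esub>k\<in>K. \<phi> (u k \<star> X) *\<^sub>A w k)"
  unfolding B.S_eq comult_t
  by (rule AA.tensor_lift_sum_of_pures[OF A.kspace_axioms functional_bilinear(1)[OF dual_right_mult[OF phi_dual]]])
    simp_all

lemma S_linear: "S \<in> linear_maps A A"
proof (rule linear_mapsI)
  note d = dual_spaceD[OF phi_dual]
  fix X assume X: "X \<in> carrier A"
  show "S X \<in> carrier A" unfolding S_sum[OF X] by (rule A.finsum_closed) simp
  show "S (b *\<^sub>A X) = b *\<^sub>A S X" for b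
    unfolding S_sum[OF X] S_sum[OF A.smult_closed'[OF X]]
    by (subst A.smult_finsum, simp, rule A.finsum_cong') (simp_all add: X smult_mult d A.smult_smult)
  fix Y assume Y: "Y \<in> carrier A"
  have "(\<Oplus>\<^bsub>A\<^esub>k\<in>K. \<phi> (u k \<star> (X \<oplus>\<^bsub>A\<^esub> Y)) *\<^sub>A w k) =
      (\<Oplus>\<^bsub>A\<^esub>k\<in>K. \<phi> (u k \<star> X) *\<^sub>A w k \<oplus>\<^bsub>A\<^esub> \<phi> (u k \<star> Y) *\<^sub>A w k)"
    by (rule A.finsum_cong') (simp_all add: X Y AR.r_distr d A.smult_add_left)
  also have "\<dots> = (\<Oplus>\<^bsub>A\<^esub>k\<in>K. \<phi> (u k \<star> X) *\<^sub>A w k) \<oplus>\<^bsub>A\<^esub> (\<Oplus>\<^bsub>A\<^esub>k\<in>K. \<phi> (u k \<star> Y) *\<^sub>A w k)"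
    by (rule A.finsum_addf) simp_all
  finally show "S (X \<oplus>\<^bsub>A\<^esub> Y) = S X \<oplus>\<^bsub>A\<^esub> S Y"
    unfolding S_sum[OF X] S_sum[OF Y] S_sum[OF A.a_closed[OF X Y]] .
qed

lemma S_closed [simp]: "X \<in> carrier A \<Longrightarrow> S X \<in> carrier A"
  by (rule linear_mapsD(1)[OF S_linear])

lemma counit_dual: "\<epsilon> \<in> dual_space A"
  by (rule B.counit_linear)

lemma counit_left_sum: "(\<Oplus>\<^bsub>A\<^esub>k\<in>K. \<epsilon> (u k) *\<^sub>A w k) = t"
  using B.counit_left[OF t_closed] unfolding comult_t
  by (subst (asm) AA.tensor_lift_sum_of_pures[OF A.kspace_axioms functional_bilinear(1)[OF counit_dual]]) simp_all

lemma counit_right_sum: "(\<Oplus>\<^bsub>A\<^esub>k\<in>K. \<epsilon> (w k) *\<^sub>A u k) = t"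
  using B.counit_right[OF t_closed] unfolding comult_t
  by (subst (asm) AA.tensor_lift_sum_of_pures[OF A.kspace_axioms functional_bilinear(2)[OF counit_dual]]) simp_all

text \<open>Apply \<open>\<epsilon>\<close> to \<open>S(X) = \<Sum> \<phi>(u\<^sub>k X) w\<^sub>k\<close> and use \<open>\<epsilon> \<circ> S = \<epsilon>\<close> with the counit law
  \<open>\<Sum> \<epsilon>(w\<^sub>k) u\<^sub>k = t\<close>.\<close>

lemma phi_t_mult:
  assumes X: "X \<in> carrier A"
  shows "\<phi> (t \<star> X) = \<epsilon> X"
proof -
  have "\<phi> (t \<star> X) = (\<Sum>k\<in>K. \<phi> ((\<epsilon> (w k) *\<^sub>A u k) \<star> X))"
    unfolding counit_right_sum[symmetric]
    by (rule functional_finsum[OF dual_right_mult[OF phi_dual X]]) simp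
  also have "\<dots> = (\<Sum>k\<in>K. \<epsilon> (\<phi> (u k \<star> X) *\<^sub>A w k))"
    by (rule sum.cong) (simp_all add: X smult_mult dual_spaceD[OF phi_dual] dual_spaceD[OF counit_dual])
  also have "\<dots> = \<epsilon> (S X)"
    unfolding S_sum[OF X] by (rule functional_finsum[OF counit_dual, symmetric]) simp
  finally show ?thesis using B.counit_S[OF X] by simp
qed

lemma counit_mult: "X \<in> carrier A \<Longrightarrow> Y \<in> carrier A \<Longrightarrow> \<epsilon> (X \<star> Y) = \<epsilon> X * \<epsilon> Y"
  using ring_hom_mult[OF B.counit_hom] by simp

lemma counit_one: "\<epsilon> \<one>\<^sub>A = 1"
  using ring_hom_one[OF B.counit_hom] by simp

lemma phi_t: "\<phi> t = 1"
  using phi_t_mult[of "\<one>\<^sub>A"] counit_one by simp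

text \<open>A nonconstant monomial is nilpotent, so an algebra homomorphism into the field kills it. The
  induction climbs from \<open>v\<close> to \<open>2 v\<close>, which eventually leaves \<open>V\<close>.\<close>

lemma counit_monom: "v \<in> V \<Longrightarrow> v \<noteq> (\<lambda>i. 0) \<Longrightarrow> \<epsilon> (x v) = 0"
proof (induction "weight \<tau> - weight v" arbitrary: v rule: less_induct)
  case less
  let ?v2 = "\<lambda>i. v i + v i"
  have sq: "\<epsilon> (x v) * \<epsilon> (x v) = \<epsilon> (x v \<star> x v)" by (simp add: counit_mult)
  have "\<epsilon> (x v \<star> x v) = 0"
  proof (cases "?v2 \<in> V")
    case True
    have "weight ?v2 \<le> weight \<tau>"
      using weight_diff(2)[OF True top_in_V V_le_top[OF True]] by simp
    moreover have "weight v \<noteq> 0" using weight_eq_0_iff[OF less.prems(1)] less.prems(2) by simp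
    ultimately have "weight \<tau> - weight ?v2 < weight \<tau> - weight v"
      using weight_add[OF less.prems(1) less.prems(1)] by simp
    moreover have "?v2 \<noteq> (\<lambda>i. 0)" using less.prems(2) by (auto simp: fun_eq_iff)
    ultimately have "\<epsilon> (x ?v2) = 0" using less.hyps True by blast
    then show ?thesis using True less.prems(1) by (simp add: monom_mult dual_spaceD[OF counit_dual])
  next
    case False
    have "\<epsilon> \<zero>\<^bsub>A\<^esub> = 0"
      using dual_spaceD(2)[OF counit_dual A.zero_closed, of 0] by simp
    then show ?thesis using False less.prems(1) by (simp add: monom_mult)
  qed
  then show ?case using sq by simp
qed

lemma counit_eq: "X \<in> carrier A \<Longrightarrow> \<epsilon> X = coeff (\<lambda>i. 0) X"
proof (rule functionals_eq_on_monoms[OF counit_dual coeff_linear])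
  fix v assume v: "v \<in> V"
  show "\<epsilon> (x v) = coeff (\<lambda>i. 0) (x v)"
    using counit_monom[OF v] v counit_one coeff_monom[OF v zero_in_V] by (cases "v = (\<lambda>i. 0)") (auto simp: monom_zero)
qed simp_all

text \<open>Let \<open>v\<^sub>0\<close> be an exponent of minimal weight occurring in \<open>t\<close>. Then \<open>t x\<^bsub>a-1-v\<^sub>0\<^esub>\<close> is a nonzero multiple of the
  top monomial, so \<open>\<epsilon>(x\<^bsub>a-1-v\<^sub>0\<^esub>) = \<phi>(t x\<^bsub>a-1-v\<^sub>0\<^esub>) \<noteq> 0\<close>, which forces \<open>v\<^sub>0 = a - 1\<close>, the exponent of largest
  weight.\<close>

lemma t_eq: "t = coeff \<tau> t *\<^sub>A x \<tau>"
proof (rule eq_if_coeffs_eq)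
  have top: "v = \<tau>" if v: "v \<in> V" "coeff v t \<noteq> 0" for v
  proof -
    obtain v0 where v0: "v0 \<in> V \<and> coeff v0 t \<noteq> 0" and min: "\<And>y. y \<in> V \<and> coeff y t \<noteq> 0 \<Longrightarrow> weight v0 \<le> weight y"
      using ex_has_least_nat[of "\<lambda>v. v \<in> V \<and> coeff v t \<noteq> 0" v weight] v by blast
    obtain b where b: "b \<in> carrier A" "\<And>X. X \<in> carrier A \<Longrightarrow> coeff \<tau> X = \<phi> (b \<star> X)"
      using B.frobenius_algebra coeff_linear[OF top_in_V] unfolding frobenius_algebra_def by blast
    have "1 = \<phi> (b \<star> x \<tau>)" using b(2)[of "x \<tau>"] by (simp add: coeff_monom)
    then have phi_top: "\<phi> (x \<tau>) \<noteq> 0" using b(1) by (auto simp: mult_top dual_spaceD[OF phi_dual])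
    have "\<phi> (t \<star> x (co v0)) = coeff v0 t * qp v0 (co v0) * \<phi> (x \<tau>)"
      using v0 min by (subst mult_co_minimal) (simp_all add: dual_spaceD[OF phi_dual])
    then have "\<epsilon> (x (co v0)) \<noteq> 0" using v0 phi_top by (simp add: phi_t_mult)
    then have "co v0 = (\<lambda>i. 0)" using counit_monom v0 co_in_V by blast
    then have "v0 = \<tau>" using v0 co_co co_zero by metis
    then have "weight \<tau> \<le> weight v" using min v by blast
    then show ?thesis using weight_less[OF v(1) top_in_V V_le_top[OF v(1)]] by linarith
  qed
  fix v assume v: "v \<in> V"
  then show "coeff v t = coeff v (coeff \<tau> t *\<^sub>A x \<tau>)"
    using top[OF v] by (auto simp: coeff_smult coeff_monom)
qed simp_all

lemma coeff_top_t: "coeff \<tau> t \<noteq> 0"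
proof
  assume "coeff \<tau> t = 0"
  then have "t = \<zero>\<^bsub>A\<^esub>" using t_eq by simp
  then show False using phi_t dual_spaceD(2)[OF phi_dual A.zero_closed, of 0] by simp
qed

lemma phi_top: "\<phi> (x \<tau>) \<noteq> 0"
  using phi_t t_eq dual_spaceD(2)[OF phi_dual, of "x \<tau>" "coeff \<tau> t"] by auto

text \<open>As \<open>t\<close> lies in the socle, \<open>u\<^sub>k t = \<epsilon>(u\<^sub>k) t\<close>, and \<open>S(t)\<close> reduces to the counit law
  \<open>\<Sum> \<epsilon>(u\<^sub>k) w\<^sub>k = t\<close>.\<close>

lemma S_t: "S t = t"
proof -
  have "\<phi> (u k \<star> t) = \<epsilon> (u k)" if k: "k \<in> K" for k
  proof -
    have "u k \<star> t = coeff \<tau> t *\<^sub>A (u k \<star> x \<tau>)"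
      using k by (subst t_eq) (simp add: smult_mult)
    also have "\<dots> = \<epsilon> (u k) *\<^sub>A (coeff \<tau> t *\<^sub>A x \<tau>)"
      using k by (simp add: mult_top counit_eq A.smult_smult mult.commute)
    also have "\<dots> = \<epsilon> (u k) *\<^sub>A t" by (simp flip: t_eq)
    finally show ?thesis by (simp add: dual_spaceD[OF phi_dual] phi_t)
  qed
  then have "S t = (\<Oplus>\<^bsub>A\<^esub>k\<in>K. \<epsilon> (u k) *\<^sub>A w k)"
    unfolding S_sum[OF t_closed] by (intro A.finsum_cong') simp_all
  then show ?thesis using counit_left_sum by simp
qed

lemma S_top: "S (x \<tau>) = x \<tau>"
proof -
  have "coeff \<tau> t *\<^sub>A S (x \<tau>) = coeff \<tau> t *\<^sub>A x \<tau>"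
    using S_t t_eq linear_mapsD(3)[OF S_linear monom_closed, of "coeff \<tau> t" \<tau>] by simp
  then have "inverse (coeff \<tau> t) *\<^sub>A (coeff \<tau> t *\<^sub>A S (x \<tau>)) = inverse (coeff \<tau> t) *\<^sub>A (coeff \<tau> t *\<^sub>A x \<tau>)"
    by simp
  then show ?thesis using coeff_top_t by (simp add: A.smult_smult)
qed

text \<open>\<open>S(x\<^sub>v)\<close> is a factor of \<open>S(x\<^bsub>a-1\<^esub>) = x\<^bsub>a-1\<^esub> \<noteq> 0\<close>.\<close>

lemma c_nonzero:
  assumes v: "v \<in> V"
  shows "c v \<noteq> 0"
proof
  assume "c v = 0"
  then have 0: "S (x v) = \<zero>\<^bsub>A\<^esub>" using S_monom[OF v] v by simp
  have "x (co v) \<star> x v = qp (co v) v *\<^sub>A x \<tau>"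
    using v add_eq_top_iff[of "co v" v] by (simp add: monom_mult)
  then have "qp (co v) v *\<^sub>A x \<tau> = S (x (co v) \<star> x v)"
    by (simp add: linear_mapsD(3)[OF S_linear] S_top)
  also have "\<dots> = \<zero>\<^bsub>A\<^esub>" by (simp add: B.S_mult 0)
  finally have "coeff \<tau> (qp (co v) v *\<^sub>A x \<tau>) = 0" by simp
  then show False by (simp add: coeff_smult coeff_monom)
qed

lemma \<sigma>_zero: "\<sigma> (\<lambda>i. 0) = (\<lambda>i. 0)" and c_zero: "c (\<lambda>i. 0) = 1"
proof -
  have "c (\<lambda>i. 0) *\<^sub>A x (\<sigma> (\<lambda>i. 0)) = 1 *\<^sub>A x (\<lambda>i. 0)"
    using S_monom[OF zero_in_V] B.S_one by (simp add: monom_zero)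
  then have "\<sigma> (\<lambda>i. 0) = (\<lambda>i. 0) \<and> c (\<lambda>i. 0) = 1"
    by (subst (asm) smult_monom_eq_iff) (simp_all add: c_nonzero)
  then show "\<sigma> (\<lambda>i. 0) = (\<lambda>i. 0)" "c (\<lambda>i. 0) = 1" by blast+
qed

text \<open>\<open>S\<close> reverses products, and the image of a nonzero product of monomials is a nonzero product of
  monomials.\<close>

lemma \<sigma>_add:
  assumes y: "y \<in> V" and v: "v \<in> V" and yv: "(\<lambda>i. y i + v i) \<in> V"
  shows "\<sigma> (\<lambda>i. y i + v i) = (\<lambda>i. \<sigma> y i + \<sigma> v i)"
    and "c (\<lambda>i. y i + v i) * qp y v = c y * c v * qp (\<sigma> v) (\<sigma> y)"
proof -
  let ?yv = "\<lambda>i. y i + v i"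
  have "(qp y v * c ?yv) *\<^sub>A x (\<sigma> ?yv) = S (x y \<star> x v)"
    using assms by (simp add: monom_mult linear_mapsD(3)[OF S_linear] S_monom A.smult_smult)
  also have "\<dots> = (c y * c v) *\<^sub>A (x (\<sigma> v) \<star> x (\<sigma> y))"
    using y v by (simp add: B.S_mult S_monom smult_mult A.smult_smult mult.commute)
  finally have eq: "(qp y v * c ?yv) *\<^sub>A x (\<sigma> ?yv) = (c y * c v) *\<^sub>A (x (\<sigma> v) \<star> x (\<sigma> y))" .
  have nz: "qp y v * c ?yv \<noteq> 0" using c_nonzero[OF yv] by simp
  have "(\<lambda>i. \<sigma> v i + \<sigma> y i) \<in> V"
  proof (rule ccontr)
    assume "(\<lambda>i. \<sigma> v i + \<sigma> y i) \<notin> V"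
    then have "coeff (\<sigma> ?yv) ((qp y v * c ?yv) *\<^sub>A x (\<sigma> ?yv)) = 0"
      unfolding eq using y v yv by (simp add: monom_mult)
    then show False using nz yv by (simp add: coeff_smult coeff_monom)
  qed
  then have "\<sigma> ?yv = (\<lambda>i. \<sigma> v i + \<sigma> y i) \<and> qp y v * c ?yv = c y * c v * qp (\<sigma> v) (\<sigma> y)"
    using eq y v yv nz by (simp add: monom_mult A.smult_smult smult_monom_eq_iff)
  then show "\<sigma> ?yv = (\<lambda>i. \<sigma> y i + \<sigma> v i)" "c ?yv * qp y v = c y * c v * qp (\<sigma> v) (\<sigma> y)"
    by (simp_all add: add.commute mult.commute)
qed

lemma basis_eq_iff: "basis_vec i = basis_vec j \<longleftrightarrow> i = j"
  by (auto simp: basis_vec_def fun_eq_iff)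

text \<open>A unit vector is not a sum of two nonzero vectors of \<open>V\<close>, so by additivity of \<open>\<sigma>\<close> its preimage cannot be
  decomposed either.\<close>

lemma basis_from_basis:
  assumes "j \<in> {1..n}"
  obtains i where "i \<in> {1..n}" "\<sigma> (basis_vec i) = basis_vec j"
proof -
  obtain v where v: "v \<in> V" "\<sigma> v = basis_vec j"
    using basis_in_V[OF assms] bij_betw_imp_surj_on[OF \<sigma>] by (metis imageE)
  have "basis_vec j \<noteq> (\<lambda>i. 0)" by (auto simp: basis_vec_def fun_eq_iff)
  then have "v \<noteq> (\<lambda>i. 0)" using v \<sigma>_zero by metis
  then obtain i y where i: "i \<in> {1..n}" "y \<in> V" "v = (\<lambda>j. basis_vec i j + y j)" using V_split[OF v(1)] by metis
  have "y = (\<lambda>i. 0)"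
  proof (rule ccontr)
    assume "y \<noteq> (\<lambda>i. 0)"
    then have "\<sigma> y \<noteq> (\<lambda>i. 0)" using \<sigma>_eq_iff[OF i(2) zero_in_V] \<sigma>_zero by simp
    moreover have "basis_vec i \<noteq> (\<lambda>i. 0)" by (auto simp: basis_vec_def fun_eq_iff)
    then have "\<sigma> (basis_vec i) \<noteq> (\<lambda>i. 0)" using \<sigma>_eq_iff[OF basis_in_V[OF i(1)] zero_in_V] \<sigma>_zero by simp
    moreover have sum: "basis_vec j k = \<sigma> (basis_vec i) k + \<sigma> y k" for k
    proof -
      have "(\<lambda>j. basis_vec i j + y j) \<in> V" using v(1) i(3) by simp
      from fun_cong[OF \<sigma>_add(1)[OF basis_in_V[OF i(1)] i(2) this], of k] show ?thesis
        using v(2) unfolding i(3) by simp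
    qed
    have "\<sigma> (basis_vec i) k \<ge> 0" "\<sigma> y k \<ge> 0" for k using V_nonneg i by simp_all
    moreover from this have "\<sigma> (basis_vec i) k = 0" "\<sigma> y k = 0" if "k \<noteq> j" for k
      using sum[of k] that by (simp_all add: basis_vec_def add_nonneg_eq_0_iff)
    ultimately have "\<sigma> (basis_vec i) j > 0" "\<sigma> y j > 0"
      by (metis order_le_less)+
    then show False using sum[of j] by (simp add: basis_vec_def)
  qed
  then show thesis using that[OF i(1)] v(2) i(3) by simp
qed

lemma basis_to_basis: "i \<in> {1..n} \<Longrightarrow> \<exists>j\<in>{1..n}. \<sigma> (basis_vec i) = basis_vec j"
proof -
  let ?E = "basis_vec ` {1..n}"
  have inj: "inj_on \<sigma> ?E" using \<sigma>_eq_iff by (auto simp: inj_on_def)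
  have "?E \<subseteq> \<sigma> ` ?E" using basis_from_basis by (metis (no_types, lifting) image_eqI image_subsetI)
  moreover have "card (\<sigma> ` ?E) = card ?E" by (rule card_image[OF inj])
  ultimately have "?E = \<sigma> ` ?E" by (intro card_subset_eq) auto
  then show "i \<in> {1..n} \<Longrightarrow> \<exists>j\<in>{1..n}. \<sigma> (basis_vec i) = basis_vec j" by blast
qed

text \<open>The identity outside \<open>{1..n}\<close>, as \<^const>\<open>permutes\<close> requires.\<close>

definition \<pi> :: "nat \<Rightarrow> nat" where
  "\<pi> i = (if i \<in> {1..n} then SOME j. j \<in> {1..n} \<and> \<sigma> (basis_vec i) = basis_vec j else i)"

lemma pi_spec: "i \<in> {1..n} \<Longrightarrow> \<pi> i \<in> {1..n} \<and> \<sigma> (basis_vec i) = basis_vec (\<pi> i)"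
proof -
  assume i: "i \<in> {1..n}"
  then have "\<exists>j. j \<in> {1..n} \<and> \<sigma> (basis_vec i) = basis_vec j" using basis_to_basis by blast
  from someI_ex[OF this] show ?thesis unfolding \<pi>_def using i by (simp only: if_True)
qed

lemma pi_permutes: "\<pi> permutes {1..n}"
proof (rule bij_imp_permutes)
  have "inj_on \<pi> {1..n}"
  proof (rule inj_onI)
    fix i j assume "i \<in> {1..n}" "j \<in> {1..n}" "\<pi> i = \<pi> j"
    then have "\<sigma> (basis_vec i) = \<sigma> (basis_vec j)" using pi_spec by metis
    then show "i = j" using \<open>i \<in> _\<close> \<open>j \<in> _\<close> \<sigma>_eq_iff basis_eq_iff by simp
  qed
  moreover have "\<pi> ` {1..n} \<subseteq> {1..n}" using pi_spec by blast
  ultimately show "bij_betw \<pi> {1..n} {1..n}"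
    by (simp add: bij_betw_def endo_inj_surj)
qed (auto simp: \<pi>_def)

lemma coeff_S:
  assumes "v \<in> V" "X \<in> carrier A"
  shows "coeff (\<sigma> v) (S X) = c v * coeff v X"
proof (rule functionals_eq_on_monoms[OF dual_comp[OF S_linear coeff_linear] _ _ assms(2)])
  show "(\<lambda>X. c v * coeff v X) \<in> dual_space A"
    using assms(1) by (intro dual_spaceI) (simp_all add: dual_spaceD[OF coeff_linear] algebra_simps)
  show "coeff (\<sigma> v) (S (x y)) = c v * coeff v (x y)" if "y \<in> V" for y
    using that assms(1) by (auto simp: S_monom coeff_smult coeff_monom \<sigma>_eq_iff)
qed (use assms in simp)

lemma S_inj: "X \<in> carrier A \<Longrightarrow> Y \<in> carrier A \<Longrightarrow> S X = S Y \<Longrightarrow> X = Y"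
  using coeff_S c_nonzero by (intro eq_if_coeffs_eq) (auto, metis mult_cancel_left)

text \<open>Since \<open>S(t) = t\<close> and \<open>S\<close> reverses \<open>\<Delta>\<close>, also \<open>\<Delta>(t) = \<Sum> S(w\<^sub>k) \<otimes> S(u\<^sub>k)\<close>. Computing \<open>S(S(b))\<close> with this
  second presentation and cancelling one \<open>S\<close> gives \<open>S(b) = \<Sum> \<phi>(S(b w\<^sub>k)) u\<^sub>k\<close>. Applying \<open>\<phi>(_ X)\<close> and using
  the first presentation of \<open>S(X)\<close> yields \<open>\<phi>(S(b) X) = \<phi>(S\<^sup>2(X) S(b))\<close>, and \<open>S\<close> is onto. In other words,
  the inverse of \<open>S\<^sup>2\<close> is the Nakayama automorphism of \<open>\<phi>\<close>.\<close>

lemma phi_S_square: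
  assumes X: "X \<in> carrier A" and v: "v \<in> V"
  shows "\<phi> (x v \<star> X) = \<phi> (S (S X) \<star> x v)"
proof -
  note phiD = dual_spaceD[OF phi_dual]
  have \<beta>: "bilinear_map A A AA.T (\<lambda>y z. pure A A (S z) (S y))"
    by (rule bilinear_mapI) (simp_all add: linear_mapsD[OF S_linear] bilinear_mapD[OF AA.pure_bilinear])
  have "\<Delta> (S t) = (\<Oplus>\<^bsub>AA.T\<^esub>k\<in>K. pure A A (S (w k)) (S (u k)))"
    unfolding B.comult_S[OF t_closed] comult_t
    by (rule AA.tensor_lift_sum_of_pures[OF AA.T.kspace_axioms \<beta>]) simp_all
  then have \<Delta>t: "\<Delta> t = (\<Oplus>\<^bsub>AA.T\<^esub>k\<in>K. pure A A (S (w k)) (S (u k)))" by (simp add: S_t)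
  have S': "S Y = (\<Oplus>\<^bsub>A\<^esub>k\<in>K. \<phi> (S (w k) \<star> Y) *\<^sub>A S (u k))" if "Y \<in> carrier A" for Y
    unfolding B.S_eq[OF that] \<Delta>t
    by (rule AA.tensor_lift_sum_of_pures[OF A.kspace_axioms functional_bilinear(1)[OF dual_right_mult[OF phi_dual that]]])
      simp_all
  have Sb: "S b = (\<Oplus>\<^bsub>A\<^esub>k\<in>K. \<phi> (S (b \<star> w k)) *\<^sub>A u k)" if b: "b \<in> carrier A" for b
  proof (rule S_inj)
    have "S (S b) = (\<Oplus>\<^bsub>A\<^esub>k\<in>K. S (\<phi> (S (b \<star> w k)) *\<^sub>A u k))"
      unfolding S'[OF S_closed[OF b]]
      by (rule A.finsum_cong') (simp_all add: b B.S_mult linear_mapsD(3)[OF S_linear])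
    also have "\<dots> = S (\<Oplus>\<^bsub>A\<^esub>k\<in>K. \<phi> (S (b \<star> w k)) *\<^sub>A u k)"
      by (rule linear_map_finsum[OF A.vectorspace_axioms A.vectorspace_axioms S_linear, symmetric]) simp
    finally show "S (S b) = \<dots>" .
  qed (simp_all add: b A.finsum_closed)
  have main: "\<phi> (S b \<star> X) = \<phi> (S (S X) \<star> S b)" if b: "b \<in> carrier A" for b
  proof -
    note l = dual_comp[OF linear_maps_comp[OF mult_right_linear[OF b] S_linear] phi_dual]
    have "\<phi> (S b \<star> X) = (\<Sum>k\<in>K. \<phi> ((\<phi> (S (b \<star> w k)) *\<^sub>A u k) \<star> X))"
      unfolding Sb[OF b] by (rule functional_finsum[OF dual_right_mult[OF phi_dual X]]) simp
    also have "\<dots> = (\<Sum>k\<in>K. \<phi> (S (b \<star> (\<phi> (u k \<star> X) *\<^sub>A w k))))"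
      by (rule sum.cong) (simp_all add: X b smult_mult phiD linear_mapsD(3)[OF S_linear])
    also have "\<dots> = \<phi> (S (b \<star> S X))"
      unfolding S_sum[OF X] by (rule functional_finsum[OF l, symmetric]) simp
    also have "\<dots> = \<phi> (S (S X) \<star> S b)" by (simp add: X b B.S_mult)
    finally show ?thesis .
  qed
  obtain y where y: "y \<in> V" "\<sigma> y = v" using v bij_betw_imp_surj_on[OF \<sigma>] by (metis imageE)
  have "S (inverse (c y) *\<^sub>A x y) = x v"
    using y c_nonzero[OF y(1)] by (simp add: linear_mapsD(3)[OF S_linear] S_monom A.smult_smult)
  then show ?thesis using main[of "inverse (c y) *\<^sub>A x y"] by simp
qed

text \<open>Take \<open>X = x\<^sub>i\<close> and the complementary monomial in \<open>phi_S_square\<close>. The left side is nonzero, while the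
  right side vanishes unless \<open>S\<^sup>2(x\<^sub>i)\<close> is a multiple of \<open>x\<^sub>i\<close>; comparing the scalars gives the second claim.\<close>

lemma pi_pi_and_c_pi:
  assumes i: "i \<in> {1..n}"
  shows "\<pi> (\<pi> i) = i" and "c (basis_vec i) * c (basis_vec (\<pi> i)) = h (basis_vec i)"
proof -
  let ?e = "basis_vec i" and ?cc = "c (basis_vec i) * c (basis_vec (\<pi> i))" and ?f = "basis_vec (\<pi> (\<pi> i))"
  have i': "\<pi> i \<in> {1..n}" "\<pi> (\<pi> i) \<in> {1..n}" using pi_spec i by blast+
  have e: "?e \<in> V" "co ?e \<in> V" "?f \<in> V" using i i' by simp_all
  have "S (S (x ?e)) = ?cc *\<^sub>A x ?f"
    using i i' pi_spec[OF i] pi_spec[OF i'(1)] by (simp add: S_monom linear_mapsD(3)[OF S_linear] A.smult_smult)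
  then have eq: "\<phi> (x (co ?e) \<star> x ?e) = ?cc * \<phi> (x ?f \<star> x (co ?e))"
    using phi_S_square[OF monom_closed e(2), of ?e] by (simp add: smult_mult dual_spaceD[OF phi_dual])
  have "(\<lambda>j. co ?e j + ?e j) = \<tau>" using add_eq_top_iff[OF e(2,1)] by simp
  then have l: "\<phi> (x (co ?e) \<star> x ?e) = qp (co ?e) ?e * \<phi> (x \<tau>)"
    using e by (simp add: monom_mult dual_spaceD[OF phi_dual])
  show "\<pi> (\<pi> i) = i"
  proof (rule ccontr)
    assume ne: "\<pi> (\<pi> i) \<noteq> i"
    have "(\<lambda>j. ?f j + co ?e j) \<notin> V"
    proof
      assume "(\<lambda>j. ?f j + co ?e j) \<in> V"
      then have "?f (\<pi> (\<pi> i)) + co ?e (\<pi> (\<pi> i)) \<le> \<tau> (\<pi> (\<pi> i))" by (rule V_le_top)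
      then show False using ne unfolding co_eq[OF e(1)] by (simp add: basis_vec_def)
    qed
    moreover have "\<phi> \<zero>\<^bsub>A\<^esub> = 0" using dual_spaceD(2)[OF phi_dual A.zero_closed, of 0] by simp
    ultimately have "qp (co ?e) ?e * \<phi> (x \<tau>) = 0" using eq l e by (simp add: monom_mult)
    then show False using phi_top by simp
  qed
  then have f: "?f = ?e" by simp
  have "(\<lambda>j. ?e j + co ?e j) = \<tau>" by (simp add: co_eq[OF e(1)])
  then have "\<phi> (x ?f \<star> x (co ?e)) = qp ?e (co ?e) * \<phi> (x \<tau>)"
    unfolding f using e by (simp add: monom_mult dual_spaceD[OF phi_dual])
  then have "qp (co ?e) ?e = ?cc * qp ?e (co ?e)" using eq l phi_top by simp
  then show "?cc = h ?e" by (simp add: h_coeff_def)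
qed

lemma \<sigma>_multiple:
  assumes i: "i \<in> {1..n}" and k: "int k \<le> a i - 1"
  shows "(\<lambda>j. int k * basis_vec i j) \<in> V \<and> \<sigma> (\<lambda>j. int k * basis_vec i j) = (\<lambda>j. int k * basis_vec (\<pi> i) j)"
  using k
proof (induction k)
  case (Suc k)
  let ?v = "\<lambda>j. int k * basis_vec i j"
  have IH: "?v \<in> V" "\<sigma> ?v = (\<lambda>j. int k * basis_vec (\<pi> i) j)" using Suc by auto
  have eq: "(\<lambda>j. int (Suc k) * basis_vec b j) = (\<lambda>j. int k * basis_vec b j + basis_vec b j)" for b
    by (simp add: algebra_simps)
  have "(\<lambda>j. ?v j + basis_vec i j) \<in> V"
  proof (rule VI)
    fix j
    show "0 \<le> ?v j + basis_vec i j" by (simp add: basis_vec_def)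
    show "?v j + basis_vec i j \<le> \<tau> j"
    proof (cases "j = i")
      case True
      have "\<tau> i = a i - 1" unfolding top_eq using i by (rule if_P)
      then show ?thesis using Suc.prems True by (simp add: basis_vec_def)
    qed (use top_nonneg[of j] in \<open>simp add: basis_vec_def\<close>)
  qed
  then show ?case
    unfolding eq using \<sigma>_add(1)[OF IH(1) basis_in_V[OF i]] IH(2) pi_spec[OF i] by simp
qed (simp add: \<sigma>_zero)

text \<open>The image of \<open>x\<^sub>i\<^bsup>a\<^sub>i-1\<^esup> \<noteq> 0\<close> is a nonzero multiple of the same power of \<open>x\<^bsub>\<pi>(i)\<^esub>\<close>, so \<open>a\<^sub>i \<le> a\<^bsub>\<pi>(i)\<^esub>\<close>,
  with equality because \<open>\<pi>\<close> is an involution. The condition on \<open>q\<close> comes from evaluating \<open>S\<close> on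
  \<open>x\<^sub>i x\<^sub>j\<close> and on \<open>x\<^sub>j x\<^sub>i\<close>.\<close>

lemma pi_compatible: "compatible n q a \<pi>"
  unfolding compatible_def
proof (intro conjI ballI pi_permutes)
  have le: "a i \<le> a (\<pi> i)" if i: "i \<in> {1..n}" for i
  proof -
    have nat: "int (nat (a i - 1)) = a i - 1" using a_ge_2[OF i] by simp
    have "(\<lambda>j. (a i - 1) * basis_vec (\<pi> i) j) \<in> V"
      using \<sigma>_multiple[OF i, of "nat (a i - 1)"] \<sigma>_in_V unfolding nat by fastforce
    then show ?thesis using V_le_top[of _ "\<pi> i"] pi_spec[OF i] by (fastforce simp: basis_vec_def top_eq)
  qed
  fix i j assume i: "i \<in> {1..n}" and j: "j \<in> {1..n}"
  show "a (\<pi> i) = a i"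
    using le[OF i] le[of "\<pi> i"] pi_spec[OF i] pi_pi_and_c_pi(1)[OF i] by simp
  show "q (\<pi> i) (\<pi> j) = q j i"
  proof (cases "i = j")
    case True
    then show ?thesis using q_diag i pi_spec[OF i] by simp
  next
    case False
    let ?i = "basis_vec i" and ?j = "basis_vec j"
    have V: "?i \<in> V" "?j \<in> V" using i j by simp_all
    have ij: "(\<lambda>k. ?i k + ?j k) \<in> V"
    proof (rule VI)
      fix k
      show "0 \<le> ?i k + ?j k" by (simp add: basis_vec_def)
      show "?i k + ?j k \<le> \<tau> k"
        using False V_le_top[OF V(1), of k] V_le_top[OF V(2), of k] by (auto simp: basis_vec_def)
    qed
    have ji: "(\<lambda>k. ?j k + ?i k) = (\<lambda>k. ?i k + ?j k)" by (simp add: add.commute)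
    have s: "\<sigma> ?i = basis_vec (\<pi> i)" "\<sigma> ?j = basis_vec (\<pi> j)" using pi_spec i j by blast+
    have p: "\<pi> i \<in> {1..n}" "\<pi> j \<in> {1..n}" using pi_spec i j by blast+
    let ?Q = "qp (basis_vec (\<pi> i)) (basis_vec (\<pi> j))" and ?c = "c (\<lambda>k. ?i k + ?j k)"
    have "?c * qp ?i ?j = c ?i * c ?j * qp (basis_vec (\<pi> j)) (basis_vec (\<pi> i))"
      using \<sigma>_add(2)[OF V ij] by (simp add: s)
    moreover have "?c * qp ?j ?i = c ?j * c ?i * ?Q"
      using \<sigma>_add(2)[OF V(2,1)] ij unfolding ji by (simp add: s)
    ultimately have "q j i * (c ?j * c ?i * ?Q) = c ?i * c ?j * (q (\<pi> i) (\<pi> j) * ?Q)"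
      using q_from_qp[OF i j] q_from_qp[OF p(2,1)] by (metis mult.left_commute)
    then show ?thesis using c_nonzero[OF V(1)] c_nonzero[OF V(2)] by simp
  qed
qed

sublocale P: antipode_scalars n a q \<pi> "\<lambda>i. c (basis_vec i)"
proof unfold_locales
  show "compatible n q a \<pi>" by (rule pi_compatible)
  show "\<pi> \<circ> \<pi> = id"
  proof
    fix i show "(\<pi> \<circ> \<pi>) i = id i"
    proof (cases "i \<in> {1..n}")
      case False
      then have "\<pi> i = i" unfolding \<pi>_def by (rule if_not_P)
      then show ?thesis by simp
    qed (use pi_pi_and_c_pi(1)[of i] in simp)
  qed
  show "c (basis_vec i) * c (basis_vec (\<pi> i)) = h (basis_vec i)" if "i \<in> {1..n}" for i
    using that by (rule pi_pi_and_c_pi(2))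
qed

text \<open>Both scalars satisfy the recursion \<open>s_add\<close> and agree on unit vectors.\<close>

lemma c_eq_s_coeff: "v \<in> V \<Longrightarrow> \<sigma> v = perm_act \<pi> v \<and> c v = P.s v"
proof (induction "weight v" arbitrary: v rule: less_induct)
  case less
  show ?case
  proof (cases "v = (\<lambda>i. 0)")
    case True
    then show ?thesis by (simp add: \<sigma>_zero c_zero P.s_coeff_zero P.perm_act_eq)
  next
    case False
    then obtain i y where i: "i \<in> {1..n}" "y \<in> V" "v = (\<lambda>j. basis_vec i j + y j)" "weight y < weight v"
      using V_split[OF less.prems] by metis
    have IH: "\<sigma> y = perm_act \<pi> y" "c y = P.s y" using less.hyps[OF i(4,2)] by blast+
    have V: "(\<lambda>j. basis_vec i j + y j) \<in> V" using i(3) less.prems by simp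
    have b: "\<sigma> (basis_vec i) = perm_act \<pi> (basis_vec i)" using pi_spec[OF i(1)] by (simp add: P.perm_act_basis)
    have "c v * qp (basis_vec i) y = P.s v * qp (basis_vec i) y"
      using \<sigma>_add(2)[OF basis_in_V[OF i(1)] i(2) V] P.s_add[of "basis_vec i" y]
      unfolding i(3) IH b P.s_coeff_basis[OF i(1)] by simp
    moreover have "\<sigma> v = perm_act \<pi> v"
      using \<sigma>_add(1)[OF basis_in_V[OF i(1)] i(2) V] unfolding i(3) IH b by (simp add: P.perm_act_eq)
    ultimately show ?thesis by simp
  qed
qed

lemma s_top: "P.s \<tau> = 1"
proof -
  have "c \<tau> *\<^sub>A x (\<sigma> \<tau>) = 1 *\<^sub>A x \<tau>" using S_monom[OF top_in_V] S_top by simp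
  then have "c \<tau> = 1" by (subst (asm) smult_monom_eq_iff) (simp_all add: c_nonzero)
  then show ?thesis using c_eq_s_coeff[OF top_in_V] by simp
qed

lemma pi_admissible:
  assumes char: "(- 1 :: 'k) \<noteq> 1"
  shows "admissible n q a \<pi>"
  unfolding admissible_def
proof (intro conjI P.compatible P.involution)
  show "card (index_I1 n q a \<pi>) + card (index_I3 n q a \<pi>) \<noteq> 0 \<or> even (card (index_J3 n q a \<pi>) div 2)"
  proof (rule disjCI)
    assume odd: "odd (card (index_J3 n q a \<pi>) div 2)"
    have "\<exists>i\<in>index_I n \<pi>. even (a i)"
    proof (rule ccontr)
      assume "\<not> ?thesis"
      then have "P.s \<tau> = (- 1) ^ (card (index_J3 n q a \<pi>) div 2)"
        by (intro P.s_top_no_even_fixed char) auto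
      then show False using odd char s_top by simp
    qed
    then obtain i where "i \<in> index_I n \<pi>" "even (a i)" by blast
    then have "i \<in> index_I1 n q a \<pi> \<or> i \<in> index_I3 n q a \<pi>"
      using P.h_cases[of i] by (auto simp: index_I1_def index_I3_def index_I_def)
    moreover have "finite (index_I1 n q a \<pi>)" "finite (index_I3 n q a \<pi>)"
      by (auto simp: index_I1_def index_I3_def index_I_def)
    ultimately show "card (index_I1 n q a \<pi>) + card (index_I3 n q a \<pi>) \<noteq> 0"
      by (auto simp: card_eq_0_iff)
  qed
qed

end

section \<open>The characterization\<close>

lemma minus_one_neq_one:
  assumes "CHAR('k::field) \<noteq> 2"
  shows "(- 1 :: 'k) \<noteq> 1"
proof
  assume "(- 1 :: 'k) = 1"
  then have "(1 + 1 :: 'k) = 0" by (metis add.right_inverse)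
  then have "of_nat 2 = (0 :: 'k)" by simp
  then have "CHAR('k) dvd 2" by (simp only: of_nat_eq_0_iff_char_dvd)
  then have "CHAR('k) \<le> 2" by (rule dvd_imp_le) simp
  moreover have "CHAR('k) \<noteq> 1" using CHAR_not_1[where ?'a = 'k] by (simp add: One_nat_def)
  moreover have "CHAR('k) \<noteq> 0" using \<open>CHAR('k) dvd 2\<close> by (metis dvd_0_left zero_neq_numeral)
  ultimately show False using assms by linarith
qed

theorem theorem7p3:
  fixes n :: nat and a :: "nat \<Rightarrow> int" and q :: "nat \<Rightarrow> nat \<Rightarrow> 'k::field"
  assumes "CHAR('k) \<noteq> 2"
    and "\<exists>r::'k. r ^ 2 = - 1"
    and "n \<ge> 2"
    and "\<And>i. i \<in> {1..n} \<Longrightarrow> a i \<ge> 2"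
    and "\<And>i. i \<in> {1..n} \<Longrightarrow> q i i = 1"
    and "\<And>i j. i \<in> {1..n} \<Longrightarrow> j \<in> {1..n} \<Longrightarrow> q i j * q j i = 1"
  shows
    "((\<exists>\<Delta> \<epsilon> \<phi> t S. bi_frobenius_algebra (qci n q a) \<Delta> \<epsilon> \<phi> t S \<and> permutation_antipode n q a S)
       \<longleftrightarrow> (\<forall>x\<in>carrier (qci n q a). qci_nakayama n q a (qci_nakayama n q a x) = x) \<and>
           (\<exists>\<pi>. admissible n q a \<pi>))
     \<and> ((\<forall>x\<in>carrier (qci n q a). qci_nakayama n q a (qci_nakayama n q a x) = x) \<longrightarrow>
         (\<forall>\<pi>. admissible n q a \<pi> \<longrightarrow>
            (\<exists>c. (\<forall>i\<in>{1..n}. c i * c (\<pi> i) = h_coeff n q a (basis_vec i)) \<and>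
                 q_perm n q a \<pi> * (\<Prod>i\<in>{1..n}. c i powi (a i - 1)) = 1 \<and>
                 bi_frobenius_algebra (qci n q a)
                   (qci_comult n q a \<pi> c) (qci_counit n q a)
                   (qci_dual n q a (top_vec n a)) (qci_monom n q a (top_vec n a))
                   (qci_antipode n q a \<pi> c))))"
proof -
  interpret Q: quantum_complete_intersection n a q
    by unfold_locales (fact assms(4-6))+
  have char: "(- 1 :: 'k) \<noteq> 1" by (rule minus_one_neq_one[OF assms(1)])
  have nak: "(\<forall>x\<in>carrier (qci n q a). qci_nakayama n q a (qci_nakayama n q a x) = x) \<longleftrightarrow>
      (\<forall>i\<in>{1..n}. h_coeff n q a (basis_vec i) ^ 2 = 1)"
    by (rule Q.nakayama_square_iff)
  have sufficient: "\<exists>c. (\<forall>i\<in>{1..n}. c i * c (\<pi> i) = h_coeff n q a (basis_vec i)) \<and>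
      q_perm n q a \<pi> * (\<Prod>i\<in>{1..n}. c i powi (a i - 1)) = 1 \<and>
      bi_frobenius_algebra (qci n q a) (qci_comult n q a \<pi> c) (qci_counit n q a)
        (qci_dual n q a (top_vec n a)) (qci_monom n q a (top_vec n a)) (qci_antipode n q a \<pi> c) \<and>
      permutation_antipode n q a (qci_antipode n q a \<pi> c)"
    if N: "\<forall>i\<in>{1..n}. h_coeff n q a (basis_vec i) ^ 2 = 1" and \<pi>: "admissible n q a \<pi>" for \<pi>
  proof -
    interpret C: compatible_involution n a q \<pi>
      by unfold_locales (use \<pi> in \<open>simp_all add: admissible_def\<close>)
    have "\<exists>c. (\<forall>i\<in>{1..n}. c i * c (\<pi> i) = h_coeff n q a (basis_vec i)) \<and>
        q_perm n q a \<pi> * (\<Prod>i\<in>{1..n}. c i powi (a i - 1)) = 1"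
      by (rule C.exists_scalars[OF _ char assms(2)]) (use N \<pi> in \<open>simp_all only: admissible_def simp_thms\<close>)
    then obtain c where c: "\<forall>i\<in>{1..n}. c i * c (\<pi> i) = h_coeff n q a (basis_vec i)"
        "q_perm n q a \<pi> * (\<Prod>i\<in>{1..n}. c i powi (a i - 1)) = 1"
      by blast
    interpret D: compatible_structure n a q \<pi> c
      by unfold_locales (use c assms(3) in \<open>simp_all add: C.s_coeff_top\<close>)
    show ?thesis using c D.bi_frobenius D.permutation_antipode_S by blast
  qed
  have necessary: "(\<forall>i\<in>{1..n}. h_coeff n q a (basis_vec i) ^ 2 = 1) \<and> (\<exists>\<pi>. admissible n q a \<pi>)"
    if B: "bi_frobenius_algebra (qci n q a) \<Delta> \<epsilon> \<phi> t S" and P: "permutation_antipode n q a S" for \<Delta> \<epsilon> \<phi> t S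
  proof -
    interpret B: bi_frobenius_algebra "qci n q a" \<Delta> \<epsilon> \<phi> t S by (rule B)
    interpret AA: tensor_pair "qci n q a" "qci n q a"
      by (rule tensor_pairI) (rule Q.A.kspace_axioms)+
    obtain \<sigma> c where \<sigma>: "bij_betw \<sigma> (exponents n a) (exponents n a)"
        "\<And>v. v \<in> exponents n a \<Longrightarrow> S (qci_monom n q a v) = c v \<odot>\<^bsub>qci n q a\<^esub> qci_monom n q a (\<sigma> v)"
      using P unfolding permutation_antipode_def by blast
    have "\<Delta> t \<in> carrier (tensor (qci n q a) (qci n q a))"
      by (rule linear_mapsD(1)[OF B.comult_linear])
        (use B.frobenius_coalgebra in \<open>unfold frobenius_coalgebra_def, blast\<close>)
    then obtain K :: "((nat list \<Rightarrow> 'k) set \<times> (nat list \<Rightarrow> 'k) set) set" and u w where K: "finite K"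
        "\<And>k. k \<in> K \<Longrightarrow> u k \<in> carrier (qci n q a)" "\<And>k. k \<in> K \<Longrightarrow> w k \<in> carrier (qci n q a)"
        "\<Delta> t = (\<Oplus>\<^bsub>tensor (qci n q a) (qci n q a)\<^esub>k\<in>K. pure (qci n q a) (qci n q a) (u k) (w k))"
      by (rule AA.tensor_sum_of_pures) (rule that)
    interpret N: bi_frobenius_permutation n a q \<Delta> \<epsilon> \<phi> t S \<sigma> c K u w
      by unfold_locales (fact \<sigma> K)+
    show ?thesis
      using N.pi_admissible[OF char] N.P.h_square by (auto simp: power2_eq_square)
  qed
  show ?thesis unfolding nak using sufficient necessary by blast
qed

end
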